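(* Let $M$ be an $F$-structure manifold of degree $K$. The $F$-structure is integrable (i.e. $N_F=0$) if and only if it is completely integrable and $$N_F(lX,mY)=-N_F(mX,lY)$$ for all vector fields $X,Y$ on $M$.
   Context: An $F$-structure manifold of degree $K$ is a smooth $n$-dimensional manifold $M$ with a nonzero smooth $(1,1)$-tensor field $F$ of constant rank $r$ satisfying $\alpha F^{K+1}+\beta F^{K}+F=0$, where $K\ge 3$ is an integer and $\alpha,\beta$ are real or complex numbers (polynomials in $F$ with complex coefficients are regarded as endomorphisms of the complexified tangent bundle). Put $l=-(\alpha F^{K}+\beta F^{K-1})$ and $m=I+\alpha F^{K}+\beta F^{K-1}$; $D_l=\mathrm{Im}\,l$ and $D_m=\mathrm{Im}\,m$ are complementary distributions of dimensions $r$ and $n-r$. For a $(1,1)$-tensor field $T$, the Nijenhuis tensor is $N_T(X,Y)=[TX,TY]-T[TX,Y]-T[X,TY]+T^2[X,Y]$; $T$ is called integrable when $N_T=0$. A distribution $D$ is integrable if through each point of $M$ there is an integral manifold of $D$ (equivalently, by Frobenius, $D$ is involutive). If $D_l$ is integrable, $F$ leaves invariant the tangent spaces of each integral manifold of $D_l$, and $\widetilde{F}$ denotes the induced $(1,1)$-tensor field on each integral manifold, $\widetilde{F}U=FU$. The $F$-structure is completely integrable if $D_l$ and $D_m$ are both integrable and the structure $\widetilde{F}$ induced from $F$ on each integral manifold of $D_l$ is integrable. *)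

theory Defs
  imports "HOL-Analysis.Analysis" "HOL-Library.Function_Algebras"
begin

section \<open>Pointwise vector space structure on functions\<close>

instantiation "fun" :: (type, scaleR) scaleR
begin
definition scaleR_fun :: "real \<Rightarrow> ('a \<Rightarrow> 'b) \<Rightarrow> 'a \<Rightarrow> 'b"
  where "scaleR_fun c f = (\<lambda>x. c *\<^sub>R f x)"
instance ..
end

instance "fun" :: (type, real_vector) real_vector
  by standard
    (simp_all add: scaleR_fun_def plus_fun_def scaleR_add_right scaleR_add_left)


section \<open>Smooth manifolds\<close>

text \<open>
  Charts take values in a linear subspace \<open>E\<close> of a Euclidean space; this makes the dimension
  a number rather than a type, so that manifolds of different dimensions (in particular a
  manifold and its submanifolds) have the same type.  In \<open>Ck_on k E W f\<close> the set \<open>W\<close> is meant to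
  be relatively open in \<open>E\<close>, so that the derivative within \<open>W\<close> is uniquely determined on \<open>E\<close>.
\<close>

primrec Ck_on ::
  "nat \<Rightarrow> 'a::real_normed_vector set \<Rightarrow> 'a set \<Rightarrow> ('a \<Rightarrow> 'b::real_normed_vector) \<Rightarrow> bool"
where
  "Ck_on 0 E W f \<longleftrightarrow> continuous_on W f"
| "Ck_on (Suc k) E W f \<longleftrightarrow>
     (\<exists>f'. (\<forall>x\<in>W. (f has_derivative f' x) (at x within W)) \<and>
           (\<forall>v\<in>E. Ck_on k E W (\<lambda>x. f' x v)))"

definition smooth_on ::
  "'a::real_normed_vector set \<Rightarrow> 'a set \<Rightarrow> ('a \<Rightarrow> 'b::real_normed_vector) \<Rightarrow> bool"
  where "smooth_on E W f \<longleftrightarrow> (\<forall>k. Ck_on k E W f)"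

text \<open>
  The underlying set of a manifold is the carrier of an abstract topology on a subset of \<open>'m\<close>;
  a submanifold can thus carry a topology finer than the subspace topology.
\<close>

record ('m, 'e) manifold =
  top_of :: "'m topology"
  model :: "'e set"
  charts :: "('m set \<times> ('m \<Rightarrow> 'e)) set"

abbreviation points :: "('m, 'e) manifold \<Rightarrow> 'm set"
  where "points M \<equiv> topspace (top_of M)"

definition is_chart :: "('m, 'e::euclidean_space) manifold \<Rightarrow> 'm set \<Rightarrow> ('m \<Rightarrow> 'e) \<Rightarrow> bool"
  where "is_chart M U \<phi> \<longleftrightarrow>
    openin (top_of M) U \<and>
    openin (top_of_set (model M)) (\<phi> ` U) \<and>
    homeomorphic_map (subtopology (top_of M) U) (top_of_set (\<phi> ` U)) \<phi>"

definition smooth_manifold :: "nat \<Rightarrow> ('m, 'e::euclidean_space) manifold \<Rightarrow> bool"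
  where "smooth_manifold n M \<longleftrightarrow>
    Hausdorff_space (top_of M) \<and> second_countable (top_of M) \<and>
    subspace (model M) \<and> dim (model M) = n \<and>
    (\<forall>(U, \<phi>)\<in>charts M. is_chart M U \<phi>) \<and>
    (\<Union>(U, \<phi>)\<in>charts M. U) = points M \<and>
    (\<forall>(U, \<phi>)\<in>charts M. \<forall>(V, \<psi>)\<in>charts M.
       smooth_on (model M) (\<phi> ` (U \<inter> V)) (\<psi> \<circ> inv_into U \<phi>))"

definition smooth_functions :: "('m, 'e::euclidean_space) manifold \<Rightarrow> ('m \<Rightarrow> real) set"
  where "smooth_functions M =
    {f. \<forall>(U, \<phi>)\<in>charts M. smooth_on (model M) (\<phi> ` U) (f \<circ> inv_into U \<phi>)}"

definition smooth_map ::
  "('k, 'd::euclidean_space) manifold \<Rightarrow> ('m, 'e::euclidean_space) manifold \<Rightarrow> ('k \<Rightarrow> 'm) \<Rightarrow> bool"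
  where "smooth_map N M h \<longleftrightarrow>
    continuous_map (top_of N) (top_of M) h \<and>
    (\<forall>(V, \<psi>)\<in>charts N. \<forall>(U, \<phi>)\<in>charts M.
       smooth_on (model N) (\<psi> ` (V \<inter> h -` U)) (\<phi> \<circ> h \<circ> inv_into V \<psi>))"


section \<open>Tangent vectors, vector fields and tensor fields\<close>

text \<open>
  A tangent vector is a derivation on smooth functions; it is set to \<open>0\<close> on non-smooth functions
  so that equality of tangent vectors is equality in HOL.
\<close>

type_synonym 'm tangent = "('m \<Rightarrow> real) \<Rightarrow> real"

definition tangent_space :: "('m, 'e::euclidean_space) manifold \<Rightarrow> 'm \<Rightarrow> 'm tangent set"
  where "tangent_space M p = {v.
    (\<forall>f\<in>smooth_functions M. \<forall>g\<in>smooth_functions M.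
        v (\<lambda>x. f x + g x) = v f + v g \<and>
        v (\<lambda>x. f x * g x) = f p * v g + v f * g p) \<and>
    (\<forall>f\<in>smooth_functions M. \<forall>c. v (\<lambda>x. c * f x) = c * v f) \<and>
    (\<forall>f. f \<notin> smooth_functions M \<longrightarrow> v f = 0)}"

definition push_forward ::
  "('m, 'e::euclidean_space) manifold \<Rightarrow> ('k \<Rightarrow> 'm) \<Rightarrow> 'k tangent \<Rightarrow> 'm tangent"
  where "push_forward M h v = (\<lambda>f. if f \<in> smooth_functions M then v (f \<circ> h) else 0)"

definition vector_fields :: "('m, 'e::euclidean_space) manifold \<Rightarrow> ('m \<Rightarrow> 'm tangent) set"
  where "vector_fields M = {X.
    (\<forall>p\<in>points M. X p \<in> tangent_space M p) \<and>
    (\<forall>f\<in>smooth_functions M. (\<lambda>p. X p f) \<in> smooth_functions M)}"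

definition lie_bracket :: "('m, 'e::euclidean_space) manifold \<Rightarrow>
    ('m \<Rightarrow> 'm tangent) \<Rightarrow> ('m \<Rightarrow> 'm tangent) \<Rightarrow> 'm \<Rightarrow> 'm tangent"
  where "lie_bracket M X Y p =
    (\<lambda>f. if f \<in> smooth_functions M then X p (\<lambda>q. Y q f) - Y p (\<lambda>q. X q f) else 0)"

definition tensor_field11 ::
  "('m, 'e::euclidean_space) manifold \<Rightarrow> ('m \<Rightarrow> 'm tangent \<Rightarrow> 'm tangent) \<Rightarrow> bool"
  where "tensor_field11 M T \<longleftrightarrow>
    (\<forall>p\<in>points M. \<forall>u\<in>tangent_space M p.
       T p u \<in> tangent_space M p \<and>
       (\<forall>v\<in>tangent_space M p. T p (u + v) = T p u + T p v) \<and>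
       (\<forall>c. T p (c *\<^sub>R u) = c *\<^sub>R T p u)) \<and>
    (\<forall>X\<in>vector_fields M. (\<lambda>p. T p (X p)) \<in> vector_fields M)"

text \<open>
  The bracket is a parameter, so that the same formula serves for real vector fields and for
  sections of the complexified tangent bundle.
\<close>

definition nijenhuis :: "(('m \<Rightarrow> 'v) \<Rightarrow> ('m \<Rightarrow> 'v) \<Rightarrow> 'm \<Rightarrow> 'v) \<Rightarrow>
    ('m \<Rightarrow> 'v \<Rightarrow> 'v::ab_group_add) \<Rightarrow> ('m \<Rightarrow> 'v) \<Rightarrow> ('m \<Rightarrow> 'v) \<Rightarrow> 'm \<Rightarrow> 'v"
  where "nijenhuis br T X Y p =
    br (\<lambda>q. T q (X q)) (\<lambda>q. T q (Y q)) p
    - T p (br (\<lambda>q. T q (X q)) Y p)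
    - T p (br X (\<lambda>q. T q (Y q)) p)
    + T p (T p (br X Y p))"

definition integrable_tensor ::
  "('m, 'e::euclidean_space) manifold \<Rightarrow> ('m \<Rightarrow> 'm tangent \<Rightarrow> 'm tangent) \<Rightarrow> bool"
  where "integrable_tensor M T \<longleftrightarrow>
    (\<forall>X\<in>vector_fields M. \<forall>Y\<in>vector_fields M. \<forall>p\<in>points M.
       nijenhuis (lie_bracket M) T X Y p = 0)"


section \<open>Complexification\<close>

text \<open>The pair \<open>(u, v)\<close> stands for \<open>u + i v\<close>, so \<open>V \<times> V\<close> is the complexification of \<open>V\<close>.\<close>

definition cscale :: "complex \<Rightarrow> 'v::real_vector \<times> 'v \<Rightarrow> 'v \<times> 'v"
  where "cscale c z =
    (Re c *\<^sub>R fst z - Im c *\<^sub>R snd z, Re c *\<^sub>R snd z + Im c *\<^sub>R fst z)"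

definition cextend :: "('v \<Rightarrow> 'v) \<Rightarrow> 'v \<times> 'v \<Rightarrow> 'v \<times> 'v"
  where "cextend T = map_prod T T"

text \<open>The complex bilinear extension of the Lie bracket.\<close>

definition clie_bracket :: "('m, 'e::euclidean_space) manifold \<Rightarrow>
    ('m \<Rightarrow> 'm tangent \<times> 'm tangent) \<Rightarrow> ('m \<Rightarrow> 'm tangent \<times> 'm tangent) \<Rightarrow>
    'm \<Rightarrow> 'm tangent \<times> 'm tangent"
  where "clie_bracket M Z W p =
    (lie_bracket M (fst \<circ> Z) (fst \<circ> W) p - lie_bracket M (snd \<circ> Z) (snd \<circ> W) p,
     lie_bracket M (fst \<circ> Z) (snd \<circ> W) p + lie_bracket M (snd \<circ> Z) (fst \<circ> W) p)"


section \<open>Integral manifolds of distributions\<close>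

text \<open>
  A distribution is given by subspaces \<open>D p\<close> of the complexified tangent spaces.  An integral
  manifold is an injectively immersed submanifold \<open>N\<close> with \<open>T\<^sub>pN \<otimes> \<complex> = D p\<close>; for the
  complexification of a real distribution \<open>D\<^sub>0\<close> this says \<open>T\<^sub>pN = D\<^sub>0 p\<close>.
\<close>

definition integral_manifold :: "('m, 'e::euclidean_space) manifold \<Rightarrow>
    ('m \<Rightarrow> ('m tangent \<times> 'm tangent) set) \<Rightarrow> ('m, 'e) manifold \<Rightarrow> bool"
  where "integral_manifold M D N \<longleftrightarrow>
    (\<exists>d. smooth_manifold d N) \<and>
    points N \<subseteq> points M \<and> smooth_map N M id \<and>
    (\<forall>p\<in>points N.
       inj_on (push_forward M id) (tangent_space N p) \<and>
       (let T = push_forward M id ` tangent_space N p in T \<times> T = D p))"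

definition integrable_distribution :: "('m, 'e::euclidean_space) manifold \<Rightarrow>
    ('m \<Rightarrow> ('m tangent \<times> 'm tangent) set) \<Rightarrow> bool"
  where "integrable_distribution M D \<longleftrightarrow>
    (\<forall>p\<in>points M. \<exists>N. integral_manifold M D N \<and> p \<in> points N)"

definition induced_tensor :: "('m, 'e::euclidean_space) manifold \<Rightarrow> ('m, 'e) manifold \<Rightarrow>
    ('m \<Rightarrow> 'm tangent \<Rightarrow> 'm tangent) \<Rightarrow> 'm \<Rightarrow> 'm tangent \<Rightarrow> 'm tangent"
  where "induced_tensor M N T p u =
    inv_into (tangent_space N p) (push_forward M id) (T p (push_forward M id u))"


section \<open>F-structures of degree K\<close>

definition l_op :: "nat \<Rightarrow> complex \<Rightarrow> complex \<Rightarrow> ('v::real_vector \<Rightarrow> 'v) \<Rightarrow> 'v \<times> 'v \<Rightarrow> 'v \<times> 'v"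
  where "l_op K \<alpha> \<beta> T z =
    - (cscale \<alpha> ((cextend T ^^ K) z) + cscale \<beta> ((cextend T ^^ (K - 1)) z))"

definition m_op :: "nat \<Rightarrow> complex \<Rightarrow> complex \<Rightarrow> ('v::real_vector \<Rightarrow> 'v) \<Rightarrow> 'v \<times> 'v \<Rightarrow> 'v \<times> 'v"
  where "m_op K \<alpha> \<beta> T z =
    z + cscale \<alpha> ((cextend T ^^ K) z) + cscale \<beta> ((cextend T ^^ (K - 1)) z)"

definition F_structure_manifold :: "('m, 'e::euclidean_space) manifold \<Rightarrow> nat \<Rightarrow> nat \<Rightarrow> nat \<Rightarrow>
    complex \<Rightarrow> complex \<Rightarrow> ('m \<Rightarrow> 'm tangent \<Rightarrow> 'm tangent) \<Rightarrow> bool"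
  where "F_structure_manifold M n r K \<alpha> \<beta> F \<longleftrightarrow>
    smooth_manifold n M \<and> tensor_field11 M F \<and>
    (\<exists>p\<in>points M. \<exists>v\<in>tangent_space M p. F p v \<noteq> 0) \<and>
    (\<forall>p\<in>points M. dim (F p ` tangent_space M p) = r) \<and>
    3 \<le> K \<and>
    (\<forall>p\<in>points M. \<forall>z\<in>tangent_space M p \<times> tangent_space M p.
       cscale \<alpha> ((cextend (F p) ^^ (K + 1)) z) + cscale \<beta> ((cextend (F p) ^^ K) z)
       + cextend (F p) z = 0)"

definition D_l :: "('m, 'e::euclidean_space) manifold \<Rightarrow> nat \<Rightarrow> complex \<Rightarrow> complex \<Rightarrow>
    ('m \<Rightarrow> 'm tangent \<Rightarrow> 'm tangent) \<Rightarrow> 'm \<Rightarrow> ('m tangent \<times> 'm tangent) set"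
  where "D_l M K \<alpha> \<beta> F p = l_op K \<alpha> \<beta> (F p) ` (tangent_space M p \<times> tangent_space M p)"

definition D_m :: "('m, 'e::euclidean_space) manifold \<Rightarrow> nat \<Rightarrow> complex \<Rightarrow> complex \<Rightarrow>
    ('m \<Rightarrow> 'm tangent \<Rightarrow> 'm tangent) \<Rightarrow> 'm \<Rightarrow> ('m tangent \<times> 'm tangent) set"
  where "D_m M K \<alpha> \<beta> F p = m_op K \<alpha> \<beta> (F p) ` (tangent_space M p \<times> tangent_space M p)"

definition completely_integrable :: "('m, 'e::euclidean_space) manifold \<Rightarrow> nat \<Rightarrow>
    complex \<Rightarrow> complex \<Rightarrow> ('m \<Rightarrow> 'm tangent \<Rightarrow> 'm tangent) \<Rightarrow> bool"
  where "completely_integrable M K \<alpha> \<beta> F \<longleftrightarrow>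
    integrable_distribution M (D_l M K \<alpha> \<beta> F) \<and>
    integrable_distribution M (D_m M K \<alpha> \<beta> F) \<and>
    (\<forall>N. integral_manifold M (D_l M K \<alpha> \<beta> F) N \<longrightarrow>
         integrable_tensor N (induced_tensor M N F))"

end

theory Submission
  imports Defs "HOL-Computational_Algebra.Polynomial"
begin

text \<open>
  Since \<open>l\<close> is the identity on \<open>Im F\<close> and \<open>F m = 0\<close>, the operators \<open>l\<close> and \<open>m\<close> are the
  complexifications of the real projections \<open>l0\<close>, \<open>m0\<close> onto \<open>Im F\<close> and \<open>Ker F\<close>.  By bilinearity
  \<open>N(X, Y)\<close> is the sum of \<open>N(l X, l Y)\<close>, \<open>N(l X, m Y) + N(m X, l Y)\<close> and \<open>N(m X, m Y)\<close>; the first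
  term is the Nijenhuis tensor of the induced structure on a leaf of \<open>D_l\<close>, and the last one is
  \<open>F\<^sup>2[m X, m Y]\<close>, which vanishes if \<open>D_m\<close> is involutive.  Conversely \<open>N = 0\<close> makes \<open>Im F\<close> and
  \<open>Ker F\<close> involutive, and Frobenius' theorem yields the integral manifolds.

  Only one leaf through a given point is needed.  In coordinates, an involutive distribution that is
  the image of a smooth projection has a frame \<open>B(x) h\<close> of commuting fields, and the leaf is a
  solution of the total differential equation \<open>D\<phi>(v) h = B(\<phi> v) h\<close>.
\<close>

section \<open>Smooth functions on open subsets of Euclidean spaces\<close>

text \<open>The imaginary part of the structure equation says that Im \<alpha> F^K + Im \<beta>
  F^(K-1) vanishes on Im F; it vanishes on Ker F because K - 1 > 0, and the two subspaces span. So
  the imaginary coefficients contribute nothing to \<open>l\<close> and \<open>m\<close>, and the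
  complex statement becomes one about pairs of real vectors. The obstacle is that tangent vectors
  are derivations of global functions, on manifolds modelled on a linear subspace. Composing charts
  with a linear projection onto the model space brings everything to open sets of the full Euclidean
  space, where derivatives are unique. Bump functions turn local data into global functions and
  fields, and Hadamard's lemma shows that a derivation is determined by its coordinate vector. A
  leaf carries its own algebra of smooth functions. Brackets on it are compared with those on
  \<open>M\<close> through related vector fields; a field on the leaf need not be the restriction of
  a given field on \<open>M\<close>, but the Nijenhuis tensor depends only on values at a point, so
  extending one value is enough.\<close>

abbreviation Ck :: "nat \<Rightarrow> 'a::real_normed_vector set \<Rightarrow> ('a \<Rightarrow> 'b::real_normed_vector) \<Rightarrow> bool"
  where "Ck k S f \<equiv> Ck_on k UNIV S f"

abbreviation smooth :: "'a::real_normed_vector set \<Rightarrow> ('a \<Rightarrow> 'b::real_normed_vector) \<Rightarrow> bool"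
  where "smooth S f \<equiv> smooth_on UNIV S f"

abbreviation Dv :: "('a::real_normed_vector \<Rightarrow> 'b::real_normed_vector) \<Rightarrow> 'a \<Rightarrow> 'a \<Rightarrow> 'b"
  where "Dv f x \<equiv> frechet_derivative f (at x)"

lemma Dv_eq: "(f has_derivative f') (at x) \<Longrightarrow> Dv f x = f'"
  by (metis frechet_derivative_at)

lemma Ck_cong:
  assumes "Ck k S f" "open S" "\<And>x. x \<in> S \<Longrightarrow> f x = g x"
  shows "Ck k S g"
  using assms(1)
proof (cases k)
  case 0
  then show ?thesis using assms by (simp cong: continuous_on_cong)
next
  case (Suc j)
  then obtain f' where f': "\<forall>x\<in>S. (f has_derivative f' x) (at x within S)" "\<forall>v. Ck j S (\<lambda>x. f' x v)"
    using assms(1) by auto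
  have "(g has_derivative f' x) (at x within S)" if "x \<in> S" for x
    using f'(1) that assms(3) by (metis has_derivative_transform)
  then show ?thesis using f'(2) Suc by auto
qed

lemma Ck_SucI:
  assumes "\<And>x. x \<in> S \<Longrightarrow> (f has_derivative f' x) (at x)" "\<And>v. Ck k S (\<lambda>x. f' x v)"
  shows "Ck (Suc k) S f"
proof -
  have "(f has_derivative f' x) (at x within S)" if "x \<in> S" for x
    by (rule has_derivative_at_withinI) (rule assms(1)[OF that])
  then show ?thesis using assms(2) by auto
qed

text \<open>On an open set the derivative within \<open>S\<close> is the full derivative and hence
  unique, so the existential witness in \<open>Ck_on\<close> agrees on \<open>S\<close> with
  \<open>Dv f\<close>. On open sets the recursion is then used in the form
  \<open>Ck_Suc_iff\<close>, with this canonical derivative.\<close>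

lemma Ck_SucE:
  assumes "Ck (Suc k) S f" "open S"
  obtains "\<And>x. x \<in> S \<Longrightarrow> (f has_derivative Dv f x) (at x)" "\<And>v. Ck k S (\<lambda>x. Dv f x v)"
proof -
  from assms(1) obtain f' where f': "\<forall>x\<in>S. (f has_derivative f' x) (at x within S)" "\<forall>v. Ck k S (\<lambda>x. f' x v)"
    by auto
  have 1: "(f has_derivative f' x) (at x)" if "x \<in> S" for x
    using f'(1) that assms(2) by (metis at_within_open)
  then have 2: "Dv f x = f' x" if "x \<in> S" for x
    using that by (metis frechet_derivative_at)
  show ?thesis
  proof (rule that)
    show "(f has_derivative Dv f x) (at x)" if "x \<in> S" for x using 1 2 that by simp
    show "Ck k S (\<lambda>x. Dv f x v)" for v
      using Ck_cong[of k S "\<lambda>x. f' x v"] f'(2) 2 assms(2) by auto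
  qed
qed

lemma Ck_Suc_iff:
  assumes "open S"
  shows "Ck (Suc k) S f \<longleftrightarrow> (\<forall>x\<in>S. (f has_derivative Dv f x) (at x)) \<and> (\<forall>v. Ck k S (\<lambda>x. Dv f x v))"
proof
  assume "Ck (Suc k) S f"
  then show "(\<forall>x\<in>S. (f has_derivative Dv f x) (at x)) \<and> (\<forall>v. Ck k S (\<lambda>x. Dv f x v))"
    by (rule Ck_SucE[OF _ assms]) simp
qed (rule Ck_SucI, auto)

declare Ck_on.simps(2) [simp del]

lemma Ck_Suc_has_derivative:
  "Ck (Suc k) S f \<Longrightarrow> open S \<Longrightarrow> x \<in> S \<Longrightarrow> (f has_derivative Dv f x) (at x)"
  by (simp add: Ck_Suc_iff)

lemma Ck_Suc_Dv: "Ck (Suc k) S f \<Longrightarrow> open S \<Longrightarrow> Ck k S (\<lambda>x. Dv f x v)"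
  by (simp add: Ck_Suc_iff)

lemma Ck_pred: "Ck (Suc k) S f \<Longrightarrow> open S \<Longrightarrow> Ck k S f"
proof (induction k arbitrary: f)
  case 0
  then have "\<forall>x\<in>S. (f has_derivative Dv f x) (at x)" by (simp add: Ck_Suc_iff)
  then show ?case
    by (auto simp: intro!: continuous_at_imp_continuous_on has_derivative_continuous)
next
  case (Suc k)
  have "(\<forall>x\<in>S. (f has_derivative Dv f x) (at x)) \<and> (\<forall>v. Ck (Suc k) S (\<lambda>x. Dv f x v))"
    using Suc.prems Ck_Suc_iff[of S "Suc k" f] by simp
  then show ?case using Suc.IH Suc.prems(2) by (intro Ck_SucI) auto
qed

lemma Ck_continuous: "Ck k S f \<Longrightarrow> open S \<Longrightarrow> continuous_on S f"
  by (induction k) (auto dest: Ck_pred)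

lemma Ck_subset: "Ck k S f \<Longrightarrow> open S \<Longrightarrow> open T \<Longrightarrow> T \<subseteq> S \<Longrightarrow> Ck k T f"
proof (induction k arbitrary: f)
  case 0
  then show ?case by (auto intro: continuous_on_subset)
next
  case (Suc k)
  then show ?case by (auto simp: Ck_Suc_iff)
qed

lemma Ck_local:
  assumes "\<And>x. x \<in> S \<Longrightarrow> \<exists>T. open T \<and> x \<in> T \<and> Ck k T f" "open S"
  shows "Ck k S f"
  using assms
proof (induction k arbitrary: f)
  case 0
  show ?case
  proof (simp, rule continuous_at_imp_continuous_on, rule)
    fix x assume "x \<in> S"
    then obtain T where "open T" "x \<in> T" "continuous_on T f" using 0 by auto
    then show "isCont f x" by (metis continuous_on_eq_continuous_at)
  qed
next
  case (Suc k)
  have "(f has_derivative Dv f x) (at x)" if "x \<in> S" for x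
    using Suc.prems(1)[OF that] by (auto simp: Ck_Suc_iff)
  moreover have "Ck k S (\<lambda>x. Dv f x v)" for v
  proof (rule Suc.IH)
    fix x assume "x \<in> S"
    then obtain T where "open T" "x \<in> T" "Ck (Suc k) T f" using Suc.prems by auto
    then show "\<exists>T. open T \<and> x \<in> T \<and> Ck k T (\<lambda>x. Dv f x v)" by (auto simp: Ck_Suc_iff)
  qed (rule Suc.prems)
  ultimately show ?case by (rule Ck_SucI)
qed

lemma Ck_const: "Ck k S (\<lambda>x. c)"
proof (induction k arbitrary: c)
  case (Suc k)
  then show ?case by (intro Ck_SucI[where f'="\<lambda>_ _. 0"]) auto
qed simp

lemma Ck_linear: "bounded_linear f \<Longrightarrow> Ck k S f"
proof (cases k)
  case 0
  assume "bounded_linear f"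
  then show ?thesis using 0 by (simp add: linear_continuous_on)
next
  case (Suc j)
  assume "bounded_linear f"
  then show ?thesis using Suc Ck_const
    by (auto intro!: Ck_SucI[where f'="\<lambda>_. f"] bounded_linear_imp_has_derivative)
qed

lemma Ck_linear_compose: "bounded_linear g \<Longrightarrow> open S \<Longrightarrow> Ck k S f \<Longrightarrow> Ck k S (\<lambda>x. g (f x))"
proof (induction k arbitrary: f)
  case 0
  then show ?case by (auto intro: bounded_linear.continuous_on)
next
  case (Suc k)
  have f: "(\<forall>x\<in>S. (f has_derivative Dv f x) (at x)) \<and> (\<forall>v. Ck k S (\<lambda>x. Dv f x v))"
    using Suc.prems by (simp add: Ck_Suc_iff)
  then show ?case using Suc
    by (intro Ck_SucI[where f'="\<lambda>x v. g (Dv f x v)"]) (auto intro: bounded_linear.has_derivative)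
qed

lemma Ck_add: "Ck k S f \<Longrightarrow> Ck k S g \<Longrightarrow> open S \<Longrightarrow> Ck k S (\<lambda>x. f x + g x)"
proof (induction k arbitrary: f g)
  case 0
  then show ?case by (auto intro: continuous_intros)
next
  case (Suc k)
  then show ?case
    by (intro Ck_SucI[where f'="\<lambda>x v. Dv f x v + Dv g x v"]) (auto simp: Ck_Suc_iff intro!: has_derivative_add)
qed

text \<open>The common source of the rules for scaling, multiplication and inner products. Each
  summand of the product rule has one undifferentiated factor, which \<open>Ck_pred\<close> weakens
  to the order of the induction hypothesis.\<close>

lemma Ck_bilinear:
  assumes "bounded_bilinear B"
  shows "Ck k S f \<Longrightarrow> Ck k S g \<Longrightarrow> open S \<Longrightarrow> Ck k S (\<lambda>x. B (f x) (g x))"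
proof (induction k arbitrary: f g)
  case 0
  then show ?case using bounded_bilinear.continuous_on[OF assms] by auto
next
  case (Suc k)
  have "Ck k S f" "Ck k S g" using Suc.prems Ck_pred by blast+
  with Suc show ?case
    by (intro Ck_SucI[where f'="\<lambda>x v. B (f x) (Dv g x v) + B (Dv f x v) (g x)"])
      (auto simp: Ck_Suc_iff intro!: Ck_add bounded_bilinear.FDERIV[OF assms])
qed

lemma Ck_scaleR: "Ck k S f \<Longrightarrow> Ck k S g \<Longrightarrow> open S \<Longrightarrow> Ck k S (\<lambda>x. f x *\<^sub>R g x)"
  by (rule Ck_bilinear[OF bounded_bilinear_scaleR])

lemma Ck_sum:
  assumes "\<And>i. i \<in> I \<Longrightarrow> Ck k S (f i)" "open S"
  shows "Ck k S (\<lambda>x. \<Sum>i\<in>I. f i x)"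
  using assms
proof (induction I rule: infinite_finite_induct)
  case (insert i I)
  then have "Ck k S (\<lambda>x. f i x + (\<Sum>i\<in>I. f i x))" by (intro Ck_add) auto
  then show ?case using insert by simp
qed (auto simp: Ck_const)

lemma Ck_inner: "Ck k S f \<Longrightarrow> open S \<Longrightarrow> Ck k S (\<lambda>x. f x \<bullet> b)"
  using Ck_linear_compose[OF bounded_linear_inner_left] by auto

lemma Ck_componentwise:
  fixes f :: "'a::real_normed_vector \<Rightarrow> 'b::euclidean_space"
  assumes "\<And>b. b \<in> Basis \<Longrightarrow> Ck k S (\<lambda>x. f x \<bullet> b)" "open S"
  shows "Ck k S f"
proof -
  have "Ck k S (\<lambda>x. \<Sum>b\<in>Basis. (f x \<bullet> b) *\<^sub>R b)"
    using assms by (intro Ck_sum Ck_scaleR Ck_const)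
  then show ?thesis by (simp add: euclidean_representation)
qed

lemma linear_expand:
  fixes f :: "'a::euclidean_space \<Rightarrow> 'b::real_vector"
  assumes "linear f"
  shows "f v = (\<Sum>b\<in>Basis. (v \<bullet> b) *\<^sub>R f b)"
  using linear_sum[OF assms, of "\<lambda>b. (v \<bullet> b) *\<^sub>R b" Basis]
  by (simp add: euclidean_representation linear_cmul[OF assms])

text \<open>In the chain rule Dg(f x)(Df x v) both the linear map and its argument vary with x.
  Expanding the argument in a basis leaves the functions Dg(.) b composed with f, for fixed b, and
  to these the induction hypothesis applies.\<close>

lemma Ck_compose:
  fixes f :: "'a::real_normed_vector \<Rightarrow> 'b::euclidean_space"
  assumes "Ck k S f" "Ck k T g" "open S" "open T" "f ` S \<subseteq> T"
  shows "Ck k S (\<lambda>x. g (f x))"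
  using assms
proof (induction k arbitrary: g)
  case 0
  then show ?case using continuous_on_compose2[of T g S f] by auto
next
  case (Suc k)
  have f: "(f has_derivative Dv f x) (at x)" if "x \<in> S" for x
    using Suc.prems that by (simp add: Ck_Suc_iff)
  have f1: "Ck k S (\<lambda>x. Dv f x v)" for v
    using Suc.prems by (simp add: Ck_Suc_iff)
  have g: "(g has_derivative Dv g x) (at x)" if "x \<in> T" for x
    using Suc.prems that by (simp add: Ck_Suc_iff)
  have g1: "Ck k T (\<lambda>x. Dv g x v)" for v
    using Suc.prems by (simp add: Ck_Suc_iff)
  have fk: "Ck k S f" using Suc.prems Ck_pred by blast
  show ?case
  proof (rule Ck_SucI[where f'="\<lambda>x v. Dv g (f x) (Dv f x v)"])
    fix x assume x: "x \<in> S"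
    then have "f x \<in> T" using Suc.prems by auto
    then show "((\<lambda>x. g (f x)) has_derivative (\<lambda>v. Dv g (f x) (Dv f x v))) (at x)"
      using has_derivative_compose[OF f[OF x] g] by simp
  next
    fix v
    have "Ck k S (\<lambda>x. \<Sum>b\<in>Basis. (Dv f x v \<bullet> b) *\<^sub>R Dv g (f x) b)"
      using Suc.prems f1 g1 fk by (intro Ck_sum Ck_scaleR Ck_inner Suc.IH) auto
    then show "Ck k S (\<lambda>x. Dv g (f x) (Dv f x v))"
    proof (rule Ck_cong)
      fix x assume "x \<in> S"
      then have "linear (Dv g (f x))" using g Suc.prems by (meson has_derivative_linear image_subset_iff)
      then show "(\<Sum>b\<in>Basis. (Dv f x v \<bullet> b) *\<^sub>R Dv g (f x) b) = Dv g (f x) (Dv f x v)"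
        by (rule linear_expand[symmetric])
    qed (use Suc.prems in auto)
  qed
qed

text \<open>The derivative of 1/x is a product of two copies of 1/x and a constant, so the order is
  raised by the product rule alone.\<close>

lemma Ck_inverse: "Ck k {x. x \<noteq> (0::real)} (\<lambda>x. 1 / x)"
proof (induction k)
  case 0
  show ?case by (auto intro!: continuous_intros)
next
  case (Suc k)
  have o: "open {x. x \<noteq> (0::real)}" by (simp add: open_Collect_neq continuous_intros)
  have "Ck k {x. x \<noteq> (0::real)} (\<lambda>x. (1/x) *\<^sub>R ((1/x) *\<^sub>R (-v)))" for v :: real
    by (intro Ck_scaleR Suc Ck_const o)
  then show ?case
    by (intro Ck_SucI[where f'="\<lambda>x v. (1/x) *\<^sub>R ((1/x) *\<^sub>R (-v))"])
      (auto intro!: derivative_eq_intros simp: divide_simps power2_eq_square)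
qed

lemma smooth_cong: "smooth S f \<Longrightarrow> open S \<Longrightarrow> (\<And>x. x \<in> S \<Longrightarrow> f x = g x) \<Longrightarrow> smooth S g"
  unfolding smooth_on_def by (meson Ck_cong)

lemma smooth_continuous: "smooth S f \<Longrightarrow> open S \<Longrightarrow> continuous_on S f"
  unfolding smooth_on_def by (meson Ck_continuous)

lemma smooth_subset: "smooth S f \<Longrightarrow> open S \<Longrightarrow> open T \<Longrightarrow> T \<subseteq> S \<Longrightarrow> smooth T f"
  unfolding smooth_on_def by (meson Ck_subset)

lemma smooth_local:
  "(\<And>x. x \<in> S \<Longrightarrow> \<exists>T. open T \<and> x \<in> T \<and> smooth T f) \<Longrightarrow> open S \<Longrightarrow> smooth S f"
  unfolding smooth_on_def by (meson Ck_local)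

lemma smooth_const: "smooth S (\<lambda>x. c)"
  unfolding smooth_on_def by (simp add: Ck_const)

lemma smooth_linear: "bounded_linear f \<Longrightarrow> smooth S f"
  unfolding smooth_on_def by (simp add: Ck_linear)

lemma smooth_linear_compose: "bounded_linear g \<Longrightarrow> open S \<Longrightarrow> smooth S f \<Longrightarrow> smooth S (\<lambda>x. g (f x))"
  unfolding smooth_on_def by (simp add: Ck_linear_compose)

lemma smooth_id: "smooth S (\<lambda>x. x)"
  by (rule smooth_linear) (rule bounded_linear_ident)

lemma smooth_add: "smooth S f \<Longrightarrow> smooth S g \<Longrightarrow> open S \<Longrightarrow> smooth S (\<lambda>x. f x + g x)"
  unfolding smooth_on_def by (simp add: Ck_add)

lemma smooth_scaleR: "smooth S f \<Longrightarrow> smooth S g \<Longrightarrow> open S \<Longrightarrow> smooth S (\<lambda>x. f x *\<^sub>R g x)"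
  unfolding smooth_on_def by (simp add: Ck_scaleR)

lemma smooth_mult: "smooth S f \<Longrightarrow> smooth S g \<Longrightarrow> open S \<Longrightarrow> smooth S (\<lambda>x. f x * g x :: real)"
  using smooth_scaleR[of S f g] by simp

lemma smooth_inner_both: "smooth S f \<Longrightarrow> smooth S g \<Longrightarrow> open S \<Longrightarrow> smooth S (\<lambda>x. f x \<bullet> g x)"
  unfolding smooth_on_def by (simp add: Ck_bilinear[OF bounded_bilinear_inner])

lemma smooth_uminus: "smooth S f \<Longrightarrow> open S \<Longrightarrow> smooth S (\<lambda>x. - f x)"
  using smooth_linear_compose[OF bounded_linear_minus[OF bounded_linear_ident]] by auto

lemma smooth_diff: "smooth S f \<Longrightarrow> smooth S g \<Longrightarrow> open S \<Longrightarrow> smooth S (\<lambda>x. f x - g x)"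
  using smooth_add[of S f "\<lambda>x. - g x"] smooth_uminus[of S g] by simp

lemma smooth_sum: "(\<And>i. i \<in> I \<Longrightarrow> smooth S (f i)) \<Longrightarrow> open S \<Longrightarrow> smooth S (\<lambda>x. \<Sum>i\<in>I. f i x)"
  unfolding smooth_on_def by (simp add: Ck_sum)

lemma smooth_inner: "smooth S f \<Longrightarrow> open S \<Longrightarrow> smooth S (\<lambda>x. f x \<bullet> b)"
  unfolding smooth_on_def by (simp add: Ck_inner)

lemma smooth_componentwise:
  fixes f :: "'a::real_normed_vector \<Rightarrow> 'b::euclidean_space"
  shows "(\<And>b. b \<in> Basis \<Longrightarrow> smooth S (\<lambda>x. f x \<bullet> b)) \<Longrightarrow> open S \<Longrightarrow> smooth S f"
  unfolding smooth_on_def by (simp add: Ck_componentwise)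

lemma smooth_compose:
  fixes f :: "'a::real_normed_vector \<Rightarrow> 'b::euclidean_space"
  shows "smooth S f \<Longrightarrow> smooth T g \<Longrightarrow> open S \<Longrightarrow> open T \<Longrightarrow> f ` S \<subseteq> T \<Longrightarrow> smooth S (\<lambda>x. g (f x))"
  unfolding smooth_on_def using Ck_compose[of _ S f T g] by blast

lemma smooth_divide:
  fixes f g :: "'a::real_normed_vector \<Rightarrow> real"
  assumes "smooth S f" "smooth S g" "open S" "\<And>x. x \<in> S \<Longrightarrow> g x \<noteq> 0"
  shows "smooth S (\<lambda>x. f x / g x)"
proof -
  have o: "open {x. x \<noteq> (0::real)}" by (simp add: open_Collect_neq continuous_intros)
  have "smooth S (\<lambda>x. 1 / g x)"
    by (rule smooth_compose[OF assms(2) _ assms(3) o, where g="\<lambda>x. 1/x"])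
      (use assms(4) Ck_inverse in \<open>auto simp: smooth_on_def\<close>)
  then have "smooth S (\<lambda>x. f x * (1 / g x))" using assms by (intro smooth_mult)
  then show ?thesis by simp
qed

lemma smooth_has_derivative: "smooth S f \<Longrightarrow> open S \<Longrightarrow> x \<in> S \<Longrightarrow> (f has_derivative Dv f x) (at x)"
  unfolding smooth_on_def by (auto intro: Ck_Suc_has_derivative)

lemma smooth_linear_Dv: "smooth S f \<Longrightarrow> open S \<Longrightarrow> x \<in> S \<Longrightarrow> linear (Dv f x)"
  by (meson smooth_has_derivative has_derivative_linear)

lemma smooth_Dv: "smooth S f \<Longrightarrow> open S \<Longrightarrow> smooth S (\<lambda>x. Dv f x v)"
  unfolding smooth_on_def by (auto intro: Ck_Suc_Dv)

lemma smooth_apply: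
  fixes g :: "'a::real_normed_vector \<Rightarrow> 'b::euclidean_space \<Rightarrow> 'c::real_normed_vector"
  assumes "\<And>v. smooth S (\<lambda>x. g x v)" "smooth S f" "open S" "\<And>x. x \<in> S \<Longrightarrow> linear (g x)"
  shows "smooth S (\<lambda>x. g x (f x))"
proof -
  have "smooth S (\<lambda>x. \<Sum>b\<in>Basis. (f x \<bullet> b) *\<^sub>R g x b)"
    using assms by (intro smooth_sum smooth_scaleR smooth_inner) auto
  then show ?thesis
    by (rule smooth_cong) (simp_all add: assms linear_expand[OF assms(4), symmetric])
qed

lemma smooth_Dv_apply:
  fixes f :: "'a::euclidean_space \<Rightarrow> 'b::real_normed_vector"
  shows "smooth S f \<Longrightarrow> smooth S g \<Longrightarrow> open S \<Longrightarrow> smooth S (\<lambda>x. Dv f x (g x))"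
  by (rule smooth_apply) (auto simp: smooth_Dv smooth_linear_Dv)

section \<open>Smoothness relative to a linear subspace\<close>

lemma open_vimage_subspace:
  fixes E W :: "'a::euclidean_space set" and \<pi> :: "'a \<Rightarrow> 'a"
  assumes W: "openin (top_of_set E) W" and pi: "linear \<pi>" "range \<pi> \<subseteq> E"
  shows "open (\<pi> -` W)"
proof -
  obtain T where "open T" "W = E \<inter> T" using W by (auto simp: openin_open)
  then have "\<pi> -` W = \<pi> -` T" using pi(2) by auto
  moreover have "open (\<pi> -` T)"
    using \<open>open T\<close> linear_continuous_on[of \<pi> UNIV] pi(1) by (intro open_vimage) (simp_all add: linear_conv_bounded_linear)
  ultimately show ?thesis by simp
qed

text \<open>A linear retraction \<pi> onto E turns derivatives within the relatively open set W into
  ordinary derivatives on the open set of points that \<pi> sends to W. The derivative of f o \<pi>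
  in direction v is f'(\<pi> x)(\<pi> v), which matches the restriction to directions in E in the
  definition of \<open>Ck_on\<close>.\<close>

lemma Ck_on_subspace_iff:
  fixes E W :: "'a::euclidean_space set" and \<pi> :: "'a \<Rightarrow> 'a"
  assumes W: "openin (top_of_set E) W" and pi: "linear \<pi>" "range \<pi> \<subseteq> E" "\<And>x. x \<in> E \<Longrightarrow> \<pi> x = x"
  shows "Ck_on k E W f \<longleftrightarrow> Ck k (\<pi> -` W) (f \<circ> \<pi>)"
proof -
  have WE: "W \<subseteq> E" using W openin_imp_subset by blast
  have pp: "\<pi> (\<pi> x) = \<pi> x" for x using pi by auto
  have bl: "bounded_linear \<pi>" using pi(1) linear_conv_bounded_linear by blast
  have cont: "continuous_on A \<pi>" for A using bl by (simp add: linear_continuous_on)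
  have o: "open (\<pi> -` W)" by (rule open_vimage_subspace[OF W pi(1,2)])
  show ?thesis
  proof (induction k arbitrary: f)
    case 0
    have "continuous_on (\<pi> -` W) (f \<circ> \<pi>)" if "continuous_on W f"
      by (rule continuous_on_compose[OF cont]) (rule continuous_on_subset[OF that], auto)
    moreover have "continuous_on W f" if "continuous_on (\<pi> -` W) (f \<circ> \<pi>)"
    proof -
      have "continuous_on W (f \<circ> \<pi>)" by (rule continuous_on_subset[OF that]) (use pi WE in auto)
      then show ?thesis by (rule continuous_on_eq) (use pi WE in auto)
    qed
    ultimately show ?case by auto
  next
    case (Suc k)
    show ?case
    proof
      assume "Ck_on (Suc k) E W f"
      then obtain f' where f': "\<And>x. x \<in> W \<Longrightarrow> (f has_derivative f' x) (at x within W)" "\<And>v. v \<in> E \<Longrightarrow> Ck_on k E W (\<lambda>x. f' x v)"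
        unfolding Ck_on.simps(2) by blast
      show "Ck (Suc k) (\<pi> -` W) (f \<circ> \<pi>)"
      proof (rule Ck_SucI[where f'="\<lambda>x v. f' (\<pi> x) (\<pi> v)"])
        fix x assume x: "x \<in> \<pi> -` W"
        have "(\<pi> has_derivative \<pi>) (at x within \<pi> -` W)" by (rule bounded_linear_imp_has_derivative[OF bl])
        moreover have "(f has_derivative f' (\<pi> x)) (at (\<pi> x) within \<pi> ` (\<pi> -` W))"
          by (rule has_derivative_subset[OF f'(1)]) (use x in auto)
        ultimately have "(f \<circ> \<pi> has_derivative f' (\<pi> x) \<circ> \<pi>) (at x within \<pi> -` W)"
          by (rule diff_chain_within)
        then show "(f \<circ> \<pi> has_derivative (\<lambda>v. f' (\<pi> x) (\<pi> v))) (at x)"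
          unfolding at_within_open[OF x o] by (simp add: o_def)
      next
        fix v
        have "\<pi> v \<in> E" using pi by auto
        from f'(2)[OF this] Suc.IH[of "\<lambda>x. f' x (\<pi> v)"]
        show "Ck k (\<pi> -` W) (\<lambda>x. f' (\<pi> x) (\<pi> v))" by (simp add: o_def)
      qed
    next
      assume C: "Ck (Suc k) (\<pi> -` W) (f \<circ> \<pi>)"
      have 1: "(f \<circ> \<pi> has_derivative Dv (f \<circ> \<pi>) x) (at x)" if "x \<in> \<pi> -` W" for x
        using C o that by (simp add: Ck_Suc_iff)
      have 2: "Ck k (\<pi> -` W) (\<lambda>x. Dv (f \<circ> \<pi>) x v)" for v
        using C o by (simp add: Ck_Suc_iff)
      show "Ck_on (Suc k) E W f"
        unfolding Ck_on.simps(2)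
      proof (intro exI[of _ "Dv (f \<circ> \<pi>)"] conjI ballI)
        fix x assume x: "x \<in> W"
        have "(f \<circ> \<pi> has_derivative Dv (f \<circ> \<pi>) x) (at x within W)"
          by (rule has_derivative_at_withinI[OF 1]) (use WE x pi in auto)
        then show "(f has_derivative Dv (f \<circ> \<pi>) x) (at x within W)"
          by (rule has_derivative_transform[OF x, rotated]) (use WE pi in auto)
      next
        fix v
        \<comment> \<open>Evaluating at \<pi> x instead of x gives a function composed with \<pi>,
          the form in which the induction hypothesis is stated.\<close>
        have "Ck k (\<pi> -` W) (\<lambda>x. Dv (f \<circ> \<pi>) (\<pi> x) v)"
          by (rule Ck_compose[OF _ 2 o o]) (use bl Ck_linear pp in auto)
        then show "Ck_on k E W (\<lambda>x. Dv (f \<circ> \<pi>) x v)"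
          using Suc.IH[of "\<lambda>x. Dv (f \<circ> \<pi>) x v"] by (simp add: o_def)
      qed
    qed
  qed
qed

subsection \<open>Bump functions\<close>

text \<open>The polynomial factor closes the family exp(-1/x) under differentiation: the derivative
  of p(1/x) exp(-1/x) is q(1/x) exp(-1/x) with q(t) = t^2 (p(t) - p'(t)). Smoothness can thus be
  proved for all p simultaneously by induction on the order.\<close>

definition exp_flat :: "real poly \<Rightarrow> real \<Rightarrow> real"
  where "exp_flat p x = (if 0 < x then poly p (1 / x) * exp (- (1 / x)) else 0)"

lemma poly_exp_tendsto_0: "((\<lambda>y. poly p y * exp (- y)) \<longlongrightarrow> (0::real)) at_top"
proof -
  have "((\<lambda>y. \<Sum>i\<le>degree p. coeff p i * (y ^ i / exp y)) \<longlongrightarrow> (\<Sum>i\<le>degree p. coeff p i * 0)) at_top"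
    by (intro tendsto_intros tendsto_power_div_exp_0)
  moreover have "(\<lambda>y. \<Sum>i\<le>degree p. coeff p i * (y ^ i / exp y)) = (\<lambda>y. poly p y * exp (- y))"
    by (simp add: poly_altdef sum_distrib_right exp_minus divide_inverse mult.assoc)
  ultimately show ?thesis by simp
qed

lemma exp_flat_has_derivative:
  "(exp_flat p has_real_derivative exp_flat ([:0,0,1:] * (p - pderiv p)) x) (at x)"
proof -
  consider "x < 0" | "x = 0" | "x > 0" by linarith
  then show ?thesis
  proof cases
    case 1
    have "((\<lambda>_. 0) has_real_derivative 0) (at x)" by simp
    then have "(exp_flat p has_real_derivative 0) (at x)"
      by (rule has_field_derivative_transform_within_open[of _ _ _ "{..<0}"]) (use 1 in \<open>auto simp: exp_flat_def\<close>)
    then show ?thesis using 1 by (simp add: exp_flat_def)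
  next
    case 3
    have "((\<lambda>x. poly p (1 / x) * exp (- (1 / x))) has_real_derivative
       exp_flat ([:0,0,1:] * (p - pderiv p)) x) (at x)"
      using 3 by (auto intro!: derivative_eq_intros simp: exp_flat_def field_simps power2_eq_square)
    then show ?thesis
      by (rule has_field_derivative_transform_within_open[of _ _ _ "{0<..}"]) (use 3 in \<open>auto simp: exp_flat_def\<close>)
  next
    case 2
    \<comment> \<open>For h > 0 the difference quotient at 0 is again of the flat form, with the
      polynomial t p(t), and 1/h tends to infinity.\<close>
    have "((\<lambda>h. poly ([:0,1:] * p) (1 / h) * exp (- (1 / h))) \<longlongrightarrow> 0) (at_right 0)"
      using poly_exp_tendsto_0[of "[:0,1:] * p"] filterlim_inverse_at_top_right
      by (auto intro: filterlim_compose simp: divide_inverse simp del: poly_mult)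
    then have R: "((\<lambda>h. exp_flat p h / h) \<longlongrightarrow> 0) (at_right 0)"
      by (rule Lim_transform_eventually)
        (auto simp: exp_flat_def eventually_at_right_less intro!: eventually_at_rightI[of 0 1])
    have L: "((\<lambda>h. exp_flat p h / h) \<longlongrightarrow> 0) (at_left 0)"
      by (rule tendsto_eventually) (auto simp: exp_flat_def intro!: eventually_at_leftI[of "-1" 0])
    have "((\<lambda>h. exp_flat p h / h) \<longlongrightarrow> 0) (at 0)"
      using L R by (simp add: filterlim_split_at)
    then have "(exp_flat p has_real_derivative 0) (at 0)"
      unfolding DERIV_def by (simp add: exp_flat_def)
    then show ?thesis using 2 by (simp add: exp_flat_def)
  qed
qed

lemma Ck_exp_flat: "Ck k UNIV (exp_flat p)"
proof (induction k arbitrary: p)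
  case 0
  then show ?case
    using exp_flat_has_derivative by (auto intro!: continuous_at_imp_continuous_on DERIV_isCont)
next
  case (Suc k)
  let ?q = "[:0,0,1:] * (p - pderiv p)"
  have "Ck k UNIV (\<lambda>x. v *\<^sub>R exp_flat ?q x)" for v :: real
    by (intro Ck_scaleR Ck_const Suc open_UNIV)
  moreover have "(exp_flat p has_derivative (\<lambda>v. v *\<^sub>R exp_flat ?q x)) (at x)" for x
    using exp_flat_has_derivative[of p x] unfolding has_field_derivative_def by (simp add: mult_commute_abs)
  ultimately show ?case by (intro Ck_SucI[where f'="\<lambda>x v. v *\<^sub>R exp_flat ?q x"])
qed

text \<open>The step is e(x) / (e(x) + e(1 - x)), where e(x) is exp(-1/x) for x > 0 and 0 otherwise.
  The denominator is positive because x and 1 - x are not both <= 0.\<close>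

lemma smooth_step_exists:
  obtains \<theta> :: "real \<Rightarrow> real"
  where "smooth UNIV \<theta>" "\<And>x. x \<le> 0 \<Longrightarrow> \<theta> x = 0" "\<And>x. x \<ge> 1 \<Longrightarrow> \<theta> x = 1"
proof -
  define e where "e = exp_flat 1"
  have e: "smooth UNIV e" unfolding e_def smooth_on_def by (simp add: Ck_exp_flat)
  have pos: "e x > 0" if "x > 0" for x using that by (simp add: e_def exp_flat_def)
  have nn: "e x \<ge> 0" for x by (simp add: e_def exp_flat_def)
  have z: "e x = 0" if "x \<le> 0" for x using that by (simp add: e_def exp_flat_def)
  have ne: "e x + e (1 - x) \<noteq> 0" for x
    using pos[of x] pos[of "1 - x"] nn[of x] nn[of "1 - x"] by (cases "x > 0") auto
  have e1: "smooth UNIV (\<lambda>x. e (1 - x))"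
    by (rule smooth_compose[OF _ e]) (auto intro!: smooth_diff smooth_const smooth_id)
  have "smooth UNIV (\<lambda>x. e x / (e x + e (1 - x)))"
    by (intro smooth_divide e smooth_add e1 open_UNIV ne)
  then show ?thesis
  proof (rule that)
    show "e x / (e x + e (1 - x)) = 1" if "x \<ge> 1" for x
      using z[of "1 - x"] ne[of x] that by simp
  qed (simp add: z)
qed

lemma bump_exists:
  fixes c :: "'a::euclidean_space"
  assumes "r > 0"
  obtains w :: "'a \<Rightarrow> real"
  where "smooth UNIV w" "\<And>x. x \<in> ball c (r / 2) \<Longrightarrow> w x = 1" "\<And>x. x \<notin> ball c r \<Longrightarrow> w x = 0"
proof -
  obtain \<theta> :: "real \<Rightarrow> real" where
    \<theta>: "smooth UNIV \<theta>" "\<And>x. x \<le> 0 \<Longrightarrow> \<theta> x = 0" "\<And>x. x \<ge> 1 \<Longrightarrow> \<theta> x = 1"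
    using smooth_step_exists by blast
  \<comment> \<open>The squared distance keeps q smooth at the centre. On the sphere of radius r/2
    the difference r^2 - |x - c|^2 is 3 r^2 / 4, so the factor makes q >= 1 inside that sphere,
    while q <= 0 outside the ball of radius r.\<close>
  define q where "q = (\<lambda>x::'a. (4 / (3 * r\<^sup>2)) * (r\<^sup>2 - (x - c) \<bullet> (x - c)))"
  have q: "smooth UNIV q" unfolding q_def
    by (intro smooth_mult smooth_diff smooth_inner_both smooth_const smooth_id open_UNIV)
  show ?thesis
  proof (rule that)
    show "smooth UNIV (\<lambda>x. \<theta> (q x))" by (rule smooth_compose[OF q \<theta>(1)]) auto
    show "\<theta> (q x) = 1" if "x \<in> ball c (r / 2)" for x
    proof (rule \<theta>(3))
      have "norm (x - c) ^ 2 \<le> (r/2)\<^sup>2"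
        using that by (intro power_mono) (auto simp: dist_norm norm_minus_commute)
      then have "4 * (r\<^sup>2 - (x - c) \<bullet> (x - c)) \<ge> 3 * r\<^sup>2"
        by (simp add: power2_norm_eq_inner power_divide)
      then show "q x \<ge> 1" using assms by (simp add: q_def field_simps)
    qed
    show "\<theta> (q x) = 0" if "x \<notin> ball c r" for x
    proof (rule \<theta>(2))
      have "norm (x - c) ^ 2 \<ge> r\<^sup>2"
        using that assms by (intro power_mono) (auto simp: dist_norm norm_minus_commute)
      then show "q x \<le> 0" using assms
        by (simp add: q_def power2_norm_eq_inner divide_nonpos_pos)
    qed
  qed
qed

subsection \<open>Hadamard's lemma\<close>

text \<open>Differentiating G(c + t (x - c)) in x produces a factor t. This is the reason for the
  weight t^j: each induction step raises j by one and replaces G by a directional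
  derivative.\<close>

lemma Ck_ray_integral:
  fixes G :: "'a::euclidean_space \<Rightarrow> real"
  assumes "Ck k (ball c r) G"
  shows "Ck k (ball c r) (\<lambda>x. integral {0..1} (\<lambda>t. t ^ j * G (c + t *\<^sub>R (x - c))))"
  using assms
proof (induction k arbitrary: G j)
  have ray: "c + t *\<^sub>R (x - c) \<in> ball c r" if "x \<in> ball c r" "t \<in> {0..1}" for x t
  proof -
    have "\<bar>t\<bar> * norm (x - c) \<le> 1 * norm (x - c)" using that by (intro mult_right_mono) auto
    then show ?thesis using that by (simp add: dist_norm norm_minus_commute)
  qed
  have cont: "continuous_on (ball c r \<times> {0..1}) (\<lambda>(x,t). t ^ j * G (c + t *\<^sub>R (x - c)))"
    if "continuous_on (ball c r) G" for G :: "'a \<Rightarrow> real" and j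
    unfolding split_beta
    by (intro continuous_intros continuous_on_compose2[OF that]) (use ray in auto)
  {
    case 0
    then have "continuous_on (ball c r) G" by simp
    from integral_continuous_on_param[of "ball c r" 0 "1::real", unfolded cbox_interval, OF cont[OF this]]
    show ?case by simp
  next
    case (Suc k)
    have G: "\<And>x. x \<in> ball c r \<Longrightarrow> (G has_derivative Dv G x) (at x)" "\<And>v. Ck k (ball c r) (\<lambda>x. Dv G x v)"
      using Suc.prems Ck_Suc_iff[OF open_ball] by blast+
    have cG: "continuous_on (ball c r) G" "\<And>v. continuous_on (ball c r) (\<lambda>x. Dv G x v)"
      using Suc.prems G(2) Ck_continuous by blast+
    \<comment> \<open>The derivative of the integrand is packed into the space of bounded linear
      maps, as \<open>leibniz_rule\<close> requires; its continuity is then checked on single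
      vectors.\<close>
    define fx where "fx = (\<lambda>x t. Blinfun (\<lambda>v. t ^ Suc j * Dv G (c + t *\<^sub>R (x - c)) v))"
    have fx: "blinfun_apply (fx x t) = (\<lambda>v. t ^ Suc j * Dv G (c + t *\<^sub>R (x - c)) v)"
      if "x \<in> ball c r" "t \<in> {0..1}" for x t
      unfolding fx_def
      by (rule bounded_linear_Blinfun_apply)
        (intro bounded_linear_const_mult has_derivative_bounded_linear[OF G(1)[OF ray[OF that]]])
    have der: "((\<lambda>x. t ^ j * G (c + t *\<^sub>R (x - c))) has_derivative blinfun_apply (fx x t)) (at x within ball c r)"
      if "x \<in> ball c r" "t \<in> {0..1}" for x t
    proof -
      have "((\<lambda>x. c + t *\<^sub>R (x - c)) has_derivative (\<lambda>v. t *\<^sub>R v)) (at x)"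
        by (auto intro!: derivative_eq_intros)
      from has_derivative_compose[OF this G(1)[OF ray[OF that]]]
      have "((\<lambda>x. t ^ j * G (c + t *\<^sub>R (x - c))) has_derivative (\<lambda>v. t ^ j * Dv G (c + t *\<^sub>R (x - c)) (t *\<^sub>R v))) (at x)"
        by (rule has_derivative_mult_right)
      moreover have "(\<lambda>v. t ^ j * Dv G (c + t *\<^sub>R (x - c)) (t *\<^sub>R v)) = blinfun_apply (fx x t)"
        unfolding fx[OF that] using linear_cmul[OF has_derivative_linear[OF G(1)[OF ray[OF that]]]]
        by (simp add: fun_eq_iff)
      ultimately show ?thesis by (metis has_derivative_at_withinI)
    qed
    have cfx: "continuous_on (ball c r \<times> {0..1}) (\<lambda>(x,t). fx x t)"
    proof (rule continuous_on_blinfun_componentwise)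
      fix i :: 'a
      show "continuous_on (ball c r \<times> {0..1}) (\<lambda>p. blinfun_apply (case p of (x, t) \<Rightarrow> fx x t) i)"
        using cont[OF cG(2)[of i], of "Suc j"]
        by (rule continuous_on_eq) (auto simp: fx)
    qed
    have int: "(\<lambda>t. t ^ j * G (c + t *\<^sub>R (x - c))) integrable_on {0..1}" if "x \<in> ball c r" for x
    proof (rule integrable_continuous_real)
      have "continuous_on {0..1} ((\<lambda>(x,t). t ^ j * G (c + t *\<^sub>R (x - c))) \<circ> Pair x)"
        by (rule continuous_on_compose) (auto intro!: continuous_intros continuous_on_subset[OF cont[OF cG(1)]] that)
      then show "continuous_on {0..1} (\<lambda>t. t ^ j * G (c + t *\<^sub>R (x - c)))" by (simp add: o_def)
    qed
    have intfx: "fx x integrable_on {0..1}" if "x \<in> ball c r" for x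
    proof (rule integrable_continuous_real)
      have "continuous_on {0..1} ((\<lambda>(x,t). fx x t) \<circ> Pair x)"
        by (rule continuous_on_compose) (auto intro!: continuous_intros continuous_on_subset[OF cfx] that)
      then show "continuous_on {0..1} (fx x)" by (simp add: o_def)
    qed
    show ?case
    proof (rule Ck_SucI)
      fix x assume x: "x \<in> ball c r"
      have "((\<lambda>x. integral (cbox 0 1) (\<lambda>t. t ^ j * G (c + t *\<^sub>R (x - c)))) has_derivative blinfun_apply (integral (cbox 0 1) (fx x))) (at x within ball c r)"
        by (rule leibniz_rule[where fx=fx]) (use der int cfx x in auto)
      moreover have "blinfun_apply (integral {0..1} (fx x)) = (\<lambda>v. integral {0..1} (\<lambda>t. t ^ Suc j * Dv G (c + t *\<^sub>R (x - c)) v))"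
      proof
        fix v
        have "blinfun_apply (integral {0..1} (fx x)) v = integral {0..1} (\<lambda>t. blinfun_apply (fx x t) v)"
          by (rule blinfun_apply_integral[OF intfx[OF x]])
        also have "\<dots> = integral {0..1} (\<lambda>t. t ^ Suc j * Dv G (c + t *\<^sub>R (x - c)) v)"
          by (rule integral_cong) (simp add: fx[OF x])
        finally show "blinfun_apply (integral {0..1} (fx x)) v = \<dots>" .
      qed
      ultimately show "((\<lambda>x. integral {0..1} (\<lambda>t. t ^ j * G (c + t *\<^sub>R (x - c)))) has_derivative
          (\<lambda>v. integral {0..1} (\<lambda>t. t ^ Suc j * Dv G (c + t *\<^sub>R (x - c)) v))) (at x)"
        unfolding at_within_open[OF x open_ball] by simp
    next
      fix v
      show "Ck k (ball c r) (\<lambda>x. integral {0..1} (\<lambda>t. t ^ Suc j * Dv G (c + t *\<^sub>R (x - c)) v))"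
        by (rule Suc.IH[OF G(2)])
    qed
  }
qed

text \<open>\<open>g b x\<close> is the mean of the partial derivative of h over the ray from c to
  x, obtained by integrating the derivative of h along that ray. The resulting products have a first
  factor that vanishes at c, so that a derivation at c sees only the values
  \<open>g b c\<close>.\<close>

lemma hadamard:
  fixes h :: "'a::euclidean_space \<Rightarrow> real"
  assumes "smooth (ball c r) h" "r > 0"
  obtains g where "\<And>b. smooth (ball c r) (g b)" "\<And>b. g b c = Dv h c b"
    "\<And>x. x \<in> ball c r \<Longrightarrow> h x = h c + (\<Sum>b\<in>Basis. ((x - c) \<bullet> b) * g b x)"
proof -
  define g where "g = (\<lambda>b x. integral {0..1} (\<lambda>t::real. Dv h (c + t *\<^sub>R (x - c)) b))"
  have D: "(h has_derivative Dv h x) (at x)" if "x \<in> ball c r" for x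
    using assms that by (intro smooth_has_derivative) auto
  have sD: "smooth (ball c r) (\<lambda>x. Dv h x v)" for v using assms by (intro smooth_Dv) auto
  show ?thesis
  proof (rule that[of g])
    show "smooth (ball c r) (g b)" for b
      using Ck_ray_integral[of _ c r "\<lambda>x. Dv h x b" 0] sD by (auto simp: smooth_on_def g_def)
    show "g b c = Dv h c b" for b by (simp add: g_def)
    fix x assume x: "x \<in> ball c r"
    have ray: "c + t *\<^sub>R (x - c) \<in> ball c r" if "t \<in> {0..1}" for t
    proof -
      have "\<bar>t\<bar> * norm (x - c) \<le> 1 * norm (x - c)" using that by (intro mult_right_mono) auto
      then show ?thesis using x by (simp add: dist_norm norm_minus_commute)
    qed
    have cD: "continuous_on {0..1} (\<lambda>t. Dv h (c + t *\<^sub>R (x - c)) b)" for b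
      by (rule continuous_on_compose2[OF smooth_continuous[OF sD open_ball]])
        (use ray in \<open>auto intro!: continuous_intros\<close>)
    have "((\<lambda>t. h (c + t *\<^sub>R (x - c))) has_vector_derivative Dv h (c + t *\<^sub>R (x - c)) (x - c)) (at t within {0..1})"
      if "t \<in> {0..1}" for t
    proof -
      have "((\<lambda>t. c + t *\<^sub>R (x - c)) has_derivative (\<lambda>s. s *\<^sub>R (x - c))) (at t)"
        by (auto intro!: derivative_eq_intros)
      from has_derivative_compose[OF this D[OF ray[OF that]]]
      have "((\<lambda>t. h (c + t *\<^sub>R (x - c))) has_derivative (\<lambda>s. s *\<^sub>R Dv h (c + t *\<^sub>R (x - c)) (x - c))) (at t)"
        by (simp only: linear_cmul[OF has_derivative_linear[OF D[OF ray[OF that]]]])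
      then show ?thesis unfolding has_vector_derivative_def by (rule has_derivative_at_withinI)
    qed
    then have "((\<lambda>t. Dv h (c + t *\<^sub>R (x - c)) (x - c)) has_integral h (c + 1 *\<^sub>R (x - c)) - h (c + 0 *\<^sub>R (x - c))) {0..1}"
      by (intro fundamental_theorem_of_calculus) auto
    then have "h x - h c = integral {0..1} (\<lambda>t. Dv h (c + t *\<^sub>R (x - c)) (x - c))"
      by (simp add: integral_unique)
    also have "\<dots> = integral {0..1} (\<lambda>t. \<Sum>b\<in>Basis. ((x - c) \<bullet> b) * Dv h (c + t *\<^sub>R (x - c)) b)"
      by (rule integral_cong)
        (use linear_expand[OF has_derivative_linear[OF D[OF ray]], of _ "x - c"] in simp)
    also have "\<dots> = (\<Sum>b\<in>Basis. integral {0..1} (\<lambda>t. ((x - c) \<bullet> b) * Dv h (c + t *\<^sub>R (x - c)) b))"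
      by (rule integral_sum) (auto intro!: integrable_continuous_real continuous_intros cD)
    also have "\<dots> = (\<Sum>b\<in>Basis. ((x - c) \<bullet> b) * g b x)"
      unfolding g_def by simp
    finally show "h x = h c + (\<Sum>b\<in>Basis. ((x - c) \<bullet> b) * g b x)" by simp
  qed
qed

subsection \<open>Inverses of smooth families of linear maps\<close>

text \<open>A product rule in which the scalar factor is merely continuous. Since g vanishes at x,
  the difference (c y - c x) g y is o(1) times O(|y - x|). It serves to differentiate an inverse
  whose continuity is known but whose differentiability is not.\<close>

lemma has_derivative_scaleR_zero:
  fixes c :: "'a::real_normed_vector \<Rightarrow> real" and g :: "'a \<Rightarrow> 'b::real_normed_vector"
  assumes c: "isCont c x" and g: "(g has_derivative g') (at x)" and z: "g x = 0"
  shows "((\<lambda>y. c y *\<^sub>R g y) has_derivative (\<lambda>h. c x *\<^sub>R g' h)) (at x)"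
proof -
  obtain C where C: "\<And>h. norm (g' h) \<le> norm h * C" "C > 0"
    using bounded_linear.pos_bounded[OF has_derivative_bounded_linear[OF g]] by blast
  have "((\<lambda>y. (c y - c x) *\<^sub>R g y) has_derivative (\<lambda>h. 0)) (at x)"
  proof (rule has_derivativeI_sandwich[of 1])
    have lim: "((\<lambda>y. norm (g y - g x - g' (y - x)) / norm (y - x)) \<longlongrightarrow> 0) (at x)"
      using g unfolding has_derivative_iff_norm by (simp add: algebra_simps)
    have c0: "((\<lambda>y. \<bar>c y - c x\<bar>) \<longlongrightarrow> 0) (at x)"
      using c unfolding isCont_def by (simp add: LIM_zero tendsto_rabs_zero)
    show "((\<lambda>y. \<bar>c y - c x\<bar> * (norm (g y - g x - g' (y - x)) / norm (y - x) + C)) \<longlongrightarrow> 0) (at x)"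
      using tendsto_mult[OF c0 tendsto_add[OF lim tendsto_const[of C]]] by simp
    fix y assume y: "y \<in> UNIV" "y \<noteq> x" "dist y x < 1"
    have "norm (g y) \<le> norm (g y - g x - g' (y - x)) + norm (g' (y - x))"
      using norm_triangle_ineq[of "g y - g x - g' (y - x)" "g' (y - x)"] z by simp
    also have "\<dots> \<le> norm (g y - g x - g' (y - x)) + norm (y - x) * C" using C by simp
    finally have "norm (g y) / norm (y - x) \<le> norm (g y - g x - g' (y - x)) / norm (y - x) + C"
      using y by (simp add: field_simps)
    then show "norm ((c y - c x) *\<^sub>R g y - (c x - c x) *\<^sub>R g x - 0) / norm (y - x)
      \<le> \<bar>c y - c x\<bar> * (norm (g y - g x - g' (y - x)) / norm (y - x) + C)"
      by (simp add: mult_left_mono flip: times_divide_eq_right)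
  qed auto
  moreover have "((\<lambda>y. c x *\<^sub>R g y) has_derivative (\<lambda>h. c x *\<^sub>R g' h)) (at x)"
    using g by (rule has_derivative_scaleR_right)
  ultimately have "((\<lambda>y. (c y - c x) *\<^sub>R g y + c x *\<^sub>R g y) has_derivative (\<lambda>h. 0 + c x *\<^sub>R g' h)) (at x)"
    by (rule has_derivative_add)
  then show ?thesis by (simp add: algebra_simps)
qed

text \<open>Where L x differs from the identity by at most 1/2 in norm it is injective, hence
  bijective. The rest follows from I y - I x = - I x (L y - L x) I y: the bound |I x v| <= 2 |v|
  gives continuity, the factor L y - L x, which vanishes at y = x, gives differentiability, and the
  formula - I x (DL) I x for the derivative raises the order step by step.\<close>

lemma smooth_inverse_family:
  fixes L :: "'a::euclidean_space \<Rightarrow> 'b::euclidean_space \<Rightarrow> 'b"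
  assumes "open H" "x0 \<in> H" and lin: "\<And>x. x \<in> H \<Longrightarrow> linear (L x)"
    and sm: "\<And>v. smooth H (\<lambda>x. L x v)" and L0: "\<And>v. L x0 v = v"
  obtains H' I where "open H'" "H' \<subseteq> H" "x0 \<in> H'"
    "\<And>x. x \<in> H' \<Longrightarrow> linear (I x)" "\<And>x v. x \<in> H' \<Longrightarrow> L x (I x v) = v"
    "\<And>x v. x \<in> H' \<Longrightarrow> I x (L x v) = v" "\<And>v. smooth H' (\<lambda>x. I x v)"
proof -
  \<comment> \<open>This sum bounds the operator norm of L x - id and is visibly continuous in
    x.\<close>
  define s where "s = (\<lambda>x. \<Sum>b\<in>Basis. norm (L x b - b))"
  have cs: "continuous_on H s" unfolding s_def
    using smooth_continuous[OF sm assms(1)] by (intro continuous_intros)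
  define H' where "H' = {x\<in>H. s x < 1/2}"
  have o: "open H'"
  proof -
    have "H' = H \<inter> s -` {..<1/2}" by (auto simp: H'_def)
    then show ?thesis using continuous_open_preimage[OF cs assms(1), of "{..<1/2}"] by auto
  qed
  have sub: "H' \<subseteq> H" by (auto simp: H'_def)
  have x0: "x0 \<in> H'" using assms by (simp add: H'_def s_def L0)
  have near: "norm (L x v - v) \<le> norm v / 2" if "x \<in> H'" for x v
  proof -
    have x: "x \<in> H" using that sub by auto
    have "L x v - v = (\<Sum>b\<in>Basis. (v \<bullet> b) *\<^sub>R L x b) - (\<Sum>b\<in>Basis. (v \<bullet> b) *\<^sub>R b)"
      using linear_expand[OF lin[OF x], of v] by (simp add: euclidean_representation)
    also have "\<dots> = (\<Sum>b\<in>Basis. (v \<bullet> b) *\<^sub>R (L x b - b))"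
      by (simp add: sum_subtractf algebra_simps)
    also have "norm \<dots> \<le> (\<Sum>b\<in>Basis. norm v * norm (L x b - b))"
      by (rule sum_norm_le) (simp add: mult_right_mono Basis_le_norm)
    also have "\<dots> = norm v * s x" by (simp add: s_def sum_distrib_left)
    also have "\<dots> \<le> norm v * (1/2)" using that by (intro mult_left_mono) (auto simp: H'_def)
    finally show ?thesis by simp
  qed
  have lower: "norm v \<le> 2 * norm (L x v)" if "x \<in> H'" for x v
    using near[OF that, of v] norm_triangle_ineq2[of v "v - L x v"] by (simp add: norm_minus_commute)
  have inj: "inj (L x)" if "x \<in> H'" for x
    unfolding linear_injective_0[OF lin[OF subsetD[OF sub that]]] using lower[OF that]
    by (metis mult_zero_right norm_le_zero_iff norm_zero)
  have surj: "surj (L x)" if "x \<in> H'" for x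
    using linear_injective_imp_surjective[OF lin inj] that sub by blast
  define I where "I = (\<lambda>x. inv (L x))"
  have LI: "L x (I x v) = v" if "x \<in> H'" for x v
    unfolding I_def using surj[OF that] by (simp add: surj_f_inv_f)
  have IL: "I x (L x v) = v" if "x \<in> H'" for x v
    unfolding I_def using inj[OF that] by simp
  have linI: "linear (I x)" if "x \<in> H'" for x
  proof (rule linearI)
    have l: "linear (L x)" using that sub lin by blast
    show "I x (u + v) = I x u + I x v" for u v
      using IL[OF that, of "I x u + I x v"] by (simp add: linear_add[OF l] LI[OF that])
    show "I x (c *\<^sub>R v) = c *\<^sub>R I x v" for c v
      using IL[OF that, of "c *\<^sub>R I x v"] by (simp add: linear_cmul[OF l] LI[OF that])
  qed
  have bdd: "norm (I x v) \<le> 2 * norm v" if "x \<in> H'" for x v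
    using lower[OF that, of "I x v"] LI[OF that] by simp
  have diff: "I y v - I x v = - I x (\<Sum>b\<in>Basis. (I y v \<bullet> b) *\<^sub>R (L y b - L x b))"
    if "x \<in> H'" "y \<in> H'" for x y v
  proof -
    have "(\<Sum>b\<in>Basis. (I y v \<bullet> b) *\<^sub>R (L y b - L x b)) = L y (I y v) - L x (I y v)"
      using linear_expand[OF lin[OF subsetD[OF sub that(2)]], of "I y v"]
        linear_expand[OF lin[OF subsetD[OF sub that(1)]], of "I y v"]
      by (simp add: sum_subtractf scaleR_diff_right)
    then show ?thesis
      using that by (simp add: LI linear_diff[OF linI] IL)
  qed
  have cont: "isCont (\<lambda>y. I y v) x" if x: "x \<in> H'" for x v
  proof -
    have "((\<lambda>y. 2 * (\<Sum>b\<in>Basis. (2 * norm v) * norm (L y b - L x b)) ) \<longlongrightarrow> 2 * (\<Sum>b\<in>Basis. (2 * norm v) * norm (L x b - L x b))) (at x)"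
      using smooth_continuous[OF sm assms(1)] x sub
      by (intro tendsto_intros) (auto simp: continuous_on_eq_continuous_at[OF assms(1)] isCont_def)
    then have l: "((\<lambda>y. 2 * (\<Sum>b\<in>Basis. (2 * norm v) * norm (L y b - L x b)) ) \<longlongrightarrow> 0) (at x)" by simp
    have "((\<lambda>y. I y v - I x v) \<longlongrightarrow> 0) (at x)"
    proof (rule tendsto_norm_zero_cancel, rule Lim_null_comparison[OF _ l])
      have "\<forall>\<^sub>F y in at x. y \<in> H'" using o x by (rule eventually_at_in_open')
      then show "\<forall>\<^sub>F y in at x. norm (norm (I y v - I x v)) \<le> 2 * (\<Sum>b\<in>Basis. (2 * norm v) * norm (L y b - L x b))"
      proof eventually_elim
        case (elim y)
        have "norm (I y v - I x v) \<le> 2 * norm (\<Sum>b\<in>Basis. (I y v \<bullet> b) *\<^sub>R (L y b - L x b))"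
          unfolding diff[OF x elim] using bdd[OF x] by simp
        also have "norm (\<Sum>b\<in>Basis. (I y v \<bullet> b) *\<^sub>R (L y b - L x b)) \<le> (\<Sum>b\<in>Basis. (2 * norm v) * norm (L y b - L x b))"
          by (rule sum_norm_le) (use bdd[OF elim, of v] Basis_le_norm[of _ "I y v"] in \<open>auto intro!: mult_right_mono intro: order_trans\<close>)
        finally show ?case by simp
      qed
    qed
    then show ?thesis unfolding isCont_def by (simp add: LIM_zero_iff)
  qed
  have der: "((\<lambda>y. I y v) has_derivative (\<lambda>h. - I x (\<Sum>b\<in>Basis. (I x v \<bullet> b) *\<^sub>R Dv (\<lambda>y. L y b) x h))) (at x)"
    if x: "x \<in> H'" for x v
  proof -
    \<comment> \<open>At this point I y v is only known to be continuous in y;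
      \<open>has_derivative_scaleR_zero\<close> applies because L y b - L x b vanishes at y =
      x.\<close>
    have "((\<lambda>y. \<Sum>b\<in>Basis. (I y v \<bullet> b) *\<^sub>R (L y b - L x b)) has_derivative
       (\<lambda>h. \<Sum>b\<in>Basis. (I x v \<bullet> b) *\<^sub>R Dv (\<lambda>y. L y b) x h)) (at x)"
    proof (intro has_derivative_sum has_derivative_scaleR_zero)
      fix b :: 'b
      show "isCont (\<lambda>y. I y v \<bullet> b) x" using cont[OF x] by (intro continuous_intros)
      have "((\<lambda>y. L y b) has_derivative Dv (\<lambda>y. L y b) x) (at x)"
        using smooth_has_derivative[OF sm assms(1)] x sub by blast
      from has_derivative_diff[OF this has_derivative_const[of "L x b"]]
      show "((\<lambda>y. L y b - L x b) has_derivative Dv (\<lambda>y. L y b) x) (at x)" by simp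
    qed simp
    then have "((\<lambda>y. I x (\<Sum>b\<in>Basis. (I y v \<bullet> b) *\<^sub>R (L y b - L x b))) has_derivative
       (\<lambda>h. I x (\<Sum>b\<in>Basis. (I x v \<bullet> b) *\<^sub>R Dv (\<lambda>y. L y b) x h))) (at x)"
      by (rule bounded_linear.has_derivative[rotated]) (use linI[OF x] linear_conv_bounded_linear in blast)
    from has_derivative_diff[OF has_derivative_const[of "I x v"] this]
    have "((\<lambda>y. I y v) has_derivative (\<lambda>h. 0 - I x (\<Sum>b\<in>Basis. (I x v \<bullet> b) *\<^sub>R Dv (\<lambda>y. L y b) x h))) (at x)"
    proof (rule has_derivative_transform_within_open[OF _ o x])
      fix y assume "y \<in> H'"
      from diff[OF x this, of v] show "I x v - I x (\<Sum>b\<in>Basis. (I y v \<bullet> b) *\<^sub>R (L y b - L x b)) = I y v"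
        by (simp add: algebra_simps)
    qed
    then show ?thesis by simp
  qed
  have "Ck k H' (\<lambda>x. I x v)" for k v
  proof (induction k arbitrary: v)
    case 0
    show ?case by (simp add: continuous_at_imp_continuous_on cont)
  next
    case (Suc k)
    show ?case
    proof (rule Ck_SucI[OF der])
      fix h
      \<comment> \<open>Expanding the derivative of L in a basis leaves \<open>I x\<close> applied
        to fixed vectors only, which the induction hypothesis covers.\<close>
      have e: "- I x (\<Sum>b\<in>Basis. (I x v \<bullet> b) *\<^sub>R Dv (\<lambda>y. L y b) x h) =
          (\<Sum>b\<in>Basis. (I x v \<bullet> b) *\<^sub>R (-1) *\<^sub>R (\<Sum>c\<in>Basis. (Dv (\<lambda>y. L y b) x h \<bullet> c) *\<^sub>R I x c))" if "x \<in> H'" for x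
      proof -
        have "I x (\<Sum>b\<in>Basis. (I x v \<bullet> b) *\<^sub>R Dv (\<lambda>y. L y b) x h)
            = (\<Sum>b\<in>Basis. (I x v \<bullet> b) *\<^sub>R I x (Dv (\<lambda>y. L y b) x h))"
          using linI[OF that] by (simp add: linear_sum linear_cmul)
        also have "\<dots> = (\<Sum>b\<in>Basis. (I x v \<bullet> b) *\<^sub>R (\<Sum>c\<in>Basis. (Dv (\<lambda>y. L y b) x h \<bullet> c) *\<^sub>R I x c))"
          by (intro sum.cong refl arg_cong2[where f=scaleR] linear_expand linI that)
        finally show ?thesis by (simp add: sum_negf)
      qed
      have "Ck k H' (\<lambda>x. Dv (\<lambda>y. L y b) x h)" for b
        using smooth_subset[OF smooth_Dv[OF sm assms(1)] assms(1) o sub] by (simp add: smooth_on_def)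
      then have "Ck k H' (\<lambda>x. \<Sum>b\<in>Basis. ((I x v \<bullet> b)) *\<^sub>R (-1) *\<^sub>R (\<Sum>c\<in>Basis. (Dv (\<lambda>y. L y b) x h \<bullet> c) *\<^sub>R I x c))"
        by (intro Ck_sum Ck_scaleR Ck_inner Suc Ck_const o)
      then show "Ck k H' (\<lambda>x. - I x (\<Sum>b\<in>Basis. (I x v \<bullet> b) *\<^sub>R Dv (\<lambda>y. L y b) x h))"
        by (rule Ck_cong[OF _ o]) (simp add: e)
    qed
  qed
  then have smI: "smooth H' (\<lambda>x. I x v)" for v by (simp add: smooth_on_def)
  show ?thesis by (rule that[OF o sub x0 linI LI IL smI])
qed

subsection \<open>Total differential equations\<close>

lemma Dv_bound_cball:
  fixes f :: "'a::euclidean_space \<Rightarrow> 'b::euclidean_space"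
  assumes "smooth H f" "open H" "cball c r \<subseteq> H"
  obtains C where "C \<ge> 0" "\<And>x v. x \<in> cball c r \<Longrightarrow> norm (Dv f x v) \<le> C * norm v"
proof -
  have "\<exists>K. \<forall>x\<in>cball c r. norm (Dv f x b) \<le> K" for b
  proof -
    have "continuous_on (cball c r) (\<lambda>x. Dv f x b)"
      using smooth_continuous[OF smooth_Dv[OF assms(1,2)] assms(2)] assms(3) by (rule continuous_on_subset)
    then have "bounded ((\<lambda>x. Dv f x b) ` cball c r)"
      by (intro compact_imp_bounded compact_continuous_image compact_cball)
    then show ?thesis by (auto simp: bounded_iff)
  qed
  then obtain K where K: "\<And>b x. x \<in> cball c r \<Longrightarrow> norm (Dv f x b) \<le> K b" by metis
  show ?thesis
  proof
    show "(\<Sum>b\<in>Basis. \<bar>K b\<bar>) \<ge> 0" by (simp add: sum_nonneg)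
    fix x v assume x: "x \<in> cball c r"
    have "Dv f x v = (\<Sum>b\<in>Basis. (v \<bullet> b) *\<^sub>R Dv f x b)"
      using x assms by (intro linear_expand smooth_linear_Dv) auto
    also have "norm \<dots> \<le> (\<Sum>b\<in>Basis. \<bar>K b\<bar> * norm v)"
    proof (rule sum_norm_le)
      fix b :: 'a assume "b \<in> Basis"
      have "\<bar>v \<bullet> b\<bar> * norm (Dv f x b) \<le> norm v * \<bar>K b\<bar>"
        using K[OF x, of b] by (intro mult_mono) (auto simp: Basis_le_norm \<open>b \<in> Basis\<close>)
      then show "norm ((v \<bullet> b) *\<^sub>R Dv f x b) \<le> \<bar>K b\<bar> * norm v" by (simp add: mult.commute)
    qed
    finally show "norm (Dv f x v) \<le> (\<Sum>b\<in>Basis. \<bar>K b\<bar>) * norm v" by (simp add: sum_distrib_right)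
  qed
qed

lemma lipschitz_cball:
  fixes f :: "'a::euclidean_space \<Rightarrow> 'b::euclidean_space"
  assumes "smooth H f" "open H" "cball c r \<subseteq> H"
  obtains C where "C \<ge> 0" "\<And>x y. x \<in> cball c r \<Longrightarrow> y \<in> cball c r \<Longrightarrow> norm (f y - f x) \<le> C * norm (y - x)"
proof -
  obtain C where C: "C \<ge> 0" "\<And>x v. x \<in> cball c r \<Longrightarrow> norm (Dv f x v) \<le> C * norm v"
    using Dv_bound_cball[OF assms] by blast
  show ?thesis
  proof (rule that[OF C(1)])
    fix x y assume "x \<in> cball c r" "y \<in> cball c r"
    then show "norm (f y - f x) \<le> C * norm (y - x)"
    proof (intro differentiable_bound[of "cball c r" f "Dv f"])
      fix z assume z: "z \<in> cball c r"
      show "onorm (Dv f z) \<le> C" by (rule onorm_le) (use C(2)[OF z] in auto)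
      show "(f has_derivative Dv f z) (at z within cball c r)"
        by (rule has_derivative_at_withinI[OF smooth_has_derivative]) (use assms z in auto)
    qed auto
  qed
qed

text \<open>The mean value inequality is applied to z -> f z - Df(x) z on the segment from x to y.
  Its derivative Df(z) - Df(x) is at most C |y - x| there, because the partial derivatives are
  Lipschitz on the ball.\<close>

lemma taylor_cball:
  fixes f :: "'a::euclidean_space \<Rightarrow> 'b::euclidean_space"
  assumes "smooth H f" "open H" "cball c r \<subseteq> H"
  obtains C where "C \<ge> 0" "\<And>x y. x \<in> cball c r \<Longrightarrow> y \<in> cball c r \<Longrightarrow>
    norm (f y - f x - Dv f x (y - x)) \<le> C * (norm (y - x))\<^sup>2"
proof -
  have "\<exists>K\<ge>0. \<forall>x\<in>cball c r. \<forall>y\<in>cball c r. norm (Dv f y b - Dv f x b) \<le> K * norm (y - x)" for b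
    using lipschitz_cball[OF smooth_Dv[OF assms(1,2)] assms(2,3)] by metis
  then obtain K where K: "\<And>b. K b \<ge> 0"
    "\<And>b x y. x \<in> cball c r \<Longrightarrow> y \<in> cball c r \<Longrightarrow> norm (Dv f y b - Dv f x b) \<le> K b * norm (y - x)" by metis
  define C where "C = (\<Sum>b\<in>Basis. K b)"
  have C0: "C \<ge> 0" using K(1) by (simp add: C_def sum_nonneg)
  have H: "x \<in> H" if "x \<in> cball c r" for x using that assms(3) by auto
  have DL: "norm (Dv f y v - Dv f x v) \<le> C * norm (y - x) * norm v" if x: "x \<in> cball c r" and y: "y \<in> cball c r" for x y v
  proof -
    have "Dv f y v - Dv f x v = (\<Sum>b\<in>Basis. (v \<bullet> b) *\<^sub>R (Dv f y b - Dv f x b))"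
      using linear_expand[OF smooth_linear_Dv[OF assms(1,2) H[OF x]], of v]
        linear_expand[OF smooth_linear_Dv[OF assms(1,2) H[OF y]], of v]
      by (simp add: sum_subtractf scaleR_diff_right)
    also have "norm \<dots> \<le> (\<Sum>b\<in>Basis. norm v * (K b * norm (y - x)))"
    proof (rule sum_norm_le)
      fix b :: 'a assume "b \<in> Basis"
      show "norm ((v \<bullet> b) *\<^sub>R (Dv f y b - Dv f x b)) \<le> norm v * (K b * norm (y - x))"
        using K(2)[OF x y, of b] by (simp, intro mult_mono) (auto simp: Basis_le_norm \<open>b \<in> Basis\<close>)
    qed
    also have "\<dots> = C * norm (y - x) * norm v"
      by (simp add: C_def sum_distrib_right sum_distrib_left mult_ac)
    finally show ?thesis .
  qed
  show ?thesis
  proof (rule that[OF C0])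
    fix x y assume x: "x \<in> cball c r" and y: "y \<in> cball c r"
    have seg: "closed_segment x y \<subseteq> cball c r" using x y convex_cball closed_segment_subset by blast
    have "norm ((f y - Dv f x y) - (f x - Dv f x x)) \<le> (C * norm (y - x)) * norm (y - x)"
    proof (rule differentiable_bound[of "closed_segment x y" "\<lambda>z. f z - Dv f x z" "\<lambda>z v. Dv f z v - Dv f x v"])
      fix z assume z: "z \<in> closed_segment x y"
      then have zc: "z \<in> cball c r" using seg by auto
      have bl: "bounded_linear (Dv f x)" using smooth_linear_Dv[OF assms(1,2) H[OF x]] by (simp add: linear_conv_bounded_linear)
      show "((\<lambda>z. f z - Dv f x z) has_derivative (\<lambda>v. Dv f z v - Dv f x v)) (at z within closed_segment x y)"
        by (intro has_derivative_diff has_derivative_at_withinI[OF smooth_has_derivative[OF assms(1,2) H[OF zc]]]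
          bounded_linear_imp_has_derivative[OF bl])
      have "norm (z - x) \<le> norm (y - x)"
        using z segment_bound1 by blast
      then have "C * norm (z - x) \<le> C * norm (y - x)" using C0 by (rule mult_left_mono)
      then have "norm (Dv f z v - Dv f x v) \<le> (C * norm (y - x)) * norm v" for v
        using DL[OF x zc, of v] mult_right_mono[of _ _ "norm v"] by (meson norm_ge_zero order_trans)
      then show "onorm (\<lambda>v. Dv f z v - Dv f x v) \<le> C * norm (y - x)" by (rule onorm_le)
    qed auto
    moreover have "(f y - Dv f x y) - (f x - Dv f x x) = f y - f x - Dv f x (y - x)"
      unfolding linear_diff[OF smooth_linear_Dv[OF assms(1,2) H[OF x]]] by simp
    ultimately show "norm (f y - f x - Dv f x (y - x)) \<le> C * (norm (y - x))\<^sup>2"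
      by (simp add: power2_eq_square mult.assoc)
  qed
qed

text \<open>The factor \<open>q\<close> is the part of the bound shared by all basis vectors (1,
  |k|, |y - x| or its square in the applications), so that the individual constants can be added
  up.\<close>

lemma linear_family_bound:
  fixes W :: "'i \<Rightarrow> 'a::euclidean_space \<Rightarrow> 'b::real_normed_vector"
  assumes "\<And>b. C b \<ge> 0" "\<And>b. b \<in> Basis \<Longrightarrow> norm (W i b) \<le> C b * q" "linear (W i)"
  shows "norm (W i v) \<le> (\<Sum>b\<in>Basis. C b) * q * norm v"
proof -
  have "W i v = (\<Sum>b\<in>Basis. (v \<bullet> b) *\<^sub>R W i b)" by (rule linear_expand[OF assms(3)])
  also have "norm \<dots> \<le> (\<Sum>b\<in>Basis. norm v * (C b * q))"
  proof (rule sum_norm_le)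
    fix b :: 'a assume b: "b \<in> Basis"
    show "norm ((v \<bullet> b) *\<^sub>R W i b) \<le> norm v * (C b * q)"
      using assms(2)[OF b] by (simp, intro mult_mono) (auto simp: Basis_le_norm b)
  qed
  also have "\<dots> = (\<Sum>b\<in>Basis. C b) * q * norm v"
    by (simp add: sum_distrib_right sum_distrib_left mult_ac)
  finally show ?thesis .
qed

lemma linear_family_Dv:
  fixes B :: "'a::euclidean_space \<Rightarrow> 'c::euclidean_space \<Rightarrow> 'b::euclidean_space"
  assumes "open H" "\<And>h. smooth H (\<lambda>x. B x h)" "\<And>x. x \<in> H \<Longrightarrow> linear (B x)" "x \<in> H"
  shows "linear (\<lambda>h. Dv (\<lambda>x. B x h) x k)"
proof -
  have D: "((\<lambda>x. B x h) has_derivative Dv (\<lambda>x. B x h) x) (at x)" for h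
    by (rule smooth_has_derivative[OF assms(2,1,4)])
  have "Dv (\<lambda>x. B x (g + h)) x = (\<lambda>k. Dv (\<lambda>x. B x g) x k + Dv (\<lambda>x. B x h) x k)" for g h
    by (rule Dv_eq, rule has_derivative_transform_within_open[OF has_derivative_add[OF D D] assms(1,4)])
      (simp add: linear_add[OF assms(3)])
  moreover have "Dv (\<lambda>x. B x (c *\<^sub>R h)) x = (\<lambda>k. c *\<^sub>R Dv (\<lambda>x. B x h) x k)" for c h
    by (rule Dv_eq, rule has_derivative_transform_within_open[OF has_derivative_scaleR_right[OF D] assms(1,4)])
      (simp add: linear_cmul[OF assms(3)])
  ultimately show ?thesis by (intro linearI) (simp_all add: fun_eq_iff)
qed

lemma gronwall_half:
  fixes w :: "real \<Rightarrow> 'a::euclidean_space"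
  assumes der: "\<And>t. t \<in> {0..1} \<Longrightarrow> (w has_vector_derivative w' t) (at t within {0..1})"
    and bd: "\<And>t. t \<in> {0..1} \<Longrightarrow> norm (w' t) \<le> norm (w t) / 2 + e" and w0: "w 0 = 0" and t: "t \<in> {0..1}"
  shows "norm (w t) \<le> 2 * e"
proof -
  have "continuous_on {0..1} w"
    unfolding continuous_on_eq_continuous_within using der has_vector_derivative_continuous by blast
  then have "continuous_on {0..1} (\<lambda>t. norm (w t))" by (intro continuous_intros)
  then obtain s where s: "s \<in> {0..1}" "\<And>t. t \<in> {0..1} \<Longrightarrow> norm (w t) \<le> norm (w s)"
    using continuous_attains_sup[of "{0..1::real}" "\<lambda>t. norm (w t)"] by auto
  define M where "M = norm (w s) / 2 + e"
  have M: "norm (w' t) \<le> M" if "t \<in> {0..1}" for t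
    using bd[OF that] s(2)[OF that] by (simp add: M_def)
  then have M0: "M \<ge> 0" using norm_ge_zero order_trans s(1) by blast
  have "norm (w s - w 0) \<le> M * norm (s - 0)"
  proof (rule differentiable_bound[of "{0..1}" w "\<lambda>t h. h *\<^sub>R w' t"])
    fix t :: real assume t: "t \<in> {0..1}"
    show "(w has_derivative (\<lambda>h. h *\<^sub>R w' t)) (at t within {0..1})"
      using der[OF t] by (simp add: has_vector_derivative_def)
    show "onorm (\<lambda>h. h *\<^sub>R w' t) \<le> M"
      by (rule onorm_le) (simp add: mult.commute[of M] mult_left_mono M[OF t])
  qed (use s in auto)
  also have "\<dots> \<le> M * 1" using s(1) M0 by (intro mult_left_mono) auto
  finally have "norm (w s) \<le> 2 * e" by (simp add: w0 M_def)
  then show ?thesis using s(2)[OF t] by simp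
qed

lemma family_bounds_cball:
  fixes B :: "'a::euclidean_space \<Rightarrow> 'c::euclidean_space \<Rightarrow> 'b::euclidean_space"
  assumes H: "open H" "cball c r \<subseteq> H" and sm: "\<And>h. smooth H (\<lambda>x. B x h)" and lin: "\<And>x. x \<in> H \<Longrightarrow> linear (B x)"
  obtains C where "C > 0"
    "\<And>x h. x \<in> cball c r \<Longrightarrow> norm (B x h) \<le> C * norm h"
    "\<And>x h k. x \<in> cball c r \<Longrightarrow> norm (Dv (\<lambda>x. B x h) x k) \<le> C * norm k * norm h"
    "\<And>x y h. x \<in> cball c r \<Longrightarrow> y \<in> cball c r \<Longrightarrow> norm (B y h - B x h) \<le> C * norm (y - x) * norm h"
    "\<And>x y h. x \<in> cball c r \<Longrightarrow> y \<in> cball c r \<Longrightarrow>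
      norm (B y h - B x h - Dv (\<lambda>x. B x h) x (y - x)) \<le> C * (norm (y - x))\<^sup>2 * norm h"
proof -
  have cH: "x \<in> H" if "x \<in> cball c r" for x using that H by auto
  have linD: "linear (\<lambda>h. Dv (\<lambda>x. B x h) x k)" if "x \<in> cball c r" for x k
    by (rule linear_family_Dv[OF H(1) sm lin cH[OF that]])
  have "\<exists>K\<ge>0. \<forall>x\<in>cball c r. norm (B x b) \<le> K" for b
  proof -
    have "continuous_on (cball c r) (\<lambda>x. B x b)"
      using smooth_continuous[OF sm H(1)] H(2) by (rule continuous_on_subset)
    then have "bounded ((\<lambda>x. B x b) ` cball c r)"
      by (intro compact_imp_bounded compact_continuous_image compact_cball)
    then show ?thesis by (auto simp: bounded_pos intro: less_imp_le)
  qed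
  then obtain C0 where C0: "\<And>b. C0 b \<ge> 0" "\<And>b x. x \<in> cball c r \<Longrightarrow> norm (B x b) \<le> C0 b" by metis
  have "\<exists>K\<ge>0. \<forall>x\<in>cball c r. \<forall>k. norm (Dv (\<lambda>x. B x b) x k) \<le> K * norm k" for b
    using Dv_bound_cball[OF sm H] by metis
  then obtain C1 where C1: "\<And>b. C1 b \<ge> 0"
    "\<And>b x k. x \<in> cball c r \<Longrightarrow> norm (Dv (\<lambda>x. B x b) x k) \<le> C1 b * norm k" by metis
  have "\<exists>K\<ge>0. \<forall>x\<in>cball c r. \<forall>y\<in>cball c r. norm (B y b - B x b) \<le> K * norm (y - x)" for b
    using lipschitz_cball[OF sm H] by metis
  then obtain C2 where C2: "\<And>b. C2 b \<ge> 0"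
    "\<And>b x y. x \<in> cball c r \<Longrightarrow> y \<in> cball c r \<Longrightarrow> norm (B y b - B x b) \<le> C2 b * norm (y - x)" by metis
  have "\<exists>K\<ge>0. \<forall>x\<in>cball c r. \<forall>y\<in>cball c r. norm (B y b - B x b - Dv (\<lambda>x. B x b) x (y - x)) \<le> K * (norm (y - x))\<^sup>2" for b
    using taylor_cball[OF sm H] by metis
  then obtain C3 where C3: "\<And>b. C3 b \<ge> 0"
    "\<And>b x y. x \<in> cball c r \<Longrightarrow> y \<in> cball c r \<Longrightarrow>
      norm (B y b - B x b - Dv (\<lambda>x. B x b) x (y - x)) \<le> C3 b * (norm (y - x))\<^sup>2" by metis
  define S where "S = (\<lambda>C::'c \<Rightarrow> real. \<Sum>b\<in>Basis. C b)"
  \<comment> \<open>The sum dominates the constants of all four estimates, and the summand 1 makes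
    it positive.\<close>
  define C where "C = 1 + S C0 + S C1 + S C2 + S C3"
  have S: "S C0 \<ge> 0" "S C1 \<ge> 0" "S C2 \<ge> 0" "S C3 \<ge> 0" using C0 C1 C2 C3 by (auto simp: S_def sum_nonneg)
  have le: "u \<le> C * q * norm h" if "u \<le> D * q * norm h" "D \<in> {S C0, S C1, S C2, S C3}" "q \<ge> 0"
    for u D q and h :: 'c
  proof -
    have "D \<le> C" using that(2) S by (auto simp: C_def)
    then have "D * q * norm h \<le> C * q * norm h" using that(3) by (intro mult_right_mono) auto
    then show ?thesis using that(1) by linarith
  qed
  show ?thesis
  proof
    show "C > 0" using S by (simp add: C_def)
    fix x assume x: "x \<in> cball c r"
    show "norm (B x h) \<le> C * norm h" for h
    proof -
      have "norm (B x h) \<le> S C0 * 1 * norm h"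
        unfolding S_def by (rule linear_family_bound[of C0 "\<lambda>_. B x"]) (use C0 x lin[OF cH[OF x]] in auto)
      from le[OF this] show ?thesis by simp
    qed
    show "norm (Dv (\<lambda>x. B x h) x k) \<le> C * norm k * norm h" for h k
      by (rule le[of _ "S C1"], unfold S_def, rule linear_family_bound[of C1 "\<lambda>_ h. Dv (\<lambda>x. B x h) x k"])
        (use C1 x linD[OF x] in auto)
    fix y assume y: "y \<in> cball c r"
    have l1: "linear (\<lambda>h. B y h - B x h)" by (intro linear_compose_sub lin cH x y)
    show "norm (B y h - B x h) \<le> C * norm (y - x) * norm h" for h
      by (rule le[of _ "S C2"], unfold S_def, rule linear_family_bound[of C2 "\<lambda>_ h. B y h - B x h"])
        (use C2 x y l1 in auto)
    have l2: "linear (\<lambda>h. B y h - B x h - Dv (\<lambda>x. B x h) x (y - x))" by (intro linear_compose_sub l1 linD x)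
    show "norm (B y h - B x h - Dv (\<lambda>x. B x h) x (y - x)) \<le> C * (norm (y - x))\<^sup>2 * norm h" for h
      by (rule le[of _ "S C3"], unfold S_def, rule linear_family_bound[of C3 "\<lambda>_ h. B y h - B x h - Dv (\<lambda>x. B x h) x (y - x)"])
        (use C3 x y l2 in auto)
  qed
qed

text \<open>The unknown is a function of v, and one contraction solves the equation for all v
  simultaneously. Bounded continuous functions are defined on the whole space, so v is clamped to
  \<open>cball 0 e\<close> by the nearest-point map \<open>c\<close>. The condition C e <= \<rho>
  keeps the values in \<open>cball x0 \<rho>\<close>, where the bounds on \<open>B\<close> hold, and
  C e <= 1/2 gives the contraction.\<close>

lemma ray_integral_equation:
  fixes B :: "'a::euclidean_space \<Rightarrow> 'b::euclidean_space \<Rightarrow> 'a"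
  assumes lin: "\<And>x. x \<in> cball x0 \<rho> \<Longrightarrow> linear (B x)" and cont: "\<And>h. continuous_on (cball x0 \<rho>) (\<lambda>x. B x h)"
    and bd: "\<And>x h. x \<in> cball x0 \<rho> \<Longrightarrow> norm (B x h) \<le> C * norm h"
    and lip: "\<And>x y h. x \<in> cball x0 \<rho> \<Longrightarrow> y \<in> cball x0 \<rho> \<Longrightarrow> norm (B y h - B x h) \<le> C * norm (y - x) * norm h"
    and e: "e > 0" "C * e \<le> \<rho>" "C * e \<le> 1 / 2" "C > 0"
  obtains \<phi> where "continuous_on UNIV \<phi>" "\<And>v. \<phi> v \<in> cball x0 \<rho>"
    "\<And>v. v \<in> cball 0 e \<Longrightarrow> \<phi> v = x0 + integral {0..1} (\<lambda>t. B (\<phi> (t *\<^sub>R v)) v)"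
proof -
  define c where "c = (closest_point (cball 0 e) :: 'b \<Rightarrow> 'b)"
  have ce: "c v \<in> cball 0 e" for v
    unfolding c_def by (rule closest_point_in_set) (use e in auto)
  have cc: "continuous_on A c" for A
    unfolding c_def by (rule continuous_on_closest_point) (use e in auto)
  have cid: "c v = v" if "v \<in> cball 0 e" for v
    unfolding c_def by (rule closest_point_self[OF that])
  define R :: "('b \<Rightarrow>\<^sub>C 'a) set" where "R = PiC UNIV (\<lambda>_. cball x0 \<rho>)"
  have R: "g \<in> R \<longleftrightarrow> (\<forall>v. apply_bcontfun g v \<in> cball x0 \<rho>)" for g by (auto simp: R_def mem_PiC_iff)
  have contj: "continuous_on (UNIV \<times> {0..1::real}) (\<lambda>(v,t). B (apply_bcontfun g (t *\<^sub>R c v)) (c v))" if "g \<in> R" for g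
  proof -
    have "continuous_on (UNIV \<times> {0..1::real}) (\<lambda>p. \<Sum>b\<in>Basis. (c (fst p) \<bullet> b) *\<^sub>R B (apply_bcontfun g (snd p *\<^sub>R c (fst p))) b)"
      using that R
      by (intro continuous_intros continuous_on_compose2[OF cc] continuous_on_compose2[OF cont]
        continuous_on_compose2[OF continuous_on_apply_bcontfun[of UNIV g]]) auto
    then show ?thesis
    proof (rule continuous_on_eq)
      fix p :: "'b \<times> real"
      have "linear (B (apply_bcontfun g (snd p *\<^sub>R c (fst p))))" using that R lin by auto
      from linear_expand[OF this, symmetric]
      show "(\<Sum>b\<in>Basis. (c (fst p) \<bullet> b) *\<^sub>R B (apply_bcontfun g (snd p *\<^sub>R c (fst p))) b)
        = (case p of (v, t) \<Rightarrow> B (apply_bcontfun g (t *\<^sub>R c v)) (c v))" by (simp add: split_beta)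
    qed
  qed
  have conts: "continuous_on {0..1} (\<lambda>t. B (apply_bcontfun g (t *\<^sub>R c v)) (c v))" if "g \<in> R" for g v
  proof -
    have "continuous_on {0..1} ((\<lambda>(v,t). B (apply_bcontfun g (t *\<^sub>R c v)) (c v)) \<circ> Pair v)"
      by (rule continuous_on_compose) (auto intro!: continuous_intros continuous_on_subset[OF contj[OF that]])
    then show ?thesis by (simp add: o_def)
  qed
  define U where "U = (\<lambda>g v. x0 + integral {0..1} (\<lambda>t. B (apply_bcontfun g (t *\<^sub>R c v)) (c v)))"
  define T where "T = (\<lambda>g. Bcontfun (U g))"
  have Uc: "continuous_on UNIV (U g)" if "g \<in> R" for g
    unfolding U_def
    using integral_continuous_on_param[of UNIV 0 "1::real", unfolded cbox_interval, OF contj[OF that]]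
    by (intro continuous_intros)
  have Ub: "U g v \<in> cball x0 \<rho>" if "g \<in> R" for g v
  proof -
    have "norm (integral {0..1} (\<lambda>t. B (apply_bcontfun g (t *\<^sub>R c v)) (c v))) \<le> (C * e) * (1 - 0)"
    proof (rule integral_bound)
      fix t :: real assume "t \<in> {0..1}"
      have "norm (B (apply_bcontfun g (t *\<^sub>R c v)) (c v)) \<le> C * norm (c v)" using that R by (intro bd) auto
      also have "\<dots> \<le> C * e" using ce[of v] e by (intro mult_left_mono) auto
      finally show "norm (B (apply_bcontfun g (t *\<^sub>R c v)) (c v)) \<le> C * e" .
    qed (use conts[OF that] in auto)
    then show ?thesis using e by (simp add: U_def dist_norm)
  qed
  have UT: "apply_bcontfun (T g) = U g" if "g \<in> R" for g
  proof -
    have "norm (U g v) \<le> norm x0 + \<rho>" for v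
      using Ub[OF that, of v] norm_triangle_ineq2[of "U g v" x0] by (simp add: dist_norm norm_minus_commute)
    then have "U g \<in> bcontfun" by (intro bcontfun_normI Uc[OF that])
    then show ?thesis by (simp add: T_def Bcontfun_inverse)
  qed
  have "\<exists>!g\<in>R. T g = g"
  proof (rule Banach_fix[where c="1/2"])
    show "complete R" unfolding R_def by (intro closed_PiC[THEN complete_eq_closed[THEN iffD2]]) auto
    show "R \<noteq> {}" using R[of "const_bcontfun x0"] e mult_pos_pos[OF e(4,1)] by auto
    show "T ` R \<subseteq> R" using UT Ub R by auto
    fix g h assume g: "g \<in> R" and h: "h \<in> R"
    show "dist (T g) (T h) \<le> 1 / 2 * dist g h"
    proof (rule dist_bound)
      fix v
      have "U g v - U h v = integral {0..1} (\<lambda>t. B (apply_bcontfun g (t *\<^sub>R c v)) (c v)) - integral {0..1} (\<lambda>t. B (apply_bcontfun h (t *\<^sub>R c v)) (c v))"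
        by (simp add: U_def)
      also have "\<dots> = integral {0..1} (\<lambda>t. B (apply_bcontfun g (t *\<^sub>R c v)) (c v) - B (apply_bcontfun h (t *\<^sub>R c v)) (c v))"
        by (intro integral_diff[symmetric] integrable_continuous_real conts g h)
      finally have eq: "U g v - U h v = \<dots>" .
      have "norm (U g v - U h v) \<le> (1 / 2 * dist g h) * (1 - 0)"
        unfolding eq
      proof (rule integral_bound)
        fix t :: real assume "t \<in> {0..1}"
        let ?x = "apply_bcontfun g (t *\<^sub>R c v)" and ?y = "apply_bcontfun h (t *\<^sub>R c v)"
        have "norm (B ?x (c v) - B ?y (c v)) \<le> C * norm (?x - ?y) * norm (c v)"
          using g h R by (intro lip) auto
        also have "\<dots> \<le> C * dist g h * e"
          using e ce[of v] dist_bounded[of g "t *\<^sub>R c v" h] by (intro mult_mono) (auto simp: dist_norm)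
        also have "\<dots> = (C * e) * dist g h" by simp
        also have "\<dots> \<le> 1 / 2 * dist g h" using e by (intro mult_right_mono) auto
        finally show "norm (B ?x (c v) - B ?y (c v)) \<le> 1 / 2 * dist g h" .
      qed (auto intro!: continuous_intros conts g h)
      then show "dist (apply_bcontfun (T g) v) (apply_bcontfun (T h) v) \<le> 1 / 2 * dist g h"
        by (simp add: UT g h dist_norm)
    qed
  qed auto
  then obtain g where g: "g \<in> R" "T g = g" by auto
  show ?thesis
  proof (rule that[of "apply_bcontfun g"])
    show "continuous_on UNIV (apply_bcontfun g)" by simp
    show "apply_bcontfun g v \<in> cball x0 \<rho>" for v using g R by auto
    show "apply_bcontfun g v = x0 + integral {0..1} (\<lambda>t. B (apply_bcontfun g (t *\<^sub>R v)) v)" if "v \<in> cball 0 e" for v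
      using fun_cong[OF UT[OF g(1), unfolded g(2)], of v] by (simp only: U_def cid[OF that])
  qed
qed

text \<open>The substitution t -> s t turns the equation at the point s v into
  \<open>\<phi> (s v) = x0 + J s\<close>, where J is an integral with upper limit s and hence
  differentiable. The substitution is carried out by differentiating J(s t) in t, which includes the
  case s = 0.\<close>

lemma ray_has_vector_derivative:
  fixes \<phi> :: "'b::euclidean_space \<Rightarrow> 'a::euclidean_space"
  assumes cont: "continuous_on {0..1} (\<lambda>t. B (\<phi> (t *\<^sub>R v)) v)" and lin: "\<And>u. linear (B (\<phi> u))"
    and eq: "\<And>s. s \<in> {0..1} \<Longrightarrow> \<phi> (s *\<^sub>R v) = x0 + integral {0..1} (\<lambda>t. B (\<phi> (t *\<^sub>R s *\<^sub>R v)) (s *\<^sub>R v))"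
    and s: "s \<in> {0..1}"
  shows "((\<lambda>s. \<phi> (s *\<^sub>R v)) has_vector_derivative B (\<phi> (s *\<^sub>R v)) v) (at s within {0..1})"
proof -
  define J where "J = (\<lambda>s. integral {0..s} (\<lambda>t. B (\<phi> (t *\<^sub>R v)) v))"
  have J: "(J has_vector_derivative B (\<phi> (s *\<^sub>R v)) v) (at s within {0..1})" if "s \<in> {0..1}" for s
    unfolding J_def by (rule integral_has_vector_derivative[OF cont that])
  have "\<phi> (s *\<^sub>R v) = x0 + J s" if s: "s \<in> {0..1}" for s
  proof -
    have "((\<lambda>t. s *\<^sub>R B (\<phi> ((s * t) *\<^sub>R v)) v) has_integral J (s * 1) - J (s * 0)) {0..1}"
    proof (rule fundamental_theorem_of_calculus)
      fix t :: real assume t: "t \<in> {0..1}"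
      have st: "s * t \<in> {0..1}" if "t \<in> {0..1}" for t using s that by (auto intro: mult_le_one)
      have "(((*) s) has_vector_derivative s) (at t within {0..1})"
        by (auto intro!: derivative_eq_intros)
      moreover have "(J has_vector_derivative B (\<phi> ((s * t) *\<^sub>R v)) v) (at (s * t) within (*) s ` {0..1})"
        by (rule has_vector_derivative_within_subset[OF J[OF st[OF t]]]) (use st in auto)
      ultimately have "((J \<circ> (*) s) has_vector_derivative s *\<^sub>R B (\<phi> ((s * t) *\<^sub>R v)) v) (at t within {0..1})"
        by (rule vector_diff_chain_within)
      then show "((\<lambda>t. J (s * t)) has_vector_derivative s *\<^sub>R B (\<phi> ((s * t) *\<^sub>R v)) v) (at t within {0..1})"
        by (simp add: o_def)
    qed simp
    moreover have "J 0 = 0" by (simp add: J_def)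
    ultimately have hi: "((\<lambda>t. s *\<^sub>R B (\<phi> ((s * t) *\<^sub>R v)) v) has_integral J s) {0..1}" by simp
    have "(\<lambda>t. B (\<phi> (t *\<^sub>R s *\<^sub>R v)) (s *\<^sub>R v)) = (\<lambda>t. s *\<^sub>R B (\<phi> ((s * t) *\<^sub>R v)) v)"
      by (simp add: linear_cmul[OF lin] mult.commute)
    then show ?thesis unfolding eq[OF s] using integral_unique[OF hi] by simp
  qed
  note phiJ = this
  have "((\<lambda>s. x0 + J s) has_vector_derivative 0 + B (\<phi> (s *\<^sub>R v)) v) (at s within {0..1})"
    by (intro has_vector_derivative_add has_vector_derivative_const J[OF s])
  then show ?thesis
    by (intro has_vector_derivative_transform[OF s phiJ]) simp_all
qed

text \<open>
  The solution along rays is differentiable because, for \<open>x = \<phi> (t v)\<close>, the symmetry of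
  \<open>(h, k) \<mapsto> D(B \<cdot> k) x (B x h)\<close> turns the derivative of
  \<open>w t = \<phi> (t (v + h)) - \<phi> (t v) - t B x h\<close> into a term linear in \<open>w\<close> plus an error of order
  \<open>\<bar>h\<bar>\<^sup>2\<close>.  No differentiable dependence of solutions on parameters is needed.
\<close>

lemma total_ode:
  fixes B :: "'a::euclidean_space \<Rightarrow> 'b::euclidean_space \<Rightarrow> 'a"
  assumes H: "open H" "x0 \<in> H" and sm: "\<And>h. smooth H (\<lambda>x. B x h)"
    and lin: "\<And>x. x \<in> H \<Longrightarrow> linear (B x)"
    and sym: "\<And>x h k. x \<in> H \<Longrightarrow> Dv (\<lambda>x. B x k) x (B x h) = Dv (\<lambda>x. B x h) x (B x k)"
  obtains e \<phi> where "e > 0" "\<phi> 0 = x0" "\<And>v. v \<in> ball 0 e \<Longrightarrow> \<phi> v \<in> H"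
    "\<And>v. v \<in> ball 0 e \<Longrightarrow> (\<phi> has_derivative B (\<phi> v)) (at v)"
proof -
  obtain \<rho> where \<rho>: "\<rho> > 0" "cball x0 \<rho> \<subseteq> H" using H open_contains_cball by blast
  obtain C where C: "C > 0"
    and C0: "\<And>x h. x \<in> cball x0 \<rho> \<Longrightarrow> norm (B x h) \<le> C * norm h"
    and C1: "\<And>x h k. x \<in> cball x0 \<rho> \<Longrightarrow> norm (Dv (\<lambda>x. B x h) x k) \<le> C * norm k * norm h"
    and C2: "\<And>x y h. x \<in> cball x0 \<rho> \<Longrightarrow> y \<in> cball x0 \<rho> \<Longrightarrow> norm (B y h - B x h) \<le> C * norm (y - x) * norm h"
    and C3: "\<And>x y h. x \<in> cball x0 \<rho> \<Longrightarrow> y \<in> cball x0 \<rho> \<Longrightarrow>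
      norm (B y h - B x h - Dv (\<lambda>x. B x h) x (y - x)) \<le> C * (norm (y - x))\<^sup>2 * norm h"
    using family_bounds_cball[OF H(1) \<rho>(2) sm lin] by metis
  \<comment> \<open>The first bound keeps the integral operator inside the ball of radius \<rho>.
    The second makes it a contraction, and it also supplies the coefficient 1/2 in both applications
    of \<open>gronwall_half\<close>.\<close>
  define e where "e = min (\<rho> / C) (1 / (2 * C))"
  have e: "e > 0" "C * e \<le> \<rho>" "C * e \<le> 1 / 2" using C \<rho> by (auto simp: e_def min_def field_simps)
  have cH: "x \<in> H" if "x \<in> cball x0 \<rho>" for x using that \<rho> by auto
  have clin: "linear (B x)" if "x \<in> cball x0 \<rho>" for x using lin cH that by blast
  have cB: "continuous_on (cball x0 \<rho>) (\<lambda>x. B x h)" for h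
    using smooth_continuous[OF sm H(1)] \<rho>(2) by (rule continuous_on_subset)
  obtain \<phi> where c\<phi>: "continuous_on UNIV \<phi>" and \<phi>c: "\<And>v. \<phi> v \<in> cball x0 \<rho>"
    and \<phi>e: "\<And>v. v \<in> cball 0 e \<Longrightarrow> \<phi> v = x0 + integral {0..1} (\<lambda>t. B (\<phi> (t *\<^sub>R v)) v)"
    using ray_integral_equation[OF clin cB C0 C2 e C] by metis
  have bl: "linear (B (\<phi> v))" for v using clin \<phi>c by blast
  have ray: "((\<lambda>s. \<phi> (s *\<^sub>R v)) has_vector_derivative B (\<phi> (s *\<^sub>R v)) v) (at s within {0..1})"
    if v: "v \<in> cball 0 e" and s: "s \<in> {0..1}" for v s
  proof (rule ray_has_vector_derivative[where ?x0.0=x0 and B=B and \<phi>=\<phi>, OF _ bl _ s])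
    show "continuous_on {0..1} (\<lambda>t. B (\<phi> (t *\<^sub>R v)) v)"
      by (intro continuous_on_compose2[OF cB] continuous_on_compose2[OF c\<phi>] continuous_intros) (use \<phi>c in auto)
    fix s :: real assume "s \<in> {0..1}"
    then have "\<bar>s\<bar> * norm v \<le> 1 * e" using v by (intro mult_mono) auto
    then show "\<phi> (s *\<^sub>R v) = x0 + integral {0..1} (\<lambda>t. B (\<phi> (t *\<^sub>R s *\<^sub>R v)) (s *\<^sub>R v))"
      by (intro \<phi>e) auto
  qed
  \<comment> \<open>The factor 2 is that of \<open>gronwall_half\<close>. In the error term the
    Taylor remainder contributes C (2 C |h|)^2 e = 4 C^3 e |h|^2, and the second derivative term
    along h contributes C (C |h|) |h|.\<close>
  define K where "K = 2 * (4 * C ^ 3 * e + C\<^sup>2)"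
  have main: "norm (\<phi> u - \<phi> v - B (\<phi> v) (u - v)) \<le> K * (norm (u - v))\<^sup>2"
    if v: "v \<in> cball 0 e" and u: "u \<in> cball 0 e" for u v
  proof -
    define h where "h = u - v"
    define x where "x = (\<lambda>t. \<phi> (t *\<^sub>R v))"
    define y where "y = (\<lambda>t. \<phi> (t *\<^sub>R u))"
    define w where "w = (\<lambda>t. y t - x t - t *\<^sub>R B (x t) h)"
    have xc: "x t \<in> cball x0 \<rho>" and yc: "y t \<in> cball x0 \<rho>" for t using \<phi>c by (auto simp: x_def y_def)
    have lx: "linear (B (x t))" for t using clin xc by blast
    have dx: "(x has_vector_derivative B (x t) v) (at t within {0..1})"
      and dy: "(y has_vector_derivative B (y t) u) (at t within {0..1})" if "t \<in> {0..1}" for t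
      unfolding x_def y_def using ray[OF v that] ray[OF u that] by auto
    have un: "norm u \<le> e" using u by simp
    have x0y0: "y 0 - x 0 = 0" by (simp add: x_def y_def)
    have Bu: "B (x t) u = B (x t) v + B (x t) h" for t
      using linear_add[OF lx, of t v h] by (simp add: h_def)
    have half: "C * q * norm u \<le> q / 2" if "q \<ge> 0" for q
    proof -
      have "C * q * norm u \<le> C * q * e" using un C that by (intro mult_left_mono) auto
      also have "\<dots> = (C * e) * q" by simp
      also have "\<dots> \<le> 1/2 * q" using e that by (intro mult_right_mono) auto
      finally show ?thesis by simp
    qed
    \<comment> \<open>The rays to u and v stay within 2 C |u - v| of each other; this first-order
      bound makes the Taylor remainder below quadratic in h.\<close>
    have Delta: "norm (y t - x t) \<le> 2 * (C * norm h)" if "t \<in> {0..1}" for t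
    proof (rule gronwall_half[of "\<lambda>t. y t - x t" "\<lambda>t. B (y t) u - B (x t) v"])
      fix t :: real assume t: "t \<in> {0..1}"
      show "((\<lambda>t. y t - x t) has_vector_derivative B (y t) u - B (x t) v) (at t within {0..1})"
        by (intro has_vector_derivative_diff dx dy t)
      have "B (y t) u - B (x t) v = (B (y t) u - B (x t) u) + B (x t) h" by (simp add: Bu)
      also have "norm \<dots> \<le> C * norm (y t - x t) * norm u + C * norm h"
        using norm_triangle_ineq C2[OF xc yc] C0[OF xc] by (meson add_mono order_trans)
      also have "\<dots> \<le> norm (y t - x t) / 2 + C * norm h" using half by simp
      finally show "norm (B (y t) u - B (x t) v) \<le> norm (y t - x t) / 2 + C * norm h" .
    qed (use x0y0 that in auto)
    define w' where "w' = (\<lambda>t. B (y t) u - B (x t) v - (t *\<^sub>R Dv (\<lambda>x. B x h) (x t) (B (x t) v) + 1 *\<^sub>R B (x t) h))"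
    have "norm (w 1) \<le> 2 * ((4 * C ^ 3 * e + C\<^sup>2) * (norm h)\<^sup>2)"
    proof (rule gronwall_half[of w w'])
      fix t :: real assume t: "t \<in> {0..1}"
      have "((\<lambda>x. B x h) has_derivative Dv (\<lambda>x. B x h) (x t)) (at (x t) within x ` {0..1})"
        by (rule has_derivative_at_withinI[OF smooth_has_derivative[OF sm H(1) cH[OF xc]]])
      from vector_derivative_diff_chain_within[OF dx[OF t] this]
      have "((\<lambda>t. B (x t) h) has_vector_derivative Dv (\<lambda>x. B x h) (x t) (B (x t) v)) (at t within {0..1})"
        by (simp add: o_def)
      from has_vector_derivative_scaleR[OF DERIV_ident this]
      show "(w has_vector_derivative w' t) (at t within {0..1})"
        unfolding w_def w'_def by (intro has_vector_derivative_diff dx dy t)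
      let ?D = "\<lambda>k. Dv (\<lambda>x. B x u) (x t) k"
      have lD: "linear ?D" by (rule smooth_linear_Dv[OF sm H(1) cH[OF xc]])
      have lDh: "linear (\<lambda>h. Dv (\<lambda>x. B x h) (x t) k)" for k
        by (rule linear_family_Dv[OF H(1) sm lin cH[OF xc]])
      have "?D (y t - x t) = ?D (w t) + t *\<^sub>R ?D (B (x t) h)"
        unfolding w_def using linear_add[OF lD] linear_cmul[OF lD] by (metis diff_add_cancel)
      \<comment> \<open>Symmetry exchanges h and u, and the decomposition u = v + h splits off
        exactly the term that \<open>w'\<close> subtracts.\<close>
      moreover have "?D (B (x t) h) = Dv (\<lambda>x. B x h) (x t) (B (x t) v) + Dv (\<lambda>x. B x h) (x t) (B (x t) h)"
        unfolding sym[OF cH[OF xc], where h=h and k=u] Bu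
        by (rule linear_add[OF smooth_linear_Dv[OF sm H(1) cH[OF xc]]])
      ultimately have "w' t = (B (y t) u - B (x t) u - ?D (y t - x t)) + ?D (w t) + t *\<^sub>R Dv (\<lambda>x. B x h) (x t) (B (x t) h)"
        unfolding w'_def Bu by (simp add: scaleR_add_right)
      also have "norm \<dots> \<le> C * (norm (y t - x t))\<^sup>2 * norm u + C * norm (w t) * norm u + 1 * (C * (C * norm h) * norm h)"
      proof (intro order_trans[OF norm_triangle_ineq] add_mono C3 C1 xc yc)
        have "norm (Dv (\<lambda>x. B x h) (x t) (B (x t) h)) \<le> C * norm (B (x t) h) * norm h" by (rule C1[OF xc])
        also have "\<dots> \<le> C * (C * norm h) * norm h"
          using C0[OF xc] C by (intro mult_right_mono mult_left_mono) auto
        finally have "\<bar>t\<bar> * norm (Dv (\<lambda>x. B x h) (x t) (B (x t) h)) \<le> 1 * (C * (C * norm h) * norm h)"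
          using t C by (intro mult_mono) auto
        then show "norm (t *\<^sub>R Dv (\<lambda>x. B x h) (x t) (B (x t) h)) \<le> 1 * (C * (C * norm h) * norm h)" by simp
      qed
      also have "C * (norm (y t - x t))\<^sup>2 * norm u \<le> C * (2 * (C * norm h))\<^sup>2 * e"
        using Delta[OF t] C un by (intro mult_mono power_mono) auto
      also have "C * norm (w t) * norm u \<le> norm (w t) / 2" by (rule half) simp
      finally show "norm (w' t) \<le> norm (w t) / 2 + (4 * C ^ 3 * e + C\<^sup>2) * (norm h)\<^sup>2"
        by (simp add: algebra_simps power2_eq_square power3_eq_cube)
    qed (auto simp: w_def x0y0)
    then show ?thesis unfolding K_def by (simp add: w_def x_def y_def h_def distrib_right)
  qed
  show ?thesis
  proof (rule that[of e \<phi>])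
    show "e > 0" by (rule e)
    show "\<phi> 0 = x0" using \<phi>e[of 0] e linear_0[OF bl] by simp
    fix v :: 'b assume v: "v \<in> ball 0 e"
    show "\<phi> v \<in> H" using \<phi>c cH by blast
    have vc: "v \<in> cball 0 e" using v by simp
    show "(\<phi> has_derivative B (\<phi> v)) (at v)"
    proof (rule has_derivativeI_sandwich[of "e - norm v" _ _ _ _ "\<lambda>u. K * norm (u - v)"])
      show "bounded_linear (B (\<phi> v))" using bl linear_conv_bounded_linear by blast
      have "((\<lambda>u. K * norm (u - v)) \<longlongrightarrow> K * norm (v - v)) (at v)" by (intro tendsto_intros)
      then show "((\<lambda>u. K * norm (u - v)) \<longlongrightarrow> 0) (at v)" by simp
      fix u assume u: "u \<noteq> v" "dist u v < e - norm v"
      then have "norm u \<le> e" using norm_triangle_ineq2[of u v] by (simp add: dist_norm)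
      then have "u \<in> cball 0 e" by simp
      from main[OF vc this] show "norm (\<phi> u - \<phi> v - B (\<phi> v) (u - v)) / norm (u - v) \<le> K * norm (u - v)"
        using u by (simp add: divide_le_eq power2_eq_square mult.assoc)
    qed (use v in auto)
  qed
qed

text \<open>The derivative of \<phi> in a fixed direction h is \<open>B (\<phi> v) h\<close>, a
  smooth function of \<phi> v and therefore of the same order as \<phi> itself; the order thus rises
  by one at each step.\<close>

lemma total_ode_smooth:
  fixes B :: "'a::euclidean_space \<Rightarrow> 'b::euclidean_space \<Rightarrow> 'a"
  assumes "open H" "open S" and sm: "\<And>h. smooth H (\<lambda>x. B x h)"
    and \<phi>: "\<And>v. v \<in> S \<Longrightarrow> \<phi> v \<in> H" "\<And>v. v \<in> S \<Longrightarrow> (\<phi> has_derivative B (\<phi> v)) (at v)"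
  shows "smooth S \<phi>"
proof -
  have "Ck k S \<phi>" for k
  proof (induction k)
    case 0
    have "isCont \<phi> x" if "x \<in> S" for x using has_derivative_continuous[OF \<phi>(2)[OF that]] .
    then show ?case by (simp add: continuous_at_imp_continuous_on)
  next
    case (Suc k)
    show ?case
    proof (rule Ck_SucI[OF \<phi>(2)])
      show "Ck k S (\<lambda>x. B (\<phi> x) h)" for h
        by (rule Ck_compose[OF Suc _ assms(2,1)]) (use sm \<phi> in \<open>auto simp: smooth_on_def\<close>)
    qed
  qed
  then show ?thesis by (simp add: smooth_on_def)
qed

section \<open>Smooth functions on manifolds\<close>

text \<open>A linear retraction onto \<open>E\<close>, fixed once by choice so that every chart of a
  manifold is extended along the same projection.\<close>

definition proj_on :: "'e::euclidean_space set \<Rightarrow> 'e \<Rightarrow> 'e"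
  where "proj_on E = (SOME g. linear g \<and> range g \<subseteq> E \<and> (\<forall>x\<in>E. g x = x))"

lemma proj_on:
  assumes "subspace E"
  shows "linear (proj_on E)" "proj_on E x \<in> E" "x \<in> E \<Longrightarrow> proj_on E x = x"
proof -
  have "\<exists>g. range g \<subseteq> E \<and> linear g \<and> (\<forall>v\<in>E. g (id v) = v)"
    using linear_exists_left_inverse_on[of id E] assms by (simp add: linear_id)
  then have "\<exists>g. linear g \<and> range g \<subseteq> E \<and> (\<forall>x\<in>E. g x = x)" by auto
  from someI_ex[OF this] show "linear (proj_on E)" "proj_on E x \<in> E" "x \<in> E \<Longrightarrow> proj_on E x = x"
    unfolding proj_on_def by auto
qed

text \<open>Tangent vectors act on globally defined smooth functions. Expressions that make sense
  only locally enter through agreement near p with a global smooth function.\<close>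

definition smooth_near :: "('m, 'e::euclidean_space) manifold \<Rightarrow> 'm \<Rightarrow> ('m \<Rightarrow> real) \<Rightarrow> bool"
  where "smooth_near M p g \<longleftrightarrow>
    (\<exists>f\<in>smooth_functions M. \<exists>W. openin (top_of M) W \<and> p \<in> W \<and> (\<forall>q\<in>W. g q = f q))"

lemma smooth_nearI:
  "f \<in> smooth_functions M \<Longrightarrow> openin (top_of M) W \<Longrightarrow> p \<in> W \<Longrightarrow> (\<And>q. q \<in> W \<Longrightarrow> g q = f q) \<Longrightarrow> smooth_near M p g"
  unfolding smooth_near_def by blast

locale mfd =
  fixes M :: "('m, 'e::euclidean_space) manifold" and n :: nat
  assumes mfd: "smooth_manifold n M"
begin

abbreviation Pr :: "'e \<Rightarrow> 'e" where "Pr \<equiv> proj_on (model M)"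

text \<open>The image of a chart is only relatively open in the model space. \<open>dom\<close> is
  its preimage under the projection, which is open in the Euclidean space, and \<open>par\<close> is
  the inverse chart, constant along the fibres of the projection. Smoothness on a manifold thus
  becomes ordinary smoothness on \<open>dom\<close>.\<close>

definition dom :: "'m set \<Rightarrow> ('m \<Rightarrow> 'e) \<Rightarrow> 'e set" where "dom U \<phi> = Pr -` (\<phi> ` U)"

definition par :: "'m set \<Rightarrow> ('m \<Rightarrow> 'e) \<Rightarrow> 'e \<Rightarrow> 'm" where "par U \<phi> x = inv_into U \<phi> (Pr x)"

lemma subspace_model: "subspace (model M)"
  using mfd by (simp add: smooth_manifold_def)

lemmas Pr = proj_on[OF subspace_model]

lemma chartD:
  assumes "(U, \<phi>) \<in> charts M"
  shows chart_open: "openin (top_of M) U" and chart_image: "openin (top_of_set (model M)) (\<phi> ` U)"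
    and chart_homeo: "homeomorphic_map (subtopology (top_of M) U) (top_of_set (\<phi> ` U)) \<phi>"
proof -
  have "is_chart M U \<phi>" using assms mfd by (auto simp: smooth_manifold_def)
  then show "openin (top_of M) U" "openin (top_of_set (model M)) (\<phi> ` U)"
    "homeomorphic_map (subtopology (top_of M) U) (top_of_set (\<phi> ` U)) \<phi>" by (auto simp: is_chart_def)
qed

lemma chart_sub: "(U, \<phi>) \<in> charts M \<Longrightarrow> U \<subseteq> points M"
  by (meson chart_open openin_subset)

lemma chart_model: "(U, \<phi>) \<in> charts M \<Longrightarrow> q \<in> U \<Longrightarrow> \<phi> q \<in> model M"
  by (meson chart_image image_eqI openin_imp_subset subsetD)

lemma chart_inj: "(U, \<phi>) \<in> charts M \<Longrightarrow> inj_on \<phi> U"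
  using chart_homeo[of U \<phi>] homeomorphic_imp_injective_map chart_sub[of U \<phi>]
  by (metis inf.absorb_iff2 topspace_subtopology)

lemma chart_cover: "p \<in> points M \<Longrightarrow> \<exists>U \<phi>. (U, \<phi>) \<in> charts M \<and> p \<in> U"
proof -
  assume "p \<in> points M"
  then have "p \<in> (\<Union>(U, \<phi>)\<in>charts M. U)" using mfd unfolding smooth_manifold_def by blast
  then show ?thesis by auto
qed

lemma par_in: "x \<in> dom U \<phi> \<Longrightarrow> par U \<phi> x \<in> U"
  by (simp add: dom_def par_def inv_into_into)

lemma chart_par: "x \<in> dom U \<phi> \<Longrightarrow> \<phi> (par U \<phi> x) = Pr x"
  by (simp add: dom_def par_def f_inv_into_f)

lemma par_chart: "(U, \<phi>) \<in> charts M \<Longrightarrow> q \<in> U \<Longrightarrow> par U \<phi> (\<phi> q) = q"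
  by (simp add: par_def chart_inj Pr(3)[OF chart_model])

lemma chart_dom: "(U, \<phi>) \<in> charts M \<Longrightarrow> q \<in> U \<Longrightarrow> \<phi> q \<in> dom U \<phi>"
  by (simp add: dom_def Pr(3)[OF chart_model])

lemma chart_image_sub:
  assumes c: "(U, \<phi>) \<in> charts M" and W: "openin (top_of M) W"
  shows "openin (top_of_set (model M)) (\<phi> ` (U \<inter> W))"
proof -
  have "openin (subtopology (top_of M) U) (U \<inter> W)" using W by (auto simp: openin_subtopology)
  then have "openin (top_of_set (\<phi> ` U)) (\<phi> ` (U \<inter> W))"
    using homeomorphic_imp_open_map[OF chart_homeo[OF c]] by (simp add: open_map_def)
  then show ?thesis using chart_image[OF c] openin_trans by blast
qed

lemma open_dom_sub: "(U, \<phi>) \<in> charts M \<Longrightarrow> openin (top_of M) W \<Longrightarrow> open (dom (U \<inter> W) \<phi>)"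
  unfolding dom_def by (rule open_vimage_subspace[OF chart_image_sub]) (use Pr in auto)

lemma open_dom: "(U, \<phi>) \<in> charts M \<Longrightarrow> open (dom U \<phi>)"
  using open_dom_sub[of U \<phi> U] chart_open by simp

lemma dom_sub_iff:
  assumes c: "(U, \<phi>) \<in> charts M" and x: "x \<in> dom U \<phi>"
  shows "x \<in> dom (U \<inter> W) \<phi> \<longleftrightarrow> par U \<phi> x \<in> W"
proof
  assume "x \<in> dom (U \<inter> W) \<phi>"
  then obtain q where "q \<in> U \<inter> W" "Pr x = \<phi> q" by (auto simp: dom_def)
  then show "par U \<phi> x \<in> W" using chart_inj[OF c] by (simp add: par_def)
next
  assume "par U \<phi> x \<in> W"
  then show "x \<in> dom (U \<inter> W) \<phi>"
    using par_in[OF x] chart_par[OF x] by (auto simp: dom_def intro: image_eqI[of _ _ "par U \<phi> x"])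
qed

lemma dom_mono: "dom (U \<inter> W) \<phi> \<subseteq> dom U \<phi>"
  by (auto simp: dom_def)

lemma chart_vimage_open:
  assumes c: "(U, \<phi>) \<in> charts M" and "open H"
  shows "openin (top_of M) {q \<in> U. \<phi> q \<in> H}"
proof -
  have "continuous_map (subtopology (top_of M) U) (top_of_set (\<phi> ` U)) \<phi>"
    by (rule homeomorphic_imp_continuous_map[OF chart_homeo[OF c]])
  then have "continuous_map (subtopology (top_of M) U) euclidean \<phi>" by (simp add: continuous_map_in_subtopology)
  from openin_continuous_map_preimage[OF this, of H] assms
  have "openin (subtopology (top_of M) U) {q \<in> topspace (subtopology (top_of M) U). \<phi> q \<in> H}" by simp
  moreover have "{q \<in> topspace (subtopology (top_of M) U). \<phi> q \<in> H} = {q \<in> U. \<phi> q \<in> H}"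
    using chart_sub[OF c] by auto
  ultimately show ?thesis using openin_trans_full[OF _ chart_open[OF c]] by simp
qed

lemma smooth_on_chart_iff:
  assumes "(U, \<phi>) \<in> charts M" "openin (top_of M) W"
  shows "smooth_on (model M) (\<phi> ` (U \<inter> W)) (g \<circ> inv_into U \<phi>) \<longleftrightarrow> smooth (dom (U \<inter> W) \<phi>) (\<lambda>x. g (par U \<phi> x))"
  unfolding smooth_on_def dom_def
  using Ck_on_subspace_iff[OF chart_image_sub[OF assms] Pr(1) _ Pr(3), where f="g \<circ> inv_into U \<phi>"] Pr(2)
  by (simp add: o_def par_def image_subset_iff)

lemma smooth_functions_iff:
  "f \<in> smooth_functions M \<longleftrightarrow> (\<forall>(U,\<phi>)\<in>charts M. smooth (dom U \<phi>) (\<lambda>x. f (par U \<phi> x)))"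
proof -
  have "smooth_on (model M) (\<phi> ` U) (f \<circ> inv_into U \<phi>) \<longleftrightarrow> smooth (dom U \<phi>) (\<lambda>x. f (par U \<phi> x))"
    if "(U,\<phi>) \<in> charts M" for U \<phi>
    using smooth_on_chart_iff[OF that chart_open[OF that], of f] by simp
  then show ?thesis by (auto simp: smooth_functions_def)
qed

lemma smooth_functionsD:
  "f \<in> smooth_functions M \<Longrightarrow> (U,\<phi>) \<in> charts M \<Longrightarrow> smooth (dom U \<phi>) (\<lambda>x. f (par U \<phi> x))"
  by (auto simp: smooth_functions_iff)

lemma smooth_transition:
  assumes c: "(U,\<phi>) \<in> charts M" and d: "(V,\<psi>) \<in> charts M"
  shows "smooth (dom (U \<inter> V) \<phi>) (\<lambda>x. \<psi> (par U \<phi> x))"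
proof -
  have "smooth_on (model M) (\<phi> ` (U \<inter> V)) (\<psi> \<circ> inv_into U \<phi>)"
    using mfd c d by (fastforce simp: smooth_manifold_def)
  then show ?thesis using smooth_on_chart_iff[OF c chart_open[OF d]] by blast
qed

lemma smooth_functions_const: "(\<lambda>x. c) \<in> smooth_functions M"
  by (auto simp: smooth_functions_iff smooth_const)

lemma smooth_functions_add:
  "f \<in> smooth_functions M \<Longrightarrow> g \<in> smooth_functions M \<Longrightarrow> (\<lambda>x. f x + g x) \<in> smooth_functions M"
  by (auto simp: smooth_functions_iff intro!: smooth_add open_dom)

lemma smooth_functions_mult:
  "f \<in> smooth_functions M \<Longrightarrow> g \<in> smooth_functions M \<Longrightarrow> (\<lambda>x. f x * g x) \<in> smooth_functions M"
  by (auto simp: smooth_functions_iff intro!: smooth_mult open_dom)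

lemma smooth_functions_sum:
  "(\<And>i. i \<in> I \<Longrightarrow> f i \<in> smooth_functions M) \<Longrightarrow> (\<lambda>x. \<Sum>i\<in>I. f i x) \<in> smooth_functions M"
  by (auto simp: smooth_functions_iff intro!: smooth_sum open_dom)

lemma smooth_functions_uminus:
  "f \<in> smooth_functions M \<Longrightarrow> (\<lambda>x. - f x) \<in> smooth_functions M"
  by (auto simp: smooth_functions_iff intro!: smooth_uminus open_dom)

lemma smooth_functions_diff:
  "f \<in> smooth_functions M \<Longrightarrow> g \<in> smooth_functions M \<Longrightarrow> (\<lambda>x. f x - g x) \<in> smooth_functions M"
  by (auto simp: smooth_functions_iff intro!: smooth_diff open_dom)

section \<open>Functions smooth near a point, and passage from local to global\<close>

lemma smooth_near_smooth: "f \<in> smooth_functions M \<Longrightarrow> p \<in> points M \<Longrightarrow> smooth_near M p f"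
  by (rule smooth_nearI[of f M "points M"]) auto

lemma smooth_near_cong:
  assumes "smooth_near M p f" "openin (top_of M) W" "p \<in> W" "\<And>q. q \<in> W \<Longrightarrow> f q = g q"
  shows "smooth_near M p g"
proof -
  obtain k V where "k \<in> smooth_functions M" "openin (top_of M) V" "p \<in> V" "\<forall>q\<in>V. f q = k q"
    using assms(1) unfolding smooth_near_def by blast
  then show ?thesis using assms(2-4) by (intro smooth_nearI[of k M "V \<inter> W"]) auto
qed

lemma smooth_near_binop:
  assumes "smooth_near M p f" "smooth_near M p g"
    and op: "\<And>f g. f \<in> smooth_functions M \<Longrightarrow> g \<in> smooth_functions M \<Longrightarrow> (\<lambda>x. F (f x) (g x)) \<in> smooth_functions M"
  shows "smooth_near M p (\<lambda>x. F (f x) (g x))"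
proof -
  obtain k V where k: "k \<in> smooth_functions M" "openin (top_of M) V" "p \<in> V" "\<forall>q\<in>V. f q = k q"
    using assms(1) unfolding smooth_near_def by blast
  obtain l W where l: "l \<in> smooth_functions M" "openin (top_of M) W" "p \<in> W" "\<forall>q\<in>W. g q = l q"
    using assms(2) unfolding smooth_near_def by blast
  show ?thesis using k l by (intro smooth_nearI[OF op[OF k(1) l(1)], of "V \<inter> W"]) auto
qed

lemma smooth_near_add: "smooth_near M p f \<Longrightarrow> smooth_near M p g \<Longrightarrow> smooth_near M p (\<lambda>x. f x + g x)"
  by (rule smooth_near_binop) (auto intro: smooth_functions_add)

lemma smooth_near_mult: "smooth_near M p f \<Longrightarrow> smooth_near M p g \<Longrightarrow> smooth_near M p (\<lambda>x. f x * g x)"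
  by (rule smooth_near_binop) (auto intro: smooth_functions_mult)

lemma smooth_near_sum:
  "p \<in> points M \<Longrightarrow> (\<And>i. i \<in> I \<Longrightarrow> smooth_near M p (f i)) \<Longrightarrow> smooth_near M p (\<lambda>x. \<Sum>i\<in>I. f i x)"
proof (induction I rule: infinite_finite_induct)
  case (insert i I)
  then have "smooth_near M p (\<lambda>x. f i x + (\<Sum>i\<in>I. f i x))" by (intro smooth_near_add) auto
  then show ?case using insert by simp
qed (auto intro: smooth_near_smooth smooth_functions_const)

lemma smooth_near_par:
  assumes "smooth_near M q g" and c: "(U,\<phi>) \<in> charts M" and q: "q \<in> U"
  obtains W where "openin (top_of M) W" "q \<in> W" "smooth (dom (U \<inter> W) \<phi>) (\<lambda>x. g (par U \<phi> x))"
proof -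
  obtain f W where f: "f \<in> smooth_functions M" "openin (top_of M) W" "q \<in> W" "\<forall>q\<in>W. g q = f q"
    using assms(1) unfolding smooth_near_def by blast
  have "smooth (dom (U \<inter> W) \<phi>) (\<lambda>x. f (par U \<phi> x))"
    by (rule smooth_subset[OF smooth_functionsD[OF f(1) c] open_dom[OF c] open_dom_sub[OF c f(2)] dom_mono])
  then have "smooth (dom (U \<inter> W) \<phi>) (\<lambda>x. g (par U \<phi> x))"
  proof (rule smooth_cong[OF _ open_dom_sub[OF c f(2)]])
    fix x assume "x \<in> dom (U \<inter> W) \<phi>"
    then have "par U \<phi> x \<in> W" using dom_sub_iff[OF c] dom_mono by blast
    then show "f (par U \<phi> x) = g (par U \<phi> x)" using f by simp
  qed
  then show ?thesis using that f by blast
qed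

lemma smooth_functions_local:
  assumes "\<And>p. p \<in> points M \<Longrightarrow> smooth_near M p g"
  shows "g \<in> smooth_functions M"
  unfolding smooth_functions_iff
proof clarify
  fix U \<phi> assume c: "(U,\<phi>) \<in> charts M"
  show "smooth (dom U \<phi>) (\<lambda>x. g (par U \<phi> x))"
  proof (rule smooth_local[OF _ open_dom[OF c]])
    fix x assume x: "x \<in> dom U \<phi>"
    have q: "par U \<phi> x \<in> U" by (rule par_in[OF x])
    then have "smooth_near M (par U \<phi> x) g" using assms chart_sub[OF c] by blast
    then obtain W where W: "openin (top_of M) W" "par U \<phi> x \<in> W" "smooth (dom (U \<inter> W) \<phi>) (\<lambda>x. g (par U \<phi> x))"
      using smooth_near_par[OF _ c q] by blast
    then show "\<exists>T. open T \<and> x \<in> T \<and> smooth T (\<lambda>x. g (par U \<phi> x))"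
      using open_dom_sub[OF c W(1)] dom_sub_iff[OF c x] by blast
  qed
qed

lemma smooth_functions_cong:
  assumes "f \<in> smooth_functions M" "\<And>q. q \<in> points M \<Longrightarrow> f q = g q"
  shows "g \<in> smooth_functions M"
  by (rule smooth_functions_local, rule smooth_near_cong[OF smooth_near_smooth[OF assms(1)]])
    (use assms(2) in auto)

text \<open>The points of U with coordinates in \<open>cball y r\<close> form a set K homeomorphic
  to a compact part of the model space; K is compact, hence closed since M is Hausdorff. The
  function is smooth on U by change of charts and vanishes on the open complement of K, and these
  two sets cover M.\<close>

lemma smooth_extend_by_zero:
  assumes c: "(U,\<phi>) \<in> charts M" and H: "open H" "smooth H h" and k: "smooth UNIV k" "\<And>x. x \<notin> cball y r \<Longrightarrow> k x = 0"
    and sub: "cball y r \<subseteq> H" "model M \<inter> cball y r \<subseteq> \<phi> ` U"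
  shows "(\<lambda>q. if q \<in> U then k (\<phi> q) * h (\<phi> q) else 0) \<in> smooth_functions M"
proof -
  define g where "g = (\<lambda>q. if q \<in> U then k (\<phi> q) * h (\<phi> q) else 0)"
  define kh where "kh = (\<lambda>x. if x \<in> H then k x * h x else 0)"
  have kh: "smooth UNIV kh"
  proof (rule smooth_local)
    fix x :: 'e
    show "\<exists>T. open T \<and> x \<in> T \<and> smooth T kh"
    proof (cases "x \<in> H")
      case True
      have "smooth H (\<lambda>x. k x * h x)"
        by (intro smooth_mult H smooth_subset[OF k(1)]) auto
      then have "smooth H kh" by (rule smooth_cong[OF _ H(1)]) (simp add: kh_def)
      then show ?thesis using True H by blast
    next
      case False
      have "smooth (- cball y r) kh"
        by (rule smooth_cong[OF smooth_const[of _ 0]]) (use k in \<open>auto simp: kh_def\<close>)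
      then show ?thesis using False sub by (intro exI[of _ "- cball y r"]) auto
    qed
  qed auto
  define K where "K = {q\<in>U. \<phi> q \<in> cball y r}"
  have g0: "g q = 0" if "q \<notin> K" for q using that k by (auto simp: g_def K_def)
  have gU: "g q = kh (\<phi> q)" if "q \<in> U" for q
    using that k(2)[of "\<phi> q"] sub(1) by (auto simp: g_def kh_def simp del: mem_cball)
  have "closedin (top_of M) K"
  proof (rule compactin_imp_closedin)
    show "Hausdorff_space (top_of M)" using mfd by (simp add: smooth_manifold_def)
    have "\<phi> ` K = model M \<inter> cball y r" using sub chart_model[OF c] by (auto simp: K_def)
    moreover have "compact (model M \<inter> cball y r)"
      by (intro closed_Int_compact closed_subspace subspace_model compact_cball)
    ultimately have "compactin (top_of_set (\<phi> ` U)) (\<phi> ` K)"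
      using sub by (simp add: compactin_subtopology)
    moreover have "K \<subseteq> topspace (subtopology (top_of M) U)" using chart_sub[OF c] by (auto simp: K_def)
    ultimately have "compactin (subtopology (top_of M) U) K"
      using homeomorphic_map_compactness[OF chart_homeo[OF c]] by blast
    then show "compactin (top_of M) K" by (simp add: compactin_subtopology)
  qed
  have "g \<in> smooth_functions M"
    unfolding smooth_functions_iff
  proof clarify
    fix V \<psi> assume d: "(V,\<psi>) \<in> charts M"
    show "smooth (dom V \<psi>) (\<lambda>x. g (par V \<psi> x))"
    proof (rule smooth_local[OF _ open_dom[OF d]])
      fix x assume x: "x \<in> dom V \<psi>"
      show "\<exists>T. open T \<and> x \<in> T \<and> smooth T (\<lambda>x. g (par V \<psi> x))"
      proof (cases "par V \<psi> x \<in> U")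
        case True
        let ?T = "dom (V \<inter> U) \<psi>"
        have o: "open ?T" by (rule open_dom_sub[OF d chart_open[OF c]])
        have "smooth ?T (\<lambda>x. kh (\<phi> (par V \<psi> x)))"
          by (rule smooth_compose[OF smooth_transition[OF d c] kh o]) auto
        then have "smooth ?T (\<lambda>x. g (par V \<psi> x))"
          by (rule smooth_cong[OF _ o]) (metis dom_mono dom_sub_iff[OF d] gU subsetD)
        then show ?thesis using o True dom_sub_iff[OF d x] by blast
      next
        case False
        let ?T = "dom (V \<inter> (points M - K)) \<psi>"
        have o: "open ?T"
          by (rule open_dom_sub[OF d]) (use \<open>closedin _ K\<close> in auto)
        have "smooth ?T (\<lambda>x. g (par V \<psi> x))"
          by (rule smooth_cong[OF smooth_const[of _ 0] o]) (metis Diff_iff dom_mono dom_sub_iff[OF d] g0 subsetD)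
        moreover have "x \<in> ?T"
          using False dom_sub_iff[OF d x] par_in[OF x] chart_sub[OF d] by (auto simp: K_def)
        ultimately show ?thesis using o by blast
      qed
    qed
  qed
  then show ?thesis by (simp add: g_def)
qed

lemma chart_bump:
  assumes c: "(U,\<phi>) \<in> charts M" and p: "p \<in> U" and H: "open H" "\<phi> p \<in> H"
  obtains r k where "r > 0" "smooth UNIV (k :: 'e \<Rightarrow> real)" "\<And>x. x \<in> ball (\<phi> p) (r/2) \<Longrightarrow> k x = 1"
    "\<And>x. x \<notin> cball (\<phi> p) r \<Longrightarrow> k x = 0" "cball (\<phi> p) r \<subseteq> H" "model M \<inter> cball (\<phi> p) r \<subseteq> \<phi> ` U"
proof -
  obtain T where T: "open T" "\<phi> ` U = model M \<inter> T" using chart_image[OF c] by (auto simp: openin_open)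
  have "open (H \<inter> T)" "\<phi> p \<in> H \<inter> T" using T H p by auto
  then obtain r where r: "r > 0" "cball (\<phi> p) r \<subseteq> H \<inter> T" using open_contains_cball by blast
  obtain k :: "'e \<Rightarrow> real" where k: "smooth UNIV k" "\<And>x. x \<in> ball (\<phi> p) (r/2) \<Longrightarrow> k x = 1" "\<And>x. x \<notin> ball (\<phi> p) r \<Longrightarrow> k x = 0"
    using bump_exists[OF r(1)] by metis
  show ?thesis by (rule that[OF r(1) k(1,2)]) (use k(3) r T in auto)
qed

lemma smooth_near_chart:
  assumes c: "(U,\<phi>) \<in> charts M" and p: "p \<in> U" and H: "open H" "\<phi> p \<in> H" "smooth H h"
  shows "smooth_near M p (\<lambda>q. h (\<phi> q))"
proof -
  obtain r k where r: "r > 0" "smooth UNIV (k :: 'e \<Rightarrow> real)" "\<And>x. x \<in> ball (\<phi> p) (r/2) \<Longrightarrow> k x = 1"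
    "\<And>x. x \<notin> cball (\<phi> p) r \<Longrightarrow> k x = 0" "cball (\<phi> p) r \<subseteq> H" "model M \<inter> cball (\<phi> p) r \<subseteq> \<phi> ` U"
    using chart_bump[OF c p H(1,2)] by blast
  show ?thesis
    by (rule smooth_nearI[OF smooth_extend_by_zero[OF c H(1,3) r(2,4,5,6)] chart_vimage_open[OF c open_ball, of "\<phi> p" "r/2"]])
      (use r p in auto)
qed

lemma smooth_near_compose:
  fixes u :: "'m \<Rightarrow> 'a::euclidean_space"
  assumes u: "\<And>b. b \<in> Basis \<Longrightarrow> smooth_near M p (\<lambda>q. u q \<bullet> b)" and H: "open H" "u p \<in> H" "smooth H h" and p: "p \<in> points M"
  shows "smooth_near M p (\<lambda>q. h (u q))"
proof -
  obtain U \<phi> where c: "(U,\<phi>) \<in> charts M" and pU: "p \<in> U" using chart_cover[OF p] by blast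
  have "\<exists>W. openin (top_of M) W \<and> p \<in> W \<and> smooth (dom (U \<inter> W) \<phi>) (\<lambda>x. u (par U \<phi> x) \<bullet> b)" if "b \<in> Basis" for b
    using smooth_near_par[OF u[OF that] c pU] by metis
  then obtain W where W: "\<And>b. b \<in> Basis \<Longrightarrow> openin (top_of M) (W b) \<and> p \<in> W b \<and> smooth (dom (U \<inter> W b) \<phi>) (\<lambda>x. u (par U \<phi> x) \<bullet> b)"
    by metis
  define V where "V = U \<inter> (\<Inter>b\<in>Basis. W b)"
  have "openin (top_of M) (\<Inter>b\<in>Basis. W b)" using W by (intro openin_INT2) auto
  then have oT: "open (dom V \<phi>)" unfolding V_def by (rule open_dom_sub[OF c])
  have sT: "smooth (dom V \<phi>) (\<lambda>x. u (par U \<phi> x))"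
  proof (rule smooth_componentwise[OF _ oT])
    fix b :: 'a assume b: "b \<in> Basis"
    show "smooth (dom V \<phi>) (\<lambda>x. u (par U \<phi> x) \<bullet> b)"
      by (rule smooth_subset[of "dom (U \<inter> W b) \<phi>"])
        (use W[OF b] open_dom_sub[OF c] oT b in \<open>auto simp: V_def dom_def\<close>)
  qed
  have pV: "\<phi> p \<in> dom V \<phi>" using pU W Pr(3)[OF chart_model[OF c pU]] by (auto simp: V_def dom_def)
  define G where "G = dom V \<phi> \<inter> (\<lambda>x. u (par U \<phi> x)) -` H"
  have oG: "open G" unfolding G_def
    by (rule continuous_open_preimage[OF smooth_continuous[OF sT oT] oT H(1)])
  have "smooth G (\<lambda>x. h (u (par U \<phi> x)))"
    by (rule smooth_compose[OF smooth_subset[OF sT oT oG] H(3) oG H(1)]) (auto simp: G_def)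
  moreover have "\<phi> p \<in> G" using pV H par_chart[OF c pU] by (simp add: G_def)
  ultimately have "smooth_near M p (\<lambda>q. h (u (par U \<phi> (\<phi> q))))"
    by (intro smooth_near_chart[OF c pU oG])
  then show ?thesis
    by (rule smooth_near_cong[OF _ chart_open[OF c] pU]) (simp add: par_chart[OF c])
qed

end

section \<open>Tangent vectors and vector fields\<close>

text \<open>The differential of \<open>u\<close> applied to \<open>v\<close>, read off componentwise
  by letting the derivation act on the components of \<open>u\<close>.\<close>

definition cvec :: "('m \<Rightarrow> 'e::euclidean_space) \<Rightarrow> 'm tangent \<Rightarrow> 'e"
  where "cvec u v = (\<Sum>b\<in>Basis. v (\<lambda>q. u q \<bullet> b) *\<^sub>R b)"

lemma cvec_inner: "b \<in> Basis \<Longrightarrow> cvec u v \<bullet> b = v (\<lambda>q. u q \<bullet> b)"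
  by (simp add: cvec_def inner_sum_left inner_Basis if_distrib cong: if_cong)

lemma cvec_add: "cvec u (v + w) = cvec u v + cvec u w"
  by (simp add: cvec_def scaleR_add_left sum.distrib)

lemma cvec_scaleR: "cvec u (c *\<^sub>R v) = c *\<^sub>R cvec u v"
  by (simp add: cvec_def scaleR_fun_def scaleR_sum_right)

lemma cvec_zero: "cvec u 0 = 0"
  by (simp add: cvec_def)

lemma cvec_sum: "cvec u (\<Sum>i\<in>I. w i) = (\<Sum>i\<in>I. cvec u (w i))"
  by (induction I rule: infinite_finite_induct) (simp_all only: sum.infinite sum.empty sum.insert cvec_add cvec_zero not_False_eq_True)

context mfd
begin

lemma tangent_add: "v \<in> tangent_space M p \<Longrightarrow> f \<in> smooth_functions M \<Longrightarrow> g \<in> smooth_functions M \<Longrightarrow>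
    v (\<lambda>x. f x + g x) = v f + v g"
  and tangent_mult: "v \<in> tangent_space M p \<Longrightarrow> f \<in> smooth_functions M \<Longrightarrow> g \<in> smooth_functions M \<Longrightarrow>
    v (\<lambda>x. f x * g x) = f p * v g + v f * g p"
  and tangent_cmul: "v \<in> tangent_space M p \<Longrightarrow> f \<in> smooth_functions M \<Longrightarrow> v (\<lambda>x. c * f x) = c * v f"
  and tangent_nonsmooth: "v \<in> tangent_space M p \<Longrightarrow> f \<notin> smooth_functions M \<Longrightarrow> v f = 0"
  by (simp_all add: tangent_space_def)

lemma tangent_const: "v \<in> tangent_space M p \<Longrightarrow> v (\<lambda>x. c) = 0"
  using tangent_mult[of v p "\<lambda>x. 1" "\<lambda>x. 1"] tangent_cmul[of v p "\<lambda>x. 1" c] smooth_functions_const[of 1]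
  by simp

lemma tangent_sum:
  "v \<in> tangent_space M p \<Longrightarrow> (\<And>i. i \<in> I \<Longrightarrow> f i \<in> smooth_functions M) \<Longrightarrow> v (\<lambda>x. \<Sum>i\<in>I. f i x) = (\<Sum>i\<in>I. v (f i))"
proof (induction I rule: infinite_finite_induct)
  case (insert i I)
  then show ?case using tangent_add[of v p "f i" "\<lambda>x. \<Sum>i\<in>I. f i x"] smooth_functions_sum[of I f] by simp
qed (auto simp: tangent_const)

lemma tangent_diff:
  assumes "v \<in> tangent_space M p" "f \<in> smooth_functions M" "g \<in> smooth_functions M"
  shows "v (\<lambda>x. f x - g x) = v f - v g"
  using tangent_add[OF assms(1,2) smooth_functions_uminus[OF assms(3)]] tangent_cmul[OF assms(1,3), of "-1"] by simp

lemma bump_function: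
  assumes "openin (top_of M) W" "p \<in> W"
  obtains k where "k \<in> smooth_functions M" "k p = 1" "\<And>q. q \<notin> W \<Longrightarrow> k q = 0"
proof -
  have "p \<in> points M" using assms openin_subset by blast
  then obtain U \<phi> where c: "(U,\<phi>) \<in> charts M" and pU: "p \<in> U" using chart_cover by blast
  have x: "\<phi> q \<in> dom (U \<inter> W) \<phi> \<longleftrightarrow> q \<in> W" if "q \<in> U" for q
    using dom_sub_iff[OF c chart_dom[OF c that]] par_chart[OF c that] by simp
  obtain r k where r: "r > 0" "smooth UNIV (k :: 'e \<Rightarrow> real)" "\<And>x. x \<in> ball (\<phi> p) (r/2) \<Longrightarrow> k x = 1"
    "\<And>x. x \<notin> cball (\<phi> p) r \<Longrightarrow> k x = 0" "cball (\<phi> p) r \<subseteq> dom (U \<inter> W) \<phi>" "model M \<inter> cball (\<phi> p) r \<subseteq> \<phi> ` U"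
    using chart_bump[OF c pU open_dom_sub[OF c assms(1)]] x[OF pU] assms(2) by blast
  show ?thesis
  proof (rule that[OF smooth_extend_by_zero[OF c open_UNIV smooth_const[of _ 1] r(2,4) _ r(6)]])
    fix q assume "q \<notin> W"
    then show "(if q \<in> U then k (\<phi> q) * 1 else 0) = 0" using x r(4,5) by (auto simp del: mem_cball)
  qed (use pU r in auto)
qed

text \<open>With a bump k that is 1 at p and 0 off W, the product (f - g) k is identically zero. The
  Leibniz rule at p leaves v(f - g), since f - g vanishes at p.\<close>

lemma tangent_local:
  assumes v: "v \<in> tangent_space M p" and f: "f \<in> smooth_functions M" and g: "g \<in> smooth_functions M"
    and W: "openin (top_of M) W" "p \<in> W" "\<And>q. q \<in> W \<Longrightarrow> f q = g q"
  shows "v f = v g"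
proof -
  obtain k where k: "k \<in> smooth_functions M" "k p = 1" "\<And>q. q \<notin> W \<Longrightarrow> k q = 0"
    using bump_function[OF W(1,2)] by blast
  have "(f q - g q) * k q = 0" for q using k(3)[of q] W(3)[of q] by (cases "q \<in> W") auto
  then have "(\<lambda>q. (f q - g q) * k q) = (\<lambda>q. 0)" by blast
  then have "v (\<lambda>q. (f q - g q) * k q) = 0" using tangent_const[OF v, of 0] by simp
  moreover have "v (\<lambda>q. (f q - g q) * k q) = (f p - g p) * v k + v (\<lambda>q. f q - g q) * k p"
    by (rule tangent_mult[OF v smooth_functions_diff[OF f g] k(1)])
  ultimately show ?thesis using tangent_diff[OF v f g] W(2,3) k(2) by simp
qed

lemma smooth_vimage_open:
  fixes u :: "'m \<Rightarrow> 'a::euclidean_space"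
  assumes u: "\<And>b. (\<lambda>q. u q \<bullet> b) \<in> smooth_functions M" and H: "open H" "u p \<in> H" and p: "p \<in> points M"
  obtains W where "openin (top_of M) W" "p \<in> W" "\<And>q. q \<in> W \<Longrightarrow> u q \<in> H"
proof -
  obtain U \<phi> where c: "(U,\<phi>) \<in> charts M" and pU: "p \<in> U" using chart_cover[OF p] by blast
  have "smooth (dom U \<phi>) (\<lambda>x. u (par U \<phi> x))"
    by (rule smooth_componentwise[OF smooth_functionsD[OF u c] open_dom[OF c]])
  then have "open (dom U \<phi> \<inter> (\<lambda>x. u (par U \<phi> x)) -` H)"
    by (intro continuous_open_preimage smooth_continuous open_dom[OF c] H(1))
  from chart_vimage_open[OF c this]
  have "openin (top_of M) {q \<in> U. \<phi> q \<in> dom U \<phi> \<inter> (\<lambda>x. u (par U \<phi> x)) -` H}" .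
  moreover have "{q \<in> U. \<phi> q \<in> dom U \<phi> \<inter> (\<lambda>x. u (par U \<phi> x)) -` H} = {q \<in> U. u q \<in> H}"
    using par_chart[OF c] chart_dom[OF c] by auto
  ultimately have o: "openin (top_of M) {q \<in> U. u q \<in> H}" by (simp only:)
  show ?thesis by (rule that[OF o]) (use pU H in auto)
qed

lemma continuous_map_smooth:
  fixes u :: "'m \<Rightarrow> 'a::euclidean_space"
  assumes u: "\<And>b. (\<lambda>q. u q \<bullet> b) \<in> smooth_functions M"
  shows "continuous_map (top_of M) euclidean u"
  unfolding continuous_map
proof (intro conjI allI impI)
  fix H :: "'a set" assume "openin euclidean H"
  then have H: "open H" by simp
  show "openin (top_of M) {q \<in> points M. u q \<in> H}"
  proof (subst openin_subopen, intro ballI)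
    fix p assume "p \<in> {q \<in> points M. u q \<in> H}"
    then obtain W where "openin (top_of M) W" "p \<in> W" "\<And>q. q \<in> W \<Longrightarrow> u q \<in> H"
      using smooth_vimage_open[OF u H] by blast
    then show "\<exists>W. openin (top_of M) W \<and> p \<in> W \<and> W \<subseteq> {q \<in> points M. u q \<in> H}"
      using openin_subset by blast
  qed
qed simp

text \<open>Hadamard's lemma writes h o u near p as a constant plus products (u_b - u_b(p)) g_b(u).
  Under the derivation only v(u_b) g_b(u p) survives, and g_b(u p) is the partial derivative of
  h.\<close>

lemma tangent_chain:
  fixes u :: "'m \<Rightarrow> 'a::euclidean_space"
  assumes v: "v \<in> tangent_space M p" and u: "\<And>b. (\<lambda>q. u q \<bullet> b) \<in> smooth_functions M"
    and H: "open H" "u p \<in> H" "smooth H h" and f: "f \<in> smooth_functions M"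
    and W: "openin (top_of M) W" "p \<in> W" "\<And>q. q \<in> W \<Longrightarrow> f q = h (u q)"
  shows "v f = Dv h (u p) (cvec u v)"
proof -
  have p: "p \<in> points M" using W openin_subset by blast
  obtain r where r: "r > 0" "ball (u p) r \<subseteq> H" using H(1,2) open_contains_ball by blast
  have sm: "smooth (ball (u p) r) h" by (rule smooth_subset[OF H(3,1) open_ball r(2)])
  obtain g where g: "\<And>b. smooth (ball (u p) r) (g b)" "\<And>b. g b (u p) = Dv h (u p) b"
    "\<And>x. x \<in> ball (u p) r \<Longrightarrow> h x = h (u p) + (\<Sum>b\<in>Basis. ((x - u p) \<bullet> b) * g b x)"
    using hadamard[OF sm r(1)] by metis
  have "smooth_near M p (\<lambda>q. g b (u q))" for b
    by (rule smooth_near_compose[OF smooth_near_smooth[OF u p] open_ball _ g(1) p]) (use r in auto)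
  then have "\<exists>k W. k \<in> smooth_functions M \<and> openin (top_of M) W \<and> p \<in> W \<and> (\<forall>q\<in>W. g b (u q) = k q)" for b
    unfolding smooth_near_def by blast
  then obtain k Wk where k: "\<And>b. k b \<in> smooth_functions M" "\<And>b. openin (top_of M) (Wk b)" "\<And>b. p \<in> Wk b"
    "\<And>b q. q \<in> Wk b \<Longrightarrow> g b (u q) = k b q" by metis
  obtain W2 where W2: "openin (top_of M) W2" "p \<in> W2" "\<And>q. q \<in> W2 \<Longrightarrow> u q \<in> ball (u p) r"
    using smooth_vimage_open[OF u open_ball _ p, of "u p" r] r by auto
  define F where "F = (\<lambda>q. h (u p) + (\<Sum>b\<in>Basis. (u q \<bullet> b - u p \<bullet> b) * k b q))"
  have ub: "(\<lambda>q. u q \<bullet> b - u p \<bullet> b) \<in> smooth_functions M" for b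
    by (intro smooth_functions_diff u smooth_functions_const)
  have sF: "(\<lambda>q. \<Sum>b\<in>Basis. (u q \<bullet> b - u p \<bullet> b) * k b q) \<in> smooth_functions M"
    by (intro smooth_functions_sum smooth_functions_mult ub k)
  have F: "F \<in> smooth_functions M" unfolding F_def by (intro smooth_functions_add sF smooth_functions_const)
  have "v f = v F"
  proof (rule tangent_local[OF v f F])
    show "openin (top_of M) (W \<inter> (W2 \<inter> (\<Inter>b\<in>Basis. Wk b)))"
      using W W2 k by (intro openin_Int openin_INT2) auto
    show "p \<in> W \<inter> (W2 \<inter> (\<Inter>b\<in>Basis. Wk b))" using W W2 k by auto
    fix q assume q: "q \<in> W \<inter> (W2 \<inter> (\<Inter>b\<in>Basis. Wk b))"
    have "f q = h (u p) + (\<Sum>b\<in>Basis. ((u q - u p) \<bullet> b) * g b (u q))"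
      using W(3) W2(3) g(3) q by auto
    also have "(\<Sum>b\<in>Basis. ((u q - u p) \<bullet> b) * g b (u q)) = (\<Sum>b\<in>Basis. (u q \<bullet> b - u p \<bullet> b) * k b q)"
      using k(4) q by (intro sum.cong) (auto simp: inner_diff_left)
    finally show "f q = F q" by (simp add: F_def)
  qed
  also have "\<dots> = (\<Sum>b\<in>Basis. v (\<lambda>q. (u q \<bullet> b - u p \<bullet> b) * k b q))"
    unfolding F_def using tangent_add[OF v smooth_functions_const sF] tangent_const[OF v]
      tangent_sum[OF v smooth_functions_mult[OF ub k(1)]] by simp
  also have "\<dots> = (\<Sum>b\<in>Basis. v (\<lambda>q. u q \<bullet> b) * Dv h (u p) b)"
  proof (rule sum.cong[OF refl])
    fix b :: 'a assume "b \<in> Basis"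
    have "v (\<lambda>q. (u q \<bullet> b - u p \<bullet> b) * k b q) = v (\<lambda>q. u q \<bullet> b) * k b p"
      using tangent_mult[OF v ub k(1)] tangent_diff[OF v u smooth_functions_const] tangent_const[OF v] by simp
    then show "v (\<lambda>q. (u q \<bullet> b - u p \<bullet> b) * k b q) = v (\<lambda>q. u q \<bullet> b) * Dv h (u p) b"
      using k(3,4) g(2) by metis
  qed
  also have "\<dots> = (\<Sum>b\<in>Basis. (cvec u v \<bullet> b) *\<^sub>R Dv h (u p) b)" by (simp add: cvec_inner)
  also have "\<dots> = Dv h (u p) (cvec u v)"
    by (rule linear_expand[symmetric]) (rule smooth_linear_Dv[OF H(3,1,2)])
  finally show ?thesis .
qed

section \<open>Linear structure of tangent vectors and vector fields; coordinates\<close>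

lemma tangent_zero: "0 \<in> tangent_space M p"
  by (simp add: tangent_space_def)

lemma tangent_plus: "v \<in> tangent_space M p \<Longrightarrow> w \<in> tangent_space M p \<Longrightarrow> v + w \<in> tangent_space M p"
  by (simp add: tangent_space_def algebra_simps)

lemma tangent_scaleR: "v \<in> tangent_space M p \<Longrightarrow> c *\<^sub>R v \<in> tangent_space M p"
  by (simp add: tangent_space_def scaleR_fun_def algebra_simps)

lemma tangent_uminus: "v \<in> tangent_space M p \<Longrightarrow> - v \<in> tangent_space M p"
  using tangent_scaleR[of v p "-1"] by simp

lemma tangent_minus: "v \<in> tangent_space M p \<Longrightarrow> w \<in> tangent_space M p \<Longrightarrow> v - w \<in> tangent_space M p"
  using tangent_plus[OF _ tangent_uminus] by simp

lemma tangent_sum_mem: "(\<And>i. i \<in> I \<Longrightarrow> v i \<in> tangent_space M p) \<Longrightarrow> (\<Sum>i\<in>I. v i) \<in> tangent_space M p"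
  by (induction I rule: infinite_finite_induct) (auto intro: tangent_zero tangent_plus)

lemma vector_fieldD: "X \<in> vector_fields M \<Longrightarrow> p \<in> points M \<Longrightarrow> X p \<in> tangent_space M p"
  "X \<in> vector_fields M \<Longrightarrow> f \<in> smooth_functions M \<Longrightarrow> (\<lambda>p. X p f) \<in> smooth_functions M"
  by (simp_all add: vector_fields_def)

lemma vector_field_plus: "X \<in> vector_fields M \<Longrightarrow> Y \<in> vector_fields M \<Longrightarrow> (\<lambda>p. X p + Y p) \<in> vector_fields M"
  by (auto simp: vector_fields_def intro!: tangent_plus smooth_functions_add)

lemma vector_field_scale:
  "f \<in> smooth_functions M \<Longrightarrow> X \<in> vector_fields M \<Longrightarrow> (\<lambda>p. f p *\<^sub>R X p) \<in> vector_fields M"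
proof -
  assume f: "f \<in> smooth_functions M" and X: "X \<in> vector_fields M"
  have "f p *\<^sub>R X p \<in> tangent_space M p" if "p \<in> points M" for p
    by (rule tangent_scaleR[OF vector_fieldD(1)[OF X that]])
  moreover have "(\<lambda>p. (f p *\<^sub>R X p) g) \<in> smooth_functions M" if "g \<in> smooth_functions M" for g
    using smooth_functions_mult[OF f vector_fieldD(2)[OF X that]] by (simp add: scaleR_fun_def)
  ultimately show ?thesis by (simp add: vector_fields_def)
qed

lemma vector_field_cscale: "X \<in> vector_fields M \<Longrightarrow> (\<lambda>p. c *\<^sub>R X p) \<in> vector_fields M"
  by (rule vector_field_scale[OF smooth_functions_const])

lemma vector_field_zero: "(\<lambda>p. 0) \<in> vector_fields M"
  by (auto simp: vector_fields_def tangent_zero smooth_functions_const)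

lemma vector_field_sum:
  "(\<And>i. i \<in> I \<Longrightarrow> X i \<in> vector_fields M) \<Longrightarrow> (\<lambda>p. \<Sum>i\<in>I. X i p) \<in> vector_fields M"
  by (induction I rule: infinite_finite_induct) (auto intro: vector_field_zero vector_field_plus)

text \<open>
  \<open>coords u W \<sigma> G\<close>: the components of \<open>u\<close> are globally smooth functions that restrict to
  coordinates on \<open>W\<close>; \<open>\<sigma>\<close> is the inverse parametrization, extended to an open set \<open>G\<close> of the
  whole Euclidean space so that it factors through the projection onto the model space.
\<close>

definition coords :: "('m \<Rightarrow> 'e) \<Rightarrow> 'm set \<Rightarrow> ('e \<Rightarrow> 'm) \<Rightarrow> 'e set \<Rightarrow> bool"
  where "coords u W \<sigma> G \<longleftrightarrow>
    (\<forall>b. (\<lambda>q. u q \<bullet> b) \<in> smooth_functions M) \<and> openin (top_of M) W \<and> open G \<and>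
    (\<forall>q\<in>W. u q \<in> model M \<and> u q \<in> G \<and> \<sigma> (u q) = q) \<and>
    (\<forall>x\<in>G. \<sigma> x \<in> W \<and> u (\<sigma> x) = Pr x) \<and>
    (\<forall>f\<in>smooth_functions M. smooth G (\<lambda>x. f (\<sigma> x))) \<and>
    (\<forall>V. openin (top_of M) V \<longrightarrow> open {x\<in>G. \<sigma> x \<in> V}) \<and>
    (\<forall>a\<in>model M. \<exists>Z\<in>vector_fields M. \<forall>q\<in>W. \<forall>b. Z q (\<lambda>q. u q \<bullet> b) = a \<bullet> b)"

text \<open>The coordinate field in direction \<open>a\<close>, damped by the bump k and extended by
  zero. For fixed f its action is k times a directional derivative of f in the chart, so smoothness
  is an instance of \<open>smooth_extend_by_zero\<close>.\<close>

lemma chart_field: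
  assumes c: "(U,\<phi>) \<in> charts M" and k: "smooth UNIV (k :: 'e \<Rightarrow> real)" "\<And>x. x \<notin> cball y r \<Longrightarrow> k x = 0"
    and r: "cball y r \<subseteq> dom U \<phi>" "model M \<inter> cball y r \<subseteq> \<phi> ` U"
  shows "(\<lambda>q f. if f \<in> smooth_functions M then if q \<in> U then k (\<phi> q) * Dv (\<lambda>x. f (par U \<phi> x)) (\<phi> q) a else 0 else 0) \<in> vector_fields M"
    (is "?Z \<in> _")
  unfolding vector_fields_def
proof (intro CollectI conjI ballI)
  fix f assume f: "f \<in> smooth_functions M"
  then show "(\<lambda>q. ?Z q f) \<in> smooth_functions M"
    using smooth_extend_by_zero[OF c open_dom[OF c] smooth_Dv[OF smooth_functionsD[OF f c] open_dom[OF c]] k r] by simp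
next
  fix q assume "q \<in> points M"
  have D: "((\<lambda>x. f (par U \<phi> x)) has_derivative Dv (\<lambda>x. f (par U \<phi> x)) (\<phi> q)) (at (\<phi> q))"
    if "f \<in> smooth_functions M" "q \<in> U" for f
    by (rule smooth_has_derivative[OF smooth_functionsD[OF that(1) c] open_dom[OF c] chart_dom[OF c that(2)]])
  show "?Z q \<in> tangent_space M q"
  proof (cases "q \<in> U")
    case False
    then show ?thesis by (simp add: tangent_space_def)
  next
    case True
    note pq = par_chart[OF c True]
    show ?thesis
      unfolding tangent_space_def
    proof (intro CollectI conjI ballI allI impI)
      fix f g assume f: "f \<in> smooth_functions M" and g: "g \<in> smooth_functions M"
      show "?Z q (\<lambda>x. f x + g x) = ?Z q f + ?Z q g"
        using f g True Dv_eq[OF has_derivative_add[OF D[OF f True] D[OF g True]]] smooth_functions_add[OF f g]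
        by (simp add: algebra_simps)
      show "?Z q (\<lambda>x. f x * g x) = f q * ?Z q g + ?Z q f * g q"
        using f g True Dv_eq[OF has_derivative_mult[OF D[OF f True] D[OF g True]]] smooth_functions_mult[OF f g] pq
        by (simp add: algebra_simps)
    next
      fix f c' assume f: "f \<in> smooth_functions M"
      show "?Z q (\<lambda>x. c' * f x) = c' * ?Z q f"
        using f True Dv_eq[OF has_derivative_mult_right[OF D[OF f True], of c']] smooth_functions_mult[OF smooth_functions_const f, of c']
        by (simp add: algebra_simps)
    qed auto
  qed
qed

lemma coords_of_chart:
  assumes c: "(U,\<phi>) \<in> charts M" and pU: "p \<in> U"
  obtains u W \<sigma> G where "coords u W \<sigma> G" "p \<in> W" "\<And>q. q \<in> W \<Longrightarrow> u q = \<phi> q"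
proof -
  obtain r k where r: "r > 0" and k: "smooth UNIV (k :: 'e \<Rightarrow> real)" "\<And>x. x \<in> ball (\<phi> p) (r/2) \<Longrightarrow> k x = 1"
    "\<And>x. x \<notin> cball (\<phi> p) r \<Longrightarrow> k x = 0" and rr: "cball (\<phi> p) r \<subseteq> dom U \<phi>" "model M \<inter> cball (\<phi> p) r \<subseteq> \<phi> ` U"
    using chart_bump[OF c pU open_dom[OF c] chart_dom[OF c pU]] by blast
  define W where "W = {q\<in>U. \<phi> q \<in> ball (\<phi> p) (r/2)}"
  \<comment> \<open>Multiplication by the bump makes the components of the chart globally smooth, so
    that derivations act on them. On \<open>W\<close>, where k = 1, the chart itself is
    unchanged.\<close>
  define u where "u = (\<lambda>q. if q \<in> U then k (\<phi> q) *\<^sub>R \<phi> q else 0)"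
  define \<sigma> where "\<sigma> = par U \<phi>"
  define G where "G = dom (U \<inter> W) \<phi>"
  have W: "openin (top_of M) W" unfolding W_def by (rule chart_vimage_open[OF c open_ball])
  have WU: "q \<in> U" if "q \<in> W" for q using that by (simp add: W_def)
  have uW: "u q = \<phi> q" if "q \<in> W" for q using that k by (simp add: W_def u_def)
  have G: "open G" unfolding G_def by (rule open_dom_sub[OF c W])
  have Gd: "G \<subseteq> dom U \<phi>" unfolding G_def by (rule dom_mono)
  have \<sigma>W: "\<sigma> x \<in> W" if "x \<in> G" for x using that dom_sub_iff[OF c, of x W] Gd by (auto simp: G_def \<sigma>_def)
  have u\<sigma>: "u (\<sigma> x) = Pr x" if "x \<in> G" for x
    using uW[OF \<sigma>W[OF that]] chart_par[of x U \<phi>] that Gd by (auto simp: \<sigma>_def)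
  have uG: "u q \<in> G" if "q \<in> W" for q
    using that uW dom_sub_iff[OF c chart_dom[OF c], of q W] par_chart[OF c] WU by (auto simp: G_def)
  have su: "(\<lambda>q. u q \<bullet> b) \<in> smooth_functions M" for b
  proof -
    have "(\<lambda>q. if q \<in> U then k (\<phi> q) * (\<phi> q \<bullet> b) else 0) \<in> smooth_functions M"
      by (rule smooth_extend_by_zero[OF c open_UNIV _ k(1,3) _ rr(2)]) (auto intro: smooth_inner smooth_id)
    moreover have "(\<lambda>q. u q \<bullet> b) = (\<lambda>q. if q \<in> U then k (\<phi> q) * (\<phi> q \<bullet> b) else 0)" by (auto simp: u_def)
    ultimately show ?thesis by simp
  qed
  have Z: "\<exists>Z\<in>vector_fields M. \<forall>q\<in>W. \<forall>b. Z q (\<lambda>q. u q \<bullet> b) = a \<bullet> b" if a: "a \<in> model M" for a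
  proof (intro bexI[OF _ chart_field[OF c k(1,3) rr, of a]] ballI allI)
    fix q b assume q: "q \<in> W"
    have "((\<lambda>x. Pr x \<bullet> b) has_derivative (\<lambda>x. Pr x \<bullet> b)) (at (\<phi> q))"
      by (intro bounded_linear_imp_has_derivative bounded_linear_inner_left_comp)
        (use Pr(1) linear_conv_bounded_linear in blast)
    then have "((\<lambda>x. u (par U \<phi> x) \<bullet> b) has_derivative (\<lambda>x. Pr x \<bullet> b)) (at (\<phi> q))"
      by (rule has_derivative_transform_within_open[OF _ G]) (use u\<sigma> uG[OF q] uW[OF q] \<sigma>_def in auto)
    from Dv_eq[OF this] show "(if (\<lambda>q. u q \<bullet> b) \<in> smooth_functions M
        then if q \<in> U then k (\<phi> q) * Dv (\<lambda>x. u (par U \<phi> x) \<bullet> b) (\<phi> q) a else 0 else 0) = a \<bullet> b"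
      using su q k(2) Pr(3)[OF a] by (auto simp: W_def)
  qed
  have sG: "smooth G (\<lambda>x. f (\<sigma> x))" if "f \<in> smooth_functions M" for f
    unfolding \<sigma>_def by (rule smooth_subset[OF smooth_functionsD[OF that c] open_dom[OF c] G Gd])
  have oG: "open {x\<in>G. \<sigma> x \<in> V}" if V: "openin (top_of M) V" for V
  proof -
    have "{x\<in>G. \<sigma> x \<in> V} = dom (U \<inter> W) \<phi> \<inter> dom (U \<inter> V) \<phi>"
      using dom_sub_iff[OF c, of _ V] Gd by (auto simp: G_def \<sigma>_def)
    then show ?thesis using open_dom_sub[OF c V] open_dom_sub[OF c W] by auto
  qed
  have "u q \<in> model M \<and> \<sigma> (u q) = q" if "q \<in> W" for q
    using uW[OF that] chart_model[OF c WU[OF that]] par_chart[OF c WU[OF that]] by (simp add: \<sigma>_def)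
  then have "coords u W \<sigma> G"
    unfolding coords_def using su W G uG \<sigma>W u\<sigma> sG oG Z by blast
  moreover have "p \<in> W" using pU r by (simp add: W_def)
  ultimately show ?thesis using uW by (rule that)
qed

lemma coords_exist:
  assumes "p \<in> points M"
  obtains u W \<sigma> G where "coords u W \<sigma> G" "p \<in> W"
  using chart_cover[OF assms] coords_of_chart by metis

context
  fixes u W \<sigma> G
  assumes C: "coords u W \<sigma> G"
begin

lemma coords_smooth: "(\<lambda>q. u q \<bullet> b) \<in> smooth_functions M"
  and coords_open: "openin (top_of M) W" "open G"
  and coords_point: "q \<in> W \<Longrightarrow> u q \<in> model M" "q \<in> W \<Longrightarrow> u q \<in> G" "q \<in> W \<Longrightarrow> \<sigma> (u q) = q"
  and coords_par: "x \<in> G \<Longrightarrow> \<sigma> x \<in> W" "x \<in> G \<Longrightarrow> u (\<sigma> x) = Pr x"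
  and coords_smooth_par: "f \<in> smooth_functions M \<Longrightarrow> smooth G (\<lambda>x. f (\<sigma> x))"
  and coords_open_par: "openin (top_of M) V \<Longrightarrow> open {x\<in>G. \<sigma> x \<in> V}"
  and coords_field: "a \<in> model M \<Longrightarrow> \<exists>Z\<in>vector_fields M. \<forall>q\<in>W. \<forall>b. Z q (\<lambda>q. u q \<bullet> b) = a \<bullet> b"
  using C by (simp_all add: coords_def)

lemma coords_sub: "q \<in> W \<Longrightarrow> q \<in> points M"
  using coords_open(1) openin_subset by blast

lemma coords_chain:
  assumes v: "v \<in> tangent_space M q" and q: "q \<in> W" and f: "f \<in> smooth_functions M"
  shows "v f = Dv (\<lambda>x. f (\<sigma> x)) (u q) (cvec u v)"
  by (rule tangent_chain[OF v coords_smooth coords_open(2) coords_point(2)[OF q] coords_smooth_par[OF f] f coords_open(1) q])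
    (simp add: coords_point(3))

lemma coords_tangent_eq:
  assumes v: "v \<in> tangent_space M q" and w: "w \<in> tangent_space M q" and q: "q \<in> W" and eq: "cvec u v = cvec u w"
  shows "v = w"
proof
  fix f show "v f = w f"
    using coords_chain[OF v q, of f] coords_chain[OF w q, of f] tangent_nonsmooth[OF v, of f] tangent_nonsmooth[OF w, of f] eq
    by metis
qed

text \<open>On \<open>W\<close> the map u equals Pr o u, so the chain rule for the linear map Pr
  shows that Pr fixes the coordinate vector.\<close>

lemma coords_cvec_model:
  assumes v: "v \<in> tangent_space M q" and q: "q \<in> W"
  shows "cvec u v \<in> model M"
proof -
  have "cvec u v = Pr (cvec u v)"
  proof (rule euclidean_eqI)
    fix b :: 'e assume b: "b \<in> Basis"
    have bl: "bounded_linear (\<lambda>x. Pr x \<bullet> b)"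
      by (intro bounded_linear_inner_left_comp) (use Pr(1) linear_conv_bounded_linear in blast)
    have "v (\<lambda>q. u q \<bullet> b) = Dv (\<lambda>x. Pr x \<bullet> b) (u q) (cvec u v)"
      by (rule tangent_chain[OF v coords_smooth open_UNIV _ smooth_linear[OF bl] coords_smooth coords_open(1) q])
        (auto simp: Pr(3) coords_point)
    then show "cvec u v \<bullet> b = Pr (cvec u v) \<bullet> b"
      using b Dv_eq[OF bounded_linear_imp_has_derivative[OF bl]] by (simp add: cvec_inner)
  qed
  then show ?thesis using Pr(2) by metis
qed

lemma coords_frame:
  obtains Z where "\<And>a. Z a \<in> vector_fields M" "\<And>a q. q \<in> W \<Longrightarrow> cvec u (Z a q) = Pr a"
proof -
  obtain Z where Z: "\<And>a. Z a \<in> vector_fields M \<and> (\<forall>q\<in>W. \<forall>b. Z a q (\<lambda>q. u q \<bullet> b) = Pr a \<bullet> b)"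
    using coords_field[OF Pr(2)] by metis
  show ?thesis
  proof (rule that[of Z])
    show "Z a \<in> vector_fields M" for a using Z by blast
    show "cvec u (Z a q) = Pr a" if "q \<in> W" for a q
      using Z[of a] that by (simp add: cvec_def euclidean_representation)
  qed
qed

end

lemma tangent_cvec_exists:
  assumes C: "coords u W \<sigma> G" and q: "q \<in> W" and a: "a \<in> model M"
  obtains v where "v \<in> tangent_space M q" "cvec u v = a"
proof -
  obtain Z where Z: "\<And>a. Z a \<in> vector_fields M" "\<And>a q. q \<in> W \<Longrightarrow> cvec u (Z a q) = Pr a"
    using coords_frame[OF C] by blast
  show ?thesis
    by (rule that[of "Z a q"]) (use Z q a vector_fieldD(1) coords_sub[OF C q] Pr(3) in auto)
qed

text \<open>The sum runs over a basis of the ambient Euclidean space, not of the model space, so the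
  fields \<open>Z b\<close> may be linearly dependent. The coefficients v(u_b) are still correct
  because Pr fixes the coordinate vector of v.\<close>

lemma vector_expand:
  assumes C: "coords u W \<sigma> G" and Z: "\<And>a. Z a \<in> vector_fields M" "\<And>a q. q \<in> W \<Longrightarrow> cvec u (Z a q) = Pr a"
    and q: "q \<in> W" and v: "v \<in> tangent_space M q"
  shows "v = (\<Sum>b\<in>Basis. v (\<lambda>q. u q \<bullet> b) *\<^sub>R Z b q)"
proof (rule coords_tangent_eq[OF C v _ q])
  have qM: "q \<in> points M" using coords_sub[OF C q] .
  show "(\<Sum>b\<in>Basis. v (\<lambda>q. u q \<bullet> b) *\<^sub>R Z b q) \<in> tangent_space M q"
    by (intro tangent_sum_mem tangent_scaleR vector_fieldD Z qM)
  have "cvec u (\<Sum>b\<in>Basis. v (\<lambda>q. u q \<bullet> b) *\<^sub>R Z b q) = (\<Sum>b\<in>Basis. (cvec u v \<bullet> b) *\<^sub>R Pr b)"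
    by (simp only: cvec_sum cvec_scaleR Z(2)[OF q]) (simp add: cvec_inner)
  also have "\<dots> = Pr (cvec u v)" by (rule linear_expand[OF Pr(1), symmetric])
  also have "\<dots> = cvec u v" by (rule Pr(3)[OF coords_cvec_model[OF C v q]])
  finally show "cvec u v = cvec u (\<Sum>b\<in>Basis. v (\<lambda>q. u q \<bullet> b) *\<^sub>R Z b q)" by simp
qed

lemma vector_field_through:
  assumes p: "p \<in> points M" and v: "v \<in> tangent_space M p"
  obtains X where "X \<in> vector_fields M" "X p = v"
proof -
  obtain u W \<sigma> G where C: "coords u W \<sigma> G" and pW: "p \<in> W" using coords_exist[OF p] by blast
  obtain Z where Z: "\<And>a. Z a \<in> vector_fields M" "\<And>a q. q \<in> W \<Longrightarrow> cvec u (Z a q) = Pr a"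
    using coords_frame[OF C] by blast
  show ?thesis
    by (rule that[of "\<lambda>q. \<Sum>b\<in>Basis. v (\<lambda>q. u q \<bullet> b) *\<^sub>R Z b q"])
      (use vector_expand[OF C Z pW v] Z in \<open>auto intro!: vector_field_sum vector_field_cscale\<close>)
qed

text \<open>Realises a smooth family of coordinate vectors by a global vector field. The components
  of h(u q) agree near p with global smooth functions, and these serve as coefficients of the
  coordinate frame.\<close>

lemma field_with_cvec:
  assumes C: "coords u W \<sigma> G" and p: "p \<in> W" and H: "open H" "u p \<in> H" "smooth H h"
    and hE: "\<And>x. x \<in> H \<Longrightarrow> h x \<in> model M"
  obtains X V where "X \<in> vector_fields M" "openin (top_of M) V" "p \<in> V" "V \<subseteq> W"
    "\<And>q. q \<in> V \<Longrightarrow> u q \<in> H \<and> cvec u (X q) = h (u q)"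
proof -
  have pM: "p \<in> points M" by (rule coords_sub[OF C p])
  obtain Z where Z: "\<And>a. Z a \<in> vector_fields M" "\<And>a q. q \<in> W \<Longrightarrow> cvec u (Z a q) = Pr a"
    using coords_frame[OF C] by blast
  have "smooth_near M p (\<lambda>q. h (u q) \<bullet> b)" for b
    by (rule smooth_near_compose[OF smooth_near_smooth[OF coords_smooth[OF C] pM] H(1,2) smooth_inner[OF H(3,1)] pM])
  then have "\<exists>k V. k \<in> smooth_functions M \<and> openin (top_of M) V \<and> p \<in> V \<and> (\<forall>q\<in>V. h (u q) \<bullet> b = k q)" for b
    unfolding smooth_near_def by blast
  then obtain k V where k: "\<And>b. k b \<in> smooth_functions M" "\<And>b. openin (top_of M) (V b)" "\<And>b. p \<in> V b"
    "\<And>b q. q \<in> V b \<Longrightarrow> h (u q) \<bullet> b = k b q" by metis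
  obtain W2 where W2: "openin (top_of M) W2" "p \<in> W2" "\<And>q. q \<in> W2 \<Longrightarrow> u q \<in> H"
    using smooth_vimage_open[OF coords_smooth[OF C] H(1,2) pM] by blast
  show ?thesis
  proof (rule that[of "\<lambda>q. \<Sum>b\<in>Basis. k b q *\<^sub>R Z b q" "W \<inter> (W2 \<inter> (\<Inter>b\<in>Basis. V b))"])
    show "(\<lambda>q. \<Sum>b\<in>Basis. k b q *\<^sub>R Z b q) \<in> vector_fields M" by (intro vector_field_sum vector_field_scale k Z)
    show "openin (top_of M) (W \<inter> (W2 \<inter> (\<Inter>b\<in>Basis. V b)))"
      using W2 k by (intro openin_Int coords_open(1)[OF C] openin_INT2) auto
    show "p \<in> W \<inter> (W2 \<inter> (\<Inter>b\<in>Basis. V b))" using p W2 k by auto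
    fix q assume q: "q \<in> W \<inter> (W2 \<inter> (\<Inter>b\<in>Basis. V b))"
    have "cvec u (\<Sum>b\<in>Basis. k b q *\<^sub>R Z b q) = (\<Sum>b\<in>Basis. k b q *\<^sub>R Pr b)"
      using q by (simp only: cvec_sum cvec_scaleR) (simp add: Z(2))
    also have "\<dots> = (\<Sum>b\<in>Basis. (h (u q) \<bullet> b) *\<^sub>R Pr b)"
      using q by (intro sum.cong refl) (simp add: k(4))
    also have "\<dots> = Pr (h (u q))" by (rule linear_expand[OF Pr(1), symmetric])
    also have "\<dots> = h (u q)" using q W2(3) hE Pr(3) by auto
    finally show "u q \<in> H \<and> cvec u (\<Sum>b\<in>Basis. k b q *\<^sub>R Z b q) = h (u q)" using q W2(3) by auto
  qed auto
qed

end

subsection \<open>Lie brackets and the Nijenhuis tensor\<close>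

context mfd
begin

lemma lie_bracket_apply:
  "f \<in> smooth_functions M \<Longrightarrow> lie_bracket M X Y p f = X p (\<lambda>q. Y q f) - Y p (\<lambda>q. X q f)"
  by (simp add: lie_bracket_def)

lemma tangent_eqI:
  assumes "v \<in> tangent_space M p" "w \<in> tangent_space M p" "\<And>f. f \<in> smooth_functions M \<Longrightarrow> v f = w f"
  shows "v = w"
proof
  fix f show "v f = w f"
    using assms(3) tangent_nonsmooth[OF assms(1)] tangent_nonsmooth[OF assms(2)] by (cases "f \<in> smooth_functions M") auto
qed

text \<open>A vector field is constrained only on \<open>points M\<close>, so identities such as U(f
  + g) = U f + U g hold only there as functions of the point; \<open>tangent_local\<close> on the
  whole carrier makes them usable under a second derivation. In the Leibniz rule the products V f *
  U g + U f * V g are symmetric in U and V and cancel in the commutator.\<close>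

lemma lie_bracket_tangent:
  assumes X: "X \<in> vector_fields M" and Y: "Y \<in> vector_fields M" and p: "p \<in> points M"
  shows "lie_bracket M X Y p \<in> tangent_space M p"
  unfolding tangent_space_def
proof (intro CollectI conjI ballI allI impI)
  fix f g assume f: "f \<in> smooth_functions M" and g: "g \<in> smooth_functions M"
  note vX = vector_fieldD(1)[OF X] and vY = vector_fieldD(1)[OF Y]
  note sX = vector_fieldD(2)[OF X] and sY = vector_fieldD(2)[OF Y]
  note loc = tangent_local[OF _ _ _ openin_topspace p]
  have A: "V p (\<lambda>q. U q (\<lambda>x. f x + g x)) = V p (\<lambda>q. U q f) + V p (\<lambda>q. U q g)"
    if U: "U \<in> vector_fields M" and V: "V \<in> vector_fields M" for U V
  proof -
    have "V p (\<lambda>q. U q (\<lambda>x. f x + g x)) = V p (\<lambda>q. U q f + U q g)"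
      by (rule loc[OF vector_fieldD(1)[OF V p] vector_fieldD(2)[OF U smooth_functions_add[OF f g]]
        smooth_functions_add[OF vector_fieldD(2)[OF U f] vector_fieldD(2)[OF U g]]])
        (rule tangent_add[OF vector_fieldD(1)[OF U] f g])
    then show ?thesis
      using tangent_add[OF vector_fieldD(1)[OF V p] vector_fieldD(2)[OF U f] vector_fieldD(2)[OF U g]] by simp
  qed
  show "lie_bracket M X Y p (\<lambda>x. f x + g x) = lie_bracket M X Y p f + lie_bracket M X Y p g"
    using A[OF X Y] A[OF Y X] by (simp add: lie_bracket_apply f g smooth_functions_add)
  have B: "V p (\<lambda>q. U q (\<lambda>x. f x * g x)) =
      f p * V p (\<lambda>q. U q g) + V p f * U p g + (U p f * V p g + V p (\<lambda>q. U q f) * g p)"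
    if U: "U \<in> vector_fields M" and V: "V \<in> vector_fields M" for U V
  proof -
    note Uf = vector_fieldD(2)[OF U f] and Ug = vector_fieldD(2)[OF U g]
    have "V p (\<lambda>q. U q (\<lambda>x. f x * g x)) = V p (\<lambda>q. f q * U q g + U q f * g q)"
      by (rule loc[OF vector_fieldD(1)[OF V p] vector_fieldD(2)[OF U smooth_functions_mult[OF f g]]
        smooth_functions_add[OF smooth_functions_mult[OF f Ug] smooth_functions_mult[OF Uf g]]])
        (rule tangent_mult[OF vector_fieldD(1)[OF U] f g])
    also have "\<dots> = V p (\<lambda>q. f q * U q g) + V p (\<lambda>q. U q f * g q)"
      by (rule tangent_add[OF vector_fieldD(1)[OF V p] smooth_functions_mult[OF f Ug] smooth_functions_mult[OF Uf g]])
    finally show ?thesis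
      using tangent_mult[OF vector_fieldD(1)[OF V p] f Ug] tangent_mult[OF vector_fieldD(1)[OF V p] Uf g] by simp
  qed
  show "lie_bracket M X Y p (\<lambda>x. f x * g x) = f p * lie_bracket M X Y p g + lie_bracket M X Y p f * g p"
    using B[OF X Y] B[OF Y X] by (simp add: lie_bracket_apply f g smooth_functions_mult algebra_simps)
next
  fix f c assume f: "f \<in> smooth_functions M"
  have A: "V p (\<lambda>q. U q (\<lambda>x. c * f x)) = c * V p (\<lambda>q. U q f)"
    if U: "U \<in> vector_fields M" and V: "V \<in> vector_fields M" for U V
  proof -
    have "V p (\<lambda>q. U q (\<lambda>x. c * f x)) = V p (\<lambda>q. c * U q f)"
      by (rule tangent_local[OF vector_fieldD(1)[OF V p] vector_fieldD(2)[OF U smooth_functions_mult[OF smooth_functions_const f]]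
        smooth_functions_mult[OF smooth_functions_const vector_fieldD(2)[OF U f]] openin_topspace p])
        (rule tangent_cmul[OF vector_fieldD(1)[OF U] f])
    then show ?thesis using tangent_cmul[OF vector_fieldD(1)[OF V p] vector_fieldD(2)[OF U f]] by simp
  qed
  show "lie_bracket M X Y p (\<lambda>x. c * f x) = c * lie_bracket M X Y p f"
    using A[OF X Y] A[OF Y X] by (simp add: lie_bracket_apply f smooth_functions_mult smooth_functions_const right_diff_distrib)
qed (simp add: lie_bracket_def)

lemma lie_bracket_antisym: "lie_bracket M X Y p = - lie_bracket M Y X p"
  by (auto simp: lie_bracket_def)

lemma lie_bracket_local_left:
  assumes X: "X \<in> vector_fields M" "X' \<in> vector_fields M" and Y: "Y \<in> vector_fields M"
    and W: "openin (top_of M) W" "p \<in> W" "\<And>q. q \<in> W \<Longrightarrow> X q = X' q"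
  shows "lie_bracket M X Y p = lie_bracket M X' Y p"
proof -
  have p: "p \<in> points M" using W openin_subset by blast
  show ?thesis
  proof (rule tangent_eqI[OF lie_bracket_tangent[OF X(1) Y p] lie_bracket_tangent[OF X(2) Y p]])
    fix f assume f: "f \<in> smooth_functions M"
    have "Y p (\<lambda>q. X q f) = Y p (\<lambda>q. X' q f)"
      by (rule tangent_local[OF vector_fieldD(1)[OF Y p] vector_fieldD(2)[OF X(1) f] vector_fieldD(2)[OF X(2) f] W(1,2)])
        (simp add: W(3))
    then show "lie_bracket M X Y p f = lie_bracket M X' Y p f"
      using W by (simp add: lie_bracket_apply f)
  qed
qed

lemma lie_bracket_local:
  assumes "X \<in> vector_fields M" "X' \<in> vector_fields M" "Y \<in> vector_fields M" "Y' \<in> vector_fields M"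
    and "openin (top_of M) W" "p \<in> W" "\<And>q. q \<in> W \<Longrightarrow> X q = X' q" "\<And>q. q \<in> W \<Longrightarrow> Y q = Y' q"
  shows "lie_bracket M X Y p = lie_bracket M X' Y' p"
  using lie_bracket_local_left[OF assms(1,2,3,5-7)] lie_bracket_local_left[OF assms(3,4,2,5,6,8)]
  by (metis lie_bracket_antisym)

lemma lie_bracket_add_left:
  assumes X: "X \<in> vector_fields M" "X' \<in> vector_fields M" and Y: "Y \<in> vector_fields M" and p: "p \<in> points M"
  shows "lie_bracket M (\<lambda>q. X q + X' q) Y p = lie_bracket M X Y p + lie_bracket M X' Y p"
proof (rule tangent_eqI[OF lie_bracket_tangent[OF vector_field_plus[OF X] Y p]
    tangent_plus[OF lie_bracket_tangent[OF X(1) Y p] lie_bracket_tangent[OF X(2) Y p]]])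
  fix f assume f: "f \<in> smooth_functions M"
  show "lie_bracket M (\<lambda>q. X q + X' q) Y p f = (lie_bracket M X Y p + lie_bracket M X' Y p) f"
    using tangent_add[OF vector_fieldD(1)[OF Y p] vector_fieldD(2)[OF X(1) f] vector_fieldD(2)[OF X(2) f]]
    by (simp add: lie_bracket_apply f)
qed

lemma lie_bracket_scale_left:
  assumes g: "g \<in> smooth_functions M" and X: "X \<in> vector_fields M" and Y: "Y \<in> vector_fields M" and p: "p \<in> points M"
  shows "lie_bracket M (\<lambda>q. g q *\<^sub>R X q) Y p = g p *\<^sub>R lie_bracket M X Y p - Y p g *\<^sub>R X p"
proof (rule tangent_eqI[OF lie_bracket_tangent[OF vector_field_scale[OF g X] Y p]
    tangent_minus[OF tangent_scaleR[OF lie_bracket_tangent[OF X Y p]] tangent_scaleR[OF vector_fieldD(1)[OF X p]]]])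
  fix f assume f: "f \<in> smooth_functions M"
  have "Y p (\<lambda>q. (g q *\<^sub>R X q) f) = g p * Y p (\<lambda>q. X q f) + Y p g * X p f"
    using tangent_mult[OF vector_fieldD(1)[OF Y p] g vector_fieldD(2)[OF X f]] by (simp add: scaleR_fun_def)
  then show "lie_bracket M (\<lambda>q. g q *\<^sub>R X q) Y p f = (g p *\<^sub>R lie_bracket M X Y p - Y p g *\<^sub>R X p) f"
    by (simp add: lie_bracket_apply f) (simp add: lie_bracket_apply f scaleR_fun_def algebra_simps)
qed

section \<open>The Nijenhuis tensor is a tensor\<close>

context
  fixes T assumes T: "tensor_field11 M T"
begin

lemma tensor_mem: "p \<in> points M \<Longrightarrow> v \<in> tangent_space M p \<Longrightarrow> T p v \<in> tangent_space M p"
  and tensor_add: "p \<in> points M \<Longrightarrow> v \<in> tangent_space M p \<Longrightarrow> w \<in> tangent_space M p \<Longrightarrow> T p (v + w) = T p v + T p w"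
  and tensor_scaleR: "p \<in> points M \<Longrightarrow> v \<in> tangent_space M p \<Longrightarrow> T p (c *\<^sub>R v) = c *\<^sub>R T p v"
  and tensor_field: "X \<in> vector_fields M \<Longrightarrow> (\<lambda>p. T p (X p)) \<in> vector_fields M"
  using T by (simp_all add: tensor_field11_def)

lemma tensor_zero: "p \<in> points M \<Longrightarrow> T p 0 = 0"
  using tensor_scaleR[of p 0 0] tangent_zero by simp

lemma tensor_uminus: "p \<in> points M \<Longrightarrow> v \<in> tangent_space M p \<Longrightarrow> T p (- v) = - T p v"
  using tensor_scaleR[of p v "-1"] by simp

lemma tensor_diff: "p \<in> points M \<Longrightarrow> v \<in> tangent_space M p \<Longrightarrow> w \<in> tangent_space M p \<Longrightarrow> T p (v - w) = T p v - T p w"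
  using tensor_add[of p v "- w"] tensor_uminus[of p w] tangent_uminus[of w p] by simp

lemma tensor_sum:
  "p \<in> points M \<Longrightarrow> (\<And>i. i \<in> I \<Longrightarrow> v i \<in> tangent_space M p) \<Longrightarrow> T p (\<Sum>i\<in>I. v i) = (\<Sum>i\<in>I. T p (v i))"
proof (induction I rule: infinite_finite_induct)
  case (insert i I)
  have "T p (v i + (\<Sum>i\<in>I. v i)) = T p (v i) + T p (\<Sum>i\<in>I. v i)"
    using insert.prems by (intro tensor_add tangent_sum_mem) auto
  moreover have "T p (\<Sum>i\<in>I. v i) = (\<Sum>i\<in>I. T p (v i))" using insert.IH insert.prems by blast
  ultimately show ?case by (simp only: sum.insert[OF insert.hyps])
qed (simp_all only: sum.infinite sum.empty tensor_zero not_False_eq_True)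

abbreviation Nij where "Nij \<equiv> nijenhuis (lie_bracket M) T"

lemma nijenhuis_tangent:
  assumes X: "X \<in> vector_fields M" and Y: "Y \<in> vector_fields M" and p: "p \<in> points M"
  shows "Nij X Y p \<in> tangent_space M p"
  unfolding nijenhuis_def
  by (intro tangent_plus tangent_minus tensor_mem lie_bracket_tangent tensor_field X Y p)

lemma nijenhuis_antisym:
  assumes X: "X \<in> vector_fields M" and Y: "Y \<in> vector_fields M" and p: "p \<in> points M"
  shows "Nij X Y p = - Nij Y X p"
proof -
  note m = lie_bracket_tangent[OF _ _ p] and f = tensor_field
  have 1: "lie_bracket M (\<lambda>q. T q (X q)) (\<lambda>q. T q (Y q)) p = - lie_bracket M (\<lambda>q. T q (Y q)) (\<lambda>q. T q (X q)) p"
    by (rule lie_bracket_antisym)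
  have 2: "T p (lie_bracket M (\<lambda>q. T q (X q)) Y p) = - T p (lie_bracket M Y (\<lambda>q. T q (X q)) p)"
    by (subst lie_bracket_antisym) (rule tensor_uminus[OF p m[OF Y f[OF X]]])
  have 3: "T p (lie_bracket M X (\<lambda>q. T q (Y q)) p) = - T p (lie_bracket M (\<lambda>q. T q (Y q)) X p)"
    by (subst lie_bracket_antisym) (rule tensor_uminus[OF p m[OF f[OF Y] X]])
  have 4: "T p (T p (lie_bracket M X Y p)) = - T p (T p (lie_bracket M Y X p))"
    by (subst lie_bracket_antisym) (simp only: tensor_uminus[OF p m[OF Y X]] tensor_uminus[OF p tensor_mem[OF p m[OF Y X]]])
  show ?thesis unfolding nijenhuis_def 1 2 3 4 by (simp only: minus_add_distrib minus_diff_eq) (simp add: algebra_simps)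
qed

lemma nijenhuis_local_left:
  assumes X: "X \<in> vector_fields M" "X' \<in> vector_fields M" and Y: "Y \<in> vector_fields M"
    and W: "openin (top_of M) W" "p \<in> W" "\<And>q. q \<in> W \<Longrightarrow> X q = X' q"
  shows "Nij X Y p = Nij X' Y p"
proof -
  have "lie_bracket M (\<lambda>q. T q (X q)) V p = lie_bracket M (\<lambda>q. T q (X' q)) V p" if "V \<in> vector_fields M" for V
    by (rule lie_bracket_local_left[OF tensor_field[OF X(1)] tensor_field[OF X(2)] that W(1,2)]) (simp add: W(3))
  moreover have "lie_bracket M X V p = lie_bracket M X' V p" if "V \<in> vector_fields M" for V
    by (rule lie_bracket_local_left[OF X that W])
  ultimately show ?thesis unfolding nijenhuis_def using Y tensor_field[OF Y] by simp
qed

lemma nijenhuis_add_left: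
  assumes X: "X \<in> vector_fields M" "X' \<in> vector_fields M" and Y: "Y \<in> vector_fields M" and p: "p \<in> points M"
  shows "Nij (\<lambda>q. X q + X' q) Y p = Nij X Y p + Nij X' Y p"
proof -
  note f = tensor_field and m = lie_bracket_tangent[OF _ _ p]
  have 1: "lie_bracket M (\<lambda>q. T q (X q + X' q)) V p = lie_bracket M (\<lambda>q. T q (X q)) V p + lie_bracket M (\<lambda>q. T q (X' q)) V p"
    if V: "V \<in> vector_fields M" for V
  proof -
    have "lie_bracket M (\<lambda>q. T q (X q + X' q)) V p = lie_bracket M (\<lambda>q. T q (X q) + T q (X' q)) V p"
      by (rule lie_bracket_local_left[OF f[OF vector_field_plus[OF X]] vector_field_plus[OF f[OF X(1)] f[OF X(2)]] V openin_topspace p])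
        (rule tensor_add[OF _ vector_fieldD(1)[OF X(1)] vector_fieldD(1)[OF X(2)]])
    then show ?thesis using lie_bracket_add_left[OF f[OF X(1)] f[OF X(2)] V p] by simp
  qed
  note 2 = lie_bracket_add_left[OF X _ p]
  have 3: "T p (v + w) = T p v + T p w" if "v \<in> tangent_space M p" "w \<in> tangent_space M p" for v w
    by (rule tensor_add[OF p that])
  show ?thesis
    unfolding nijenhuis_def 1[OF Y] 1[OF f[OF Y]] 2[OF Y] 2[OF f[OF Y]]
      3[OF m[OF f[OF X(1)] Y] m[OF f[OF X(2)] Y]] 3[OF m[OF X(1) f[OF Y]] m[OF X(2) f[OF Y]]]
      3[OF m[OF X(1) Y] m[OF X(2) Y]] 3[OF tensor_mem[OF p m[OF X(1) Y]] tensor_mem[OF p m[OF X(2) Y]]]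
    by (simp only: algebra_simps)
qed

text \<open>The four brackets contribute the derivative terms -(TY g) TX, (Y g) T^2 X, (TY g) TX and
  -(Y g) T^2 X, which cancel in pairs.\<close>

lemma nijenhuis_scale_left:
  assumes g: "g \<in> smooth_functions M" and X: "X \<in> vector_fields M" and Y: "Y \<in> vector_fields M" and p: "p \<in> points M"
  shows "Nij (\<lambda>q. g q *\<^sub>R X q) Y p = g p *\<^sub>R Nij X Y p"
proof -
  note f = tensor_field and m = lie_bracket_tangent[OF _ _ p] and s = lie_bracket_scale_left[OF g _ _ p]
  have 1: "lie_bracket M (\<lambda>q. T q (g q *\<^sub>R X q)) V p = g p *\<^sub>R lie_bracket M (\<lambda>q. T q (X q)) V p - V p g *\<^sub>R T p (X p)"
    if V: "V \<in> vector_fields M" for V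
  proof -
    have "lie_bracket M (\<lambda>q. T q (g q *\<^sub>R X q)) V p = lie_bracket M (\<lambda>q. g q *\<^sub>R T q (X q)) V p"
      by (rule lie_bracket_local_left[OF f[OF vector_field_scale[OF g X]] vector_field_scale[OF g f[OF X]] V openin_topspace p])
        (rule tensor_scaleR[OF _ vector_fieldD(1)[OF X]])
    then show ?thesis using s[OF f[OF X] V] by simp
  qed
  have lin: "T p (a *\<^sub>R v - b *\<^sub>R w) = a *\<^sub>R T p v - b *\<^sub>R T p w" if "v \<in> tangent_space M p" "w \<in> tangent_space M p" for a b v w
    using tensor_diff[OF p tangent_scaleR[OF that(1), of a] tangent_scaleR[OF that(2), of b]]
      tensor_scaleR[OF p that(1)] tensor_scaleR[OF p that(2)] by simp
  note Xp = vector_fieldD(1)[OF X p]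
  note TXp = tensor_mem[OF p Xp]
  show ?thesis
    unfolding nijenhuis_def 1[OF Y] 1[OF f[OF Y]] s[OF X Y] s[OF X f[OF Y]]
      lin[OF m[OF f[OF X] Y] TXp] lin[OF m[OF X f[OF Y]] Xp] lin[OF m[OF X Y] Xp]
      lin[OF tensor_mem[OF p m[OF X Y]] TXp]
    by (simp only: algebra_simps)
qed

lemma nijenhuis_sum_left:
  assumes "\<And>i. i \<in> I \<Longrightarrow> X i \<in> vector_fields M" and Y: "Y \<in> vector_fields M" and p: "p \<in> points M"
  shows "Nij (\<lambda>q. \<Sum>i\<in>I. X i q) Y p = (\<Sum>i\<in>I. Nij (X i) Y p)"
  using assms(1)
proof (induction I rule: infinite_finite_induct)
  case (insert i I)
  have "Nij (\<lambda>q. X i q + (\<Sum>i\<in>I. X i q)) Y p = Nij (X i) Y p + Nij (\<lambda>q. \<Sum>i\<in>I. X i q) Y p"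
    using insert.prems by (intro nijenhuis_add_left vector_field_sum Y p) auto
  moreover have "Nij (\<lambda>q. \<Sum>i\<in>I. X i q) Y p = (\<Sum>i\<in>I. Nij (X i) Y p)" using insert.IH insert.prems by blast
  ultimately show ?case by (simp only: sum.insert[OF insert.hyps])
next
  have z: "Nij (\<lambda>q. 0) Y p = 0"
    using nijenhuis_scale_left[OF smooth_functions_const[of 0] vector_field_zero Y p] by simp
  { case (infinite A) then show ?case using z by (simp only: sum.infinite not_False_eq_True) }
  { case empty show ?case using z by (simp only: sum.empty) }
qed

text \<open>Near p a field is a combination of the frame fields with smooth coefficients V(u_b).
  Linearity over functions moves these out of the tensor, and only their values at p remain.\<close>

lemma nijenhuis_pointwise_left:
  assumes X: "X \<in> vector_fields M" "X' \<in> vector_fields M" and Y: "Y \<in> vector_fields M"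
    and p: "p \<in> points M" and eq: "X p = X' p"
  shows "Nij X Y p = Nij X' Y p"
proof -
  obtain u W \<sigma> G where C: "coords u W \<sigma> G" and pW: "p \<in> W" using coords_exist[OF p] by blast
  obtain Z where Z: "\<And>a. Z a \<in> vector_fields M" "\<And>a q. q \<in> W \<Longrightarrow> cvec u (Z a q) = Pr a"
    using coords_frame[OF C] by blast
  have "Nij V Y p = (\<Sum>b\<in>Basis. V p (\<lambda>q. u q \<bullet> b) *\<^sub>R Nij (Z b) Y p)" if V: "V \<in> vector_fields M" for V
  proof -
    have s: "(\<lambda>q. V q (\<lambda>q. u q \<bullet> b)) \<in> smooth_functions M" for b
      by (rule vector_fieldD(2)[OF V coords_smooth[OF C]])
    note sZ = vector_field_scale[OF s Z(1)]
    have "Nij V Y p = Nij (\<lambda>q. \<Sum>b\<in>Basis. V q (\<lambda>q. u q \<bullet> b) *\<^sub>R Z b q) Y p"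
      by (rule nijenhuis_local_left[OF V vector_field_sum[OF sZ] Y coords_open(1)[OF C] pW])
        (rule vector_expand[OF C Z _ vector_fieldD(1)[OF V coords_sub[OF C]]])
    also have "\<dots> = (\<Sum>b\<in>Basis. Nij (\<lambda>q. V q (\<lambda>q. u q \<bullet> b) *\<^sub>R Z b q) Y p)"
      by (rule nijenhuis_sum_left[OF sZ Y p])
    also have "\<dots> = (\<Sum>b\<in>Basis. V p (\<lambda>q. u q \<bullet> b) *\<^sub>R Nij (Z b) Y p)"
      by (intro sum.cong refl nijenhuis_scale_left s Z Y p)
    finally show ?thesis .
  qed
  then show ?thesis using X eq by simp
qed

lemma nijenhuis_pointwise:
  assumes X: "X \<in> vector_fields M" "X' \<in> vector_fields M" and Y: "Y \<in> vector_fields M" "Y' \<in> vector_fields M"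
    and p: "p \<in> points M" and eq: "X p = X' p" "Y p = Y' p"
  shows "Nij X Y p = Nij X' Y' p"
proof -
  have "Nij X Y p = Nij X' Y p" by (rule nijenhuis_pointwise_left[OF X Y(1) p eq(1)])
  also have "\<dots> = - Nij Y X' p" by (rule nijenhuis_antisym[OF X(2) Y(1) p])
  also have "\<dots> = - Nij Y' X' p" using nijenhuis_pointwise_left[OF Y X(2) p eq(2)] by simp
  also have "\<dots> = Nij X' Y' p" using nijenhuis_antisym[OF X(2) Y(2) p] by simp
  finally show ?thesis .
qed

end

end

section \<open>Immersed submanifolds\<close>

lemma sum_apply_fun: "(\<Sum>i\<in>I. w i) f = (\<Sum>i\<in>I. w i f)"
  for w :: "'i \<Rightarrow> 'f \<Rightarrow> 'c::real_vector"
  by (induction I rule: infinite_finite_induct) simp_all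

lemma scaleR_apply_fun: "(c *\<^sub>R w) f = c *\<^sub>R w f"
  by (simp add: scaleR_fun_def)

lemma lie_bracket_nonsmooth: "f \<notin> smooth_functions M \<Longrightarrow> lie_bracket M X Y p f = 0"
  by (simp add: lie_bracket_def)

locale submap = M: mfd M n + N: mfd N d
  for M N :: "('m, 'e::euclidean_space) manifold" and n d :: nat +
  assumes points_sub: "points N \<subseteq> points M" and smooth_id: "smooth_map N M id"
begin

abbreviation push where "push \<equiv> push_forward M id"

lemma openin_restrict: "openin (top_of M) W \<Longrightarrow> openin (top_of N) {q \<in> points N. q \<in> W}"
  using smooth_id openin_continuous_map_preimage[of "top_of N" "top_of M" id W] by (simp add: smooth_map_def)

lemma smooth_restrict:
  assumes f: "f \<in> smooth_functions M"
  shows "f \<in> smooth_functions N"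
  unfolding N.smooth_functions_iff
proof clarify
  fix V \<psi> assume d: "(V, \<psi>) \<in> charts N"
  show "smooth (N.dom V \<psi>) (\<lambda>x. f (N.par V \<psi> x))"
  proof (rule smooth_local[OF _ N.open_dom[OF d]])
    fix x assume x: "x \<in> N.dom V \<psi>"
    have q: "N.par V \<psi> x \<in> V" by (rule N.par_in[OF x])
    then have "N.par V \<psi> x \<in> points M" using N.chart_sub[OF d] points_sub by blast
    then obtain U \<phi> where c: "(U, \<phi>) \<in> charts M" and qU: "N.par V \<psi> x \<in> U" using M.chart_cover by blast
    define U' where "U' = {q \<in> points N. q \<in> U}"
    have U': "openin (top_of N) U'" unfolding U'_def by (rule openin_restrict[OF M.chart_open[OF c]])
    have VU: "V \<inter> id -` U = V \<inter> U'" using N.chart_sub[OF d] by (auto simp: U'_def)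
    let ?T = "N.dom (V \<inter> U') \<psi>"
    have o: "open ?T" by (rule N.open_dom_sub[OF d U'])
    have "smooth_on (model N) (\<psi> ` (V \<inter> U')) (\<phi> \<circ> inv_into V \<psi>)"
      using smooth_id d c VU unfolding smooth_map_def by fastforce
    then have s: "smooth ?T (\<lambda>x. \<phi> (N.par V \<psi> x))"
      using N.smooth_on_chart_iff[OF d U'] by blast
    have TU: "N.par V \<psi> y \<in> U" if "y \<in> ?T" for y
      using that N.dom_sub_iff[OF d, of y U'] N.dom_mono by (auto simp: U'_def)
    have "smooth ?T (\<lambda>x. f (M.par U \<phi> (\<phi> (N.par V \<psi> x))))"
      by (rule smooth_compose[OF s M.smooth_functionsD[OF f c] o M.open_dom[OF c]])
        (use TU M.chart_dom[OF c] in auto)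
    then have "smooth ?T (\<lambda>x. f (N.par V \<psi> x))"
      by (rule smooth_cong[OF _ o]) (simp add: M.par_chart[OF c TU])
    moreover have "x \<in> ?T"
      using N.dom_sub_iff[OF d x] qU q N.chart_sub[OF d] by (auto simp: U'_def)
    ultimately show "\<exists>T. open T \<and> x \<in> T \<and> smooth T (\<lambda>x. f (N.par V \<psi> x))" using o by blast
  qed
qed

lemma push_apply: "f \<in> smooth_functions M \<Longrightarrow> push v f = v f"
  by (simp add: push_forward_def)

lemma push_nonsmooth: "f \<notin> smooth_functions M \<Longrightarrow> push v f = 0"
  by (simp add: push_forward_def)

lemma push_add: "push (v + w) = push v + push w"
  and push_diff: "push (v - w) = push v - push w"
  and push_scaleR: "push (c *\<^sub>R v) = c *\<^sub>R push v"
  and push_zero: "push 0 = 0"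
  by (auto simp: push_forward_def scaleR_fun_def fun_eq_iff)

lemma push_tangent:
  assumes v: "v \<in> tangent_space N q"
  shows "push v \<in> tangent_space M q"
  using N.tangent_add[OF v smooth_restrict smooth_restrict] N.tangent_mult[OF v smooth_restrict smooth_restrict]
    N.tangent_cmul[OF v smooth_restrict]
  by (auto simp: tangent_space_def push_apply push_nonsmooth M.smooth_functions_add M.smooth_functions_mult
      M.smooth_functions_mult[OF M.smooth_functions_const])

lemma cvec_push:
  assumes "M.coords y W \<tau> G"
  shows "cvec y (push v) = cvec y v"
  by (simp add: cvec_def push_apply[OF M.coords_smooth[OF assms]])

lemma cvec_chain:
  assumes C: "N.coords u W \<sigma> G" and D: "M.coords y W' \<tau> G'" and q: "q \<in> W" and v: "v \<in> tangent_space N q"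
  shows "smooth G (\<lambda>x. y (\<sigma> x))" "cvec y (push v) = Dv (\<lambda>x. y (\<sigma> x)) (u q) (cvec u v)"
proof -
  have yb: "(\<lambda>q. y q \<bullet> b) \<in> smooth_functions N" for b by (rule smooth_restrict[OF M.coords_smooth[OF D]])
  show s: "smooth G (\<lambda>x. y (\<sigma> x))"
    by (rule smooth_componentwise[OF N.coords_smooth_par[OF C yb] N.coords_open(2)[OF C]])
  have uq: "u q \<in> G" by (rule N.coords_point(2)[OF C q])
  have D1: "((\<lambda>x. y (\<sigma> x)) has_derivative Dv (\<lambda>x. y (\<sigma> x)) (u q)) (at (u q))"
    by (rule smooth_has_derivative[OF s N.coords_open(2)[OF C] uq])
  have "cvec y v = Dv (\<lambda>x. y (\<sigma> x)) (u q) (cvec u v)"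
  proof (rule euclidean_eqI)
    fix b :: 'e assume b: "b \<in> Basis"
    have "v (\<lambda>q. y q \<bullet> b) = Dv (\<lambda>x. y (\<sigma> x) \<bullet> b) (u q) (cvec u v)"
      by (rule N.coords_chain[OF C v q yb])
    also have "Dv (\<lambda>x. y (\<sigma> x) \<bullet> b) (u q) = (\<lambda>h. Dv (\<lambda>x. y (\<sigma> x)) (u q) h \<bullet> b)"
      by (rule Dv_eq) (rule has_derivative_inner_left[OF D1])
    finally show "cvec y v \<bullet> b = Dv (\<lambda>x. y (\<sigma> x)) (u q) (cvec u v) \<bullet> b" using b by (simp add: cvec_inner)
  qed
  then show "cvec y (push v) = Dv (\<lambda>x. y (\<sigma> x)) (u q) (cvec u v)" by (simp add: cvec_push[OF D])
qed

end

section \<open>Fields and tensors induced on an immersed submanifold\<close>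

locale immersion = submap M N n d
  for M N :: "('m, 'e::euclidean_space) manifold" and n d :: nat +
  assumes inj: "\<And>q. q \<in> points N \<Longrightarrow> inj_on push (tangent_space N q)"
begin

lemma push_eqD: "q \<in> points N \<Longrightarrow> v \<in> tangent_space N q \<Longrightarrow> w \<in> tangent_space N q \<Longrightarrow> push v = push w \<Longrightarrow> v = w"
  using inj by (meson inj_onD)

text \<open>
  Functions on \<open>N\<close> that do not extend to \<open>M\<close> are reached through a smooth left inverse of the
  differential of the immersion.
\<close>

lemma vector_fieldI:
  assumes ZT: "\<And>q. q \<in> points N \<Longrightarrow> Z q \<in> tangent_space N q"
    and Zf: "\<And>f. f \<in> smooth_functions M \<Longrightarrow> (\<lambda>q. Z q f) \<in> smooth_functions N"
  shows "Z \<in> vector_fields N"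
proof -
  have "(\<lambda>q. Z q g) \<in> smooth_functions N" if g: "g \<in> smooth_functions N" for g
  proof (rule N.smooth_functions_local)
    fix p assume p: "p \<in> points N"
    obtain u W \<sigma> G where C: "N.coords u W \<sigma> G" and pW: "p \<in> W" using N.coords_exist[OF p] by blast
    obtain y W' \<tau> G' where D: "M.coords y W' \<tau> G'" and pW': "p \<in> W'" using M.coords_exist p points_sub by blast
    define J where "J = (\<lambda>x. y (\<sigma> x))"
    have J: "smooth G J" unfolding J_def by (rule cvec_chain(1)[OF C D pW N.tangent_zero])
    have ch: "cvec y (push v) = Dv J (u q) (cvec u v)" if "q \<in> W" "v \<in> tangent_space N q" for q v
      unfolding J_def by (rule cvec_chain(2)[OF C D that])
    have oG: "open G" by (rule N.coords_open(2)[OF C])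
    have pG: "u p \<in> G" by (rule N.coords_point(2)[OF C pW])
    have lJ: "linear (Dv J x)" if "x \<in> G" for x by (rule smooth_linear_Dv[OF J oG that])
    have inj0: "a = 0" if a: "a \<in> model N" "Dv J (u p) a = 0" for a
    proof -
      obtain v where v: "v \<in> tangent_space N p" "cvec u v = a"
        using N.tangent_cvec_exists[OF C pW a(1)] by blast
      have "cvec y (push v) = cvec y 0" using ch[OF pW v(1)] v(2) a(2) by (simp add: cvec_zero)
      then have "push v = push 0"
        using M.coords_tangent_eq[OF D push_tangent[OF v(1)] M.tangent_zero pW'] by (simp add: push_zero)
      then have "v = 0" by (rule push_eqD[OF p v(1) N.tangent_zero])
      then show ?thesis using v(2) by (simp add: cvec_zero)
    qed
    have "inj_on (Dv J (u p)) (model N)"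
      unfolding linear_injective_on_subspace_0[OF lJ[OF pG] N.subspace_model] using inj0 by blast
    then obtain L where L: "linear L" "\<And>a. a \<in> model N \<Longrightarrow> L (Dv J (u p) a) = a"
      using linear_exists_left_inverse_on[OF lJ[OF pG] N.subspace_model] by blast
    have bL: "bounded_linear L" using L(1) linear_conv_bounded_linear by blast
    \<comment> \<open>L inverts the differential of the inclusion on the model space, at the point u
      p. \<open>A x\<close> agrees with L (Dv J x) on model vectors and is completed by the identity
      on the kernel of Pr. It becomes an endomorphism of the ambient space equal to the identity at
      u p, as \<open>smooth_inverse_family\<close> requires.\<close>
    define A where "A = (\<lambda>x a. L (Dv J x (N.Pr a)) + (a - N.Pr a))"
    have lA: "linear (A x)" if "x \<in> G" for x
      unfolding A_def
      by (intro linear_compose_add linear_compose_sub linear_ident N.Pr(1)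
          linear_compose[OF linear_compose[OF N.Pr(1) lJ[OF that]] L(1), unfolded o_def])
    have sA: "smooth G (\<lambda>x. A x a)" for a
      unfolding A_def by (intro smooth_add smooth_linear_compose[OF bL oG] smooth_Dv[OF J oG] smooth_const oG)
    have A0: "A (u p) a = a" for a unfolding A_def using L(2)[OF N.Pr(2)] by simp
    obtain H I where H: "open H" "H \<subseteq> G" "u p \<in> H" and lI: "\<And>x. x \<in> H \<Longrightarrow> linear (I x)"
      and IA: "\<And>x v. x \<in> H \<Longrightarrow> I x (A x v) = v" and sI: "\<And>v. smooth H (\<lambda>x. I x v)"
      using smooth_inverse_family[OF oG pG lA sA A0] by metis
    obtain V where V: "openin (top_of N) V" "p \<in> V" "\<And>q. q \<in> V \<Longrightarrow> u q \<in> H"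
      using N.smooth_vimage_open[OF N.coords_smooth[OF C] H(1,3) p] by blast
    define h where "h = (\<lambda>b x. Dv (\<lambda>x. g (\<sigma> x)) x (I x (L b)))"
    have sg: "smooth H (\<lambda>x. g (\<sigma> x))"
      by (rule smooth_subset[OF N.coords_smooth_par[OF C g] oG H(1,2)])
    have sh: "smooth H (h b)" for b unfolding h_def by (rule smooth_Dv_apply[OF sg sI H(1)])
    have "smooth_near N p (\<lambda>q. \<Sum>b\<in>Basis. Z q (\<lambda>q. y q \<bullet> b) * h b (u q))"
      by (intro N.smooth_near_sum[OF p] N.smooth_near_mult N.smooth_near_smooth[OF Zf[OF M.coords_smooth[OF D]] p]
          N.smooth_near_compose[OF N.smooth_near_smooth[OF N.coords_smooth[OF C] p] H(1,3) sh p])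
    then show "smooth_near N p (\<lambda>q. Z q g)"
    proof (rule N.smooth_near_cong[where W="V \<inter> W"])
      show "openin (top_of N) (V \<inter> W)" "p \<in> V \<inter> W" using V pW N.coords_open(1)[OF C] by auto
      fix q assume q: "q \<in> V \<inter> W"
      then have uH: "u q \<in> H" and qW: "q \<in> W" using V by auto
      have Zq: "Z q \<in> tangent_space N q" by (rule ZT[OF N.coords_sub[OF C qW]])
      define z where "z = cvec u (Z q)"
      \<comment> \<open>The coordinate vector z of Z is recovered through I and L from the numbers
        Z(y_b). These are smooth by hypothesis, since the y_b are functions on M.\<close>
      have "A (u q) z = L (cvec y (push (Z q)))"
        unfolding A_def z_def ch[OF qW Zq] by (simp add: N.Pr(3)[OF N.coords_cvec_model[OF C Zq qW]])
      then have "z = I (u q) (L (cvec y (push (Z q))))" using IA[OF uH, of z] by simp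
      also have "\<dots> = I (u q) (L (\<Sum>b\<in>Basis. Z q (\<lambda>q. y q \<bullet> b) *\<^sub>R b))"
        unfolding cvec_push[OF D] by (simp add: cvec_def)
      also have "\<dots> = (\<Sum>b\<in>Basis. Z q (\<lambda>q. y q \<bullet> b) *\<^sub>R I (u q) (L b))"
        using L(1) lI[OF uH] by (simp add: linear_sum linear_cmul)
      finally have z: "z = \<dots>" .
      have ld: "linear (Dv (\<lambda>x. g (\<sigma> x)) (u q))" by (rule smooth_linear_Dv[OF sg H(1) uH])
      have "Z q g = Dv (\<lambda>x. g (\<sigma> x)) (u q) z" unfolding z_def by (rule N.coords_chain[OF C Zq qW g])
      also have "\<dots> = (\<Sum>b\<in>Basis. Z q (\<lambda>q. y q \<bullet> b) * h b (u q))"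
        unfolding z h_def using ld by (simp add: linear_sum linear_cmul)
      finally show "(\<Sum>b\<in>Basis. Z q (\<lambda>q. y q \<bullet> b) * h b (u q)) = Z q g" by simp
    qed
  qed
  then show ?thesis using ZT by (simp add: vector_fields_def)
qed

definition restrict_field :: "('m \<Rightarrow> 'm tangent) \<Rightarrow> 'm \<Rightarrow> 'm tangent"
  where "restrict_field X q = inv_into (tangent_space N q) push (X q)"

lemma restrict_field:
  assumes X: "X \<in> vector_fields M" and XN: "\<And>q. q \<in> points N \<Longrightarrow> X q \<in> push ` tangent_space N q"
  shows "restrict_field X \<in> vector_fields N" "q \<in> points N \<Longrightarrow> push (restrict_field X q) = X q"
proof -
  show 1: "push (restrict_field X q) = X q" if "q \<in> points N" for q
    unfolding restrict_field_def by (rule f_inv_into_f[OF XN[OF that]])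
  show "restrict_field X \<in> vector_fields N"
  proof (rule vector_fieldI)
    show "restrict_field X q \<in> tangent_space N q" if "q \<in> points N" for q
      unfolding restrict_field_def by (rule inv_into_into[OF XN[OF that]])
    fix f assume f: "f \<in> smooth_functions M"
    show "(\<lambda>q. restrict_field X q f) \<in> smooth_functions N"
      by (rule N.smooth_functions_cong[OF smooth_restrict[OF M.vector_fieldD(2)[OF X f]]])
        (metis 1 push_apply[OF f])
  qed
qed

text \<open>Naturality of the bracket for related fields: V' f is the restriction of V f to the
  submanifold, and U' acts on restrictions as U does.\<close>

lemma push_lie_bracket:
  assumes X: "X \<in> vector_fields M" "X' \<in> vector_fields N" "\<And>q. q \<in> points N \<Longrightarrow> push (X' q) = X q"
    and Y: "Y \<in> vector_fields M" "Y' \<in> vector_fields N" "\<And>q. q \<in> points N \<Longrightarrow> push (Y' q) = Y q"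
    and p: "p \<in> points N"
  shows "push (lie_bracket N X' Y' p) = lie_bracket M X Y p"
proof
  fix f
  show "push (lie_bracket N X' Y' p) f = lie_bracket M X Y p f"
  proof (cases "f \<in> smooth_functions M")
    case f: True
    have *: "U' p (\<lambda>q. V' q f) = U p (\<lambda>q. V q f)"
      if U: "U' \<in> vector_fields N" "\<And>q. q \<in> points N \<Longrightarrow> push (U' q) = U q"
        and V: "V \<in> vector_fields M" "V' \<in> vector_fields N" "\<And>q. q \<in> points N \<Longrightarrow> push (V' q) = V q" for U U' V V'
    proof -
      have "U' p (\<lambda>q. V' q f) = U' p (\<lambda>q. V q f)"
        by (rule N.tangent_local[OF N.vector_fieldD(1)[OF U(1) p] N.vector_fieldD(2)[OF V(2) smooth_restrict[OF f]]
              smooth_restrict[OF M.vector_fieldD(2)[OF V(1) f]] openin_topspace p])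
          (metis V(3) push_apply[OF f])
      also have "\<dots> = U p (\<lambda>q. V q f)"
        using push_apply[OF M.vector_fieldD(2)[OF V(1) f], of "U' p"] U(2)[OF p] by simp
      finally show ?thesis .
    qed
    show ?thesis
      using *[OF X(2,3) Y] *[OF Y(2,3) X]
      by (simp add: push_apply[OF f] N.lie_bracket_apply[OF smooth_restrict[OF f]] M.lie_bracket_apply[OF f])
  qed (simp add: push_nonsmooth lie_bracket_nonsmooth)
qed

context
  fixes T assumes T: "tensor_field11 M T"
    and TN: "\<And>q v. q \<in> points N \<Longrightarrow> v \<in> tangent_space N q \<Longrightarrow> T q (push v) \<in> push ` tangent_space N q"
begin

abbreviation T' where "T' \<equiv> induced_tensor M N T"

lemma induced_tensor_mem: "q \<in> points N \<Longrightarrow> v \<in> tangent_space N q \<Longrightarrow> T' q v \<in> tangent_space N q"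
  unfolding induced_tensor_def by (rule inv_into_into[OF TN])

lemma push_induced_tensor: "q \<in> points N \<Longrightarrow> v \<in> tangent_space N q \<Longrightarrow> push (T' q v) = T q (push v)"
  unfolding induced_tensor_def by (rule f_inv_into_f[OF TN])

text \<open>By \<open>vector_fieldI\<close> the field T' X need only be tested on functions f of M.
  Expanding the pushed-forward X in a coordinate frame Z of M gives (T' X) f as a sum of products of
  X(y_b) with restrictions of (T Z_b) f.\<close>

lemma tensor_induced_tensor: "tensor_field11 N T'"
  unfolding tensor_field11_def
proof (intro conjI ballI allI)
  fix q u assume q: "q \<in> points N" and u: "u \<in> tangent_space N q"
  have qM: "q \<in> points M" using q points_sub by blast
  note mem = induced_tensor_mem[OF q] and psh = push_induced_tensor[OF q]
  show "T' q u \<in> tangent_space N q" by (rule mem[OF u])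
  show "T' q (u + v) = T' q u + T' q v" if v: "v \<in> tangent_space N q" for v
  proof (rule push_eqD[OF q])
    show "push (T' q (u + v)) = push (T' q u + T' q v)"
      by (simp only: push_add psh N.tangent_plus u v M.tensor_add[OF T qM push_tangent[OF u] push_tangent[OF v]])
  qed (intro mem N.tangent_plus u v)+
  show "T' q (c *\<^sub>R u) = c *\<^sub>R T' q u" for c
  proof (rule push_eqD[OF q])
    show "push (T' q (c *\<^sub>R u)) = push (c *\<^sub>R T' q u)"
      by (simp only: push_scaleR psh N.tangent_scaleR u M.tensor_scaleR[OF T qM push_tangent[OF u]])
  qed (intro mem N.tangent_scaleR u)+
next
  fix X assume X: "X \<in> vector_fields N"
  note XT = N.vector_fieldD(1)[OF X]
  show "(\<lambda>p. T' p (X p)) \<in> vector_fields N"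
  proof (rule vector_fieldI)
    show "T' q (X q) \<in> tangent_space N q" if "q \<in> points N" for q
      by (rule induced_tensor_mem[OF that XT[OF that]])
    fix f assume f: "f \<in> smooth_functions M"
    show "(\<lambda>q. T' q (X q) f) \<in> smooth_functions N"
    proof (rule N.smooth_functions_local)
      fix p assume p: "p \<in> points N"
      obtain y W \<tau> G where D: "M.coords y W \<tau> G" and pW: "p \<in> W" using M.coords_exist p points_sub by blast
      obtain Z where Z: "\<And>a. Z a \<in> vector_fields M" "\<And>a q. q \<in> W \<Longrightarrow> cvec y (Z a q) = M.Pr a"
        using M.coords_frame[OF D] by blast
      have "smooth_near N p (\<lambda>q. \<Sum>b\<in>Basis. X q (\<lambda>q. y q \<bullet> b) * T q (Z b q) f)"
        by (intro N.smooth_near_sum[OF p] N.smooth_near_mult N.smooth_near_smooth[OF _ p]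
            N.vector_fieldD(2)[OF X smooth_restrict[OF M.coords_smooth[OF D]]]
            smooth_restrict M.vector_fieldD(2)[OF M.tensor_field[OF T Z(1)] f])
      then show "smooth_near N p (\<lambda>q. T' q (X q) f)"
      proof (rule N.smooth_near_cong[OF _ openin_restrict[OF M.coords_open(1)[OF D]]])
        show "p \<in> {q \<in> points N. q \<in> W}" using p pW by simp
        fix q assume "q \<in> {q \<in> points N. q \<in> W}"
        then have q: "q \<in> points N" and qW: "q \<in> W" by auto
        have qM: "q \<in> points M" using q points_sub by blast
        note Zq = M.vector_fieldD(1)[OF Z(1) qM]
        have "push (X q) = (\<Sum>b\<in>Basis. push (X q) (\<lambda>q. y q \<bullet> b) *\<^sub>R Z b q)"
          by (rule M.vector_expand[OF D Z qW push_tangent[OF XT[OF q]]])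
        then have "T q (push (X q)) = T q (\<Sum>b\<in>Basis. push (X q) (\<lambda>q. y q \<bullet> b) *\<^sub>R Z b q)" by (rule arg_cong)
        also have "\<dots> = (\<Sum>b\<in>Basis. T q (push (X q) (\<lambda>q. y q \<bullet> b) *\<^sub>R Z b q))"
          by (rule M.tensor_sum[OF T qM M.tangent_scaleR[OF Zq]])
        also have "\<dots> = (\<Sum>b\<in>Basis. X q (\<lambda>q. y q \<bullet> b) *\<^sub>R T q (Z b q))"
          by (simp only: M.tensor_scaleR[OF T qM Zq] push_apply[OF M.coords_smooth[OF D]])
        finally have "T q (push (X q)) f = (\<Sum>b\<in>Basis. X q (\<lambda>q. y q \<bullet> b) * T q (Z b q) f)"
          by (simp only: sum_apply_fun scaleR_apply_fun real_scaleR_def)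
        then show "(\<Sum>b\<in>Basis. X q (\<lambda>q. y q \<bullet> b) * T q (Z b q) f) = T' q (X q) f"
          using push_apply[OF f, of "T' q (X q)"] push_induced_tensor[OF q XT[OF q]] by simp
      qed
    qed
  qed
qed

lemma push_nijenhuis:
  assumes X: "X \<in> vector_fields M" "X' \<in> vector_fields N" "\<And>q. q \<in> points N \<Longrightarrow> push (X' q) = X q"
    and Y: "Y \<in> vector_fields M" "Y' \<in> vector_fields N" "\<And>q. q \<in> points N \<Longrightarrow> push (Y' q) = Y q"
    and p: "p \<in> points N"
  shows "push (nijenhuis (lie_bracket N) T' X' Y' p) = nijenhuis (lie_bracket M) T X Y p"
proof -
  note TM = M.tensor_field[OF T] and TN' = N.tensor_field[OF tensor_induced_tensor]
  have TX: "push (T' q (X' q)) = T q (X q)" and TY: "push (T' q (Y' q)) = T q (Y q)" if "q \<in> points N" for q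
    using push_induced_tensor[OF that N.vector_fieldD(1)[OF X(2) that]] X(3)[OF that]
      push_induced_tensor[OF that N.vector_fieldD(1)[OF Y(2) that]] Y(3)[OF that] by simp_all
  note FX = TM[OF X(1)] TN'[OF X(2)] TX and FY = TM[OF Y(1)] TN'[OF Y(2)] TY
  have b1: "push (lie_bracket N (\<lambda>q. T' q (X' q)) (\<lambda>q. T' q (Y' q)) p) = lie_bracket M (\<lambda>q. T q (X q)) (\<lambda>q. T q (Y q)) p"
    by (rule push_lie_bracket[OF FX FY p])
  have b2: "push (lie_bracket N (\<lambda>q. T' q (X' q)) Y' p) = lie_bracket M (\<lambda>q. T q (X q)) Y p"
    by (rule push_lie_bracket[OF FX Y p])
  have b3: "push (lie_bracket N X' (\<lambda>q. T' q (Y' q)) p) = lie_bracket M X (\<lambda>q. T q (Y q)) p"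
    by (rule push_lie_bracket[OF X FY p])
  have b4: "push (lie_bracket N X' Y' p) = lie_bracket M X Y p"
    by (rule push_lie_bracket[OF X Y p])
  note m = N.lie_bracket_tangent[OF _ _ p]
  note i = push_induced_tensor[OF p]
  show ?thesis
    unfolding nijenhuis_def push_add push_diff
    by (simp only: i m[OF TN'[OF X(2)] Y(2)] m[OF X(2) TN'[OF Y(2)]] m[OF X(2) Y(2)]
        induced_tensor_mem[OF p] b1 b2 b3 b4)
qed

end

end

section \<open>Frobenius' theorem for a projection tensor\<close>

locale involutive_projection = mfd M n
  for M :: "('m, 'e::euclidean_space) manifold" and n :: nat +
  fixes P :: "'m \<Rightarrow> 'm tangent \<Rightarrow> 'm tangent"
  assumes P: "tensor_field11 M P"
    and idem: "\<And>p v. p \<in> points M \<Longrightarrow> v \<in> tangent_space M p \<Longrightarrow> P p (P p v) = P p v"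
    and invol: "\<And>X Y p. X \<in> vector_fields M \<Longrightarrow> Y \<in> vector_fields M \<Longrightarrow> p \<in> points M \<Longrightarrow>
      (\<And>q. q \<in> points M \<Longrightarrow> P q (X q) = X q) \<Longrightarrow> (\<And>q. q \<in> points M \<Longrightarrow> P q (Y q) = Y q) \<Longrightarrow>
      P p (lie_bracket M X Y p) = lie_bracket M X Y p"
begin

text \<open>Replacing X and Y by P X and P Y makes them sections of the distribution everywhere
  without changing them on W, so that involutivity for global sections applies.\<close>

lemma invol_local:
  assumes X: "X \<in> vector_fields M" and Y: "Y \<in> vector_fields M" and W: "openin (top_of M) W" "p \<in> W"
    and PX: "\<And>q. q \<in> W \<Longrightarrow> P q (X q) = X q" and PY: "\<And>q. q \<in> W \<Longrightarrow> P q (Y q) = Y q"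
  shows "P p (lie_bracket M X Y p) = lie_bracket M X Y p"
proof -
  have p: "p \<in> points M" using W openin_subset by blast
  have "lie_bracket M X Y p = lie_bracket M (\<lambda>q. P q (X q)) (\<lambda>q. P q (Y q)) p"
    by (rule lie_bracket_local[OF X tensor_field[OF P X] Y tensor_field[OF P Y] W]) (simp_all add: PX PY)
  then show ?thesis
    using invol[OF tensor_field[OF P X] tensor_field[OF P Y] p] idem vector_fieldD(1)[OF X] vector_fieldD(1)[OF Y] by simp
qed

text \<open>\<open>Pm x\<close> is the matrix of \<open>P\<close> at \<open>\<sigma> x\<close>.
  Since \<open>Z a\<close> has coordinate vector Pr a, it is defined on the whole ambient space,
  factors through Pr and takes values in the model space.\<close>

lemma projection_in_coords:
  assumes C: "coords u W \<sigma> G"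
  obtains Pm where "\<And>a. smooth G (\<lambda>x. Pm x a)" "\<And>x. x \<in> G \<Longrightarrow> linear (Pm x)"
    "\<And>q v. q \<in> W \<Longrightarrow> v \<in> tangent_space M q \<Longrightarrow> cvec u (P q v) = Pm (u q) (cvec u v)"
    "\<And>x a. x \<in> G \<Longrightarrow> Pm x (Pm x a) = Pm x a" "\<And>x a. x \<in> G \<Longrightarrow> Pm x a \<in> model M"
proof -
  obtain Z where Z: "\<And>a. Z a \<in> vector_fields M" "\<And>a q. q \<in> W \<Longrightarrow> cvec u (Z a q) = Pr a"
    using coords_frame[OF C] by blast
  define Pm where "Pm = (\<lambda>x a. cvec u (P (\<sigma> x) (Z a (\<sigma> x))))"
  have qM: "q \<in> points M" if "q \<in> W" for q by (rule coords_sub[OF C that])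
  have ZT: "Z a q \<in> tangent_space M q" if "q \<in> W" for a q by (rule vector_fieldD(1)[OF Z(1) qM[OF that]])
  have PT: "P q v \<in> tangent_space M q" if "q \<in> W" "v \<in> tangent_space M q" for q v
    by (rule tensor_mem[OF P qM[OF that(1)] that(2)])
  have Zcv: "Z (cvec u v) q = v" if "q \<in> W" "v \<in> tangent_space M q" for q v
    by (rule coords_tangent_eq[OF C ZT that(2)]) (simp_all add: that Z(2) Pr(3)[OF coords_cvec_model[OF C that(2,1)]])
  have form: "cvec u (P q v) = Pm (u q) (cvec u v)" if q: "q \<in> W" and v: "v \<in> tangent_space M q" for q v
    unfolding Pm_def by (simp add: coords_point(3)[OF C q] Zcv[OF q v])
  note \<sigma>W = coords_par(1)[OF C]
  show ?thesis
  proof (rule that[of Pm])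
    show "smooth G (\<lambda>x. Pm x a)" for a
    proof (rule smooth_componentwise[OF _ coords_open(2)[OF C]])
      fix b :: 'e assume "b \<in> Basis"
      then show "smooth G (\<lambda>x. Pm x a \<bullet> b)"
        using coords_smooth_par[OF C vector_fieldD(2)[OF tensor_field[OF P Z(1)] coords_smooth[OF C]]]
        by (simp add: Pm_def cvec_inner)
    qed
    fix x assume x: "x \<in> G"
    let ?q = "\<sigma> x"
    note q = \<sigma>W[OF x]
    show "linear (Pm x)"
    proof (rule linearI)
      fix a b :: 'e and c :: real
      have "Z (a + b) ?q = Z a ?q + Z b ?q"
        by (rule coords_tangent_eq[OF C ZT tangent_plus[OF ZT ZT]]) (simp_all only: q cvec_add Z(2)[OF q] linear_add[OF Pr(1)])
      then show "Pm x (a + b) = Pm x a + Pm x b"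
        unfolding Pm_def by (simp only: tensor_add[OF P qM[OF q] ZT[OF q] ZT[OF q]] cvec_add)
      have "Z (c *\<^sub>R a) ?q = c *\<^sub>R Z a ?q"
        by (rule coords_tangent_eq[OF C ZT tangent_scaleR[OF ZT]]) (simp_all only: q cvec_scaleR Z(2)[OF q] linear_cmul[OF Pr(1)])
      then show "Pm x (c *\<^sub>R a) = c *\<^sub>R Pm x a"
        unfolding Pm_def by (simp only: tensor_scaleR[OF P qM[OF q] ZT[OF q]] cvec_scaleR)
    qed
    show "Pm x a \<in> model M" for a
      unfolding Pm_def by (rule coords_cvec_model[OF C PT[OF q ZT[OF q]] q])
    show "Pm x (Pm x a) = Pm x a" for a
      unfolding Pm_def by (simp only: Zcv[OF q PT[OF q ZT[OF q]]] idem[OF qM[OF q] ZT[OF q]])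
  qed (rule form)
qed

text \<open>Let \<open>Pm x\<close> be P in coordinates and \<open>P0\<close> its value at u p. The
  operator L x = P0 (Pm x) + (1 - P0)(1 - Pm x) is the identity at u p and satisfies L x (Pm x) = P0
  (L x), so its inverse \<open>I x\<close> carries Im P0 onto Im (Pm x). Hence I x (P0 h) spans the
  distribution and is normalised by having P0-part P0 h. The bracket of two such fields lies in Im
  (Pm x) by involutivity and is annihilated by P0, as the P0-parts are constant; P0 is injective on
  Im (Pm x), so the bracket is zero. This is the symmetry needed for
  \<open>total_ode\<close>.\<close>

lemma adapted_frame:
  assumes C: "coords u W \<sigma> G" and p: "p \<in> W"
  obtains P0 B H where "linear P0" "\<And>a. P0 (P0 a) = P0 a" "\<And>a. P0 a \<in> model M"
    "open H" "H \<subseteq> G" "u p \<in> H" "\<And>h. smooth H (\<lambda>x. B x h)" "\<And>x. x \<in> H \<Longrightarrow> linear (B x)"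
    "\<And>x h. x \<in> H \<Longrightarrow> B x h \<in> model M" "\<And>x h. x \<in> H \<Longrightarrow> P0 (B x h) = P0 h"
    "\<And>x h. x \<in> H \<Longrightarrow> B x (P0 h) = B x h"
    "\<And>x h k. x \<in> H \<Longrightarrow> Dv (\<lambda>x. B x k) x (B x h) = Dv (\<lambda>x. B x h) x (B x k)"
    "\<And>q v. q \<in> W \<Longrightarrow> u q \<in> H \<Longrightarrow> v \<in> tangent_space M q \<Longrightarrow> P q v = v \<longleftrightarrow> cvec u v = B (u q) (cvec u v)"
    "\<And>q v w. q \<in> W \<Longrightarrow> u q \<in> H \<Longrightarrow> v \<in> tangent_space M q \<Longrightarrow> cvec u v = B (u q) w \<Longrightarrow> P q v = v"
proof (rule projection_in_coords[OF C])
  fix Pm assume sP: "\<And>a. smooth G (\<lambda>x. Pm x a)" and lP: "\<And>x. x \<in> G \<Longrightarrow> linear (Pm x)"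
    and form: "\<And>q v. q \<in> W \<Longrightarrow> v \<in> tangent_space M q \<Longrightarrow> cvec u (P q v) = Pm (u q) (cvec u v)"
    and PP: "\<And>x a. x \<in> G \<Longrightarrow> Pm x (Pm x a) = Pm x a" and PE: "\<And>x a. x \<in> G \<Longrightarrow> Pm x a \<in> model M"
  have oG: "open G" by (rule coords_open(2)[OF C])
  have pG: "u p \<in> G" by (rule coords_point(2)[OF C p])
  define P0 where "P0 = Pm (u p)"
  have lP0: "linear P0" and P00: "\<And>a. P0 (P0 a) = P0 a" and P0E: "\<And>a. P0 a \<in> model M"
    unfolding P0_def using lP[OF pG] PP[OF pG] PE[OF pG] by auto
  have bP0: "bounded_linear P0" using lP0 linear_conv_bounded_linear by blast
  have bPr: "bounded_linear Pr" using Pr(1) linear_conv_bounded_linear by blast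
  define L where "L = (\<lambda>x a. P0 (Pm x a) + ((a - Pm x a) - P0 (a - Pm x a)))"
  have lL: "linear (L x)" if "x \<in> G" for x
    unfolding L_def
    by (intro linear_compose_add linear_compose_sub linear_ident lP[OF that]
        linear_compose[OF lP[OF that] lP0, unfolded o_def]
        linear_compose[OF linear_compose_sub[OF linear_ident lP[OF that]] lP0, unfolded o_def])
  have sL: "smooth G (\<lambda>x. L x a)" for a
    unfolding L_def by (intro smooth_add smooth_diff smooth_linear_compose[OF bP0 oG] sP smooth_const oG)
  have L0: "L (u p) a = a" for a
    unfolding L_def P0_def[symmetric] by (simp add: linear_diff[OF lP0] P00)
  obtain K I where K: "open K" "K \<subseteq> G" "u p \<in> K" and lI: "\<And>x. x \<in> K \<Longrightarrow> linear (I x)"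
    and LI: "\<And>x v. x \<in> K \<Longrightarrow> L x (I x v) = v" and IL: "\<And>x v. x \<in> K \<Longrightarrow> I x (L x v) = v"
    and sI: "\<And>v. smooth K (\<lambda>x. I x v)"
    using smooth_inverse_family[OF oG pG lL sL L0] by metis
  have KG: "x \<in> G" if "x \<in> K" for x using K(2) that by blast
  have LP: "L x (Pm x a) = P0 (Pm x a)" if "x \<in> K" for x a
    unfolding L_def using PP[OF KG[OF that]] linear_0[OF lP0] by simp
  have P0L: "P0 (L x a) = P0 (Pm x a)" if "x \<in> K" for x a
    unfolding L_def by (simp add: linear_add[OF lP0] linear_diff[OF lP0] P00)
  have PI: "Pm x (I x (P0 h)) = I x (P0 h)" if "x \<in> K" for x h
  proof -
    have "L x (Pm x (I x (P0 h))) = L x (I x (P0 h))"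
      unfolding LP[OF that] P0L[OF that, symmetric] LI[OF that] by (rule P00)
    then show ?thesis using IL[OF that] by metis
  qed
  have P0I: "P0 (I x (P0 h)) = P0 h" if "x \<in> K" for x h
    using P0L[OF that, of "I x (P0 h)"] LI[OF that] PI[OF that] P00 by simp
  have fix1: "c = I x (P0 c)" if "x \<in> K" "Pm x c = c" for x c
    using LP[OF that(1), of c] IL[OF that(1), of c] that(2) by simp
  have Pfix: "P q v = v \<longleftrightarrow> Pm (u q) (cvec u v) = cvec u v" if q: "q \<in> W" and v: "v \<in> tangent_space M q" for q v
    using coords_tangent_eq[OF C tensor_mem[OF P coords_sub[OF C q] v] v q] form[OF q v] by auto
  \<comment> \<open>Points of \<open>W\<close> have coordinates in the model space, so the bracket
    argument is available only for such x.\<close>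
  have sym: "Dv (\<lambda>x. I x (P0 k)) x (I x (P0 h)) = Dv (\<lambda>x. I x (P0 h)) x (I x (P0 k))"
    if x: "x \<in> K" "x \<in> model M" for x h k
  proof -
    define q where "q = \<sigma> x"
    have q: "q \<in> W" and uq: "u q = x"
      using coords_par[OF C KG[OF x(1)]] Pr(3)[OF x(2)] by (auto simp: q_def)
    define B where "B = (\<lambda>h x. I x (P0 h))"
    have sB: "smooth K (B h)" for h unfolding B_def by (rule sI)
    have BE: "B h y \<in> model M" if "y \<in> K" for h y
      using PE[OF KG[OF that], of "B h y"] PI[OF that] by (simp add: B_def)
    have uK: "u q \<in> K" using x uq by simp
    have ex: "\<exists>X V. X \<in> vector_fields M \<and> openin (top_of M) V \<and> q \<in> V \<and> V \<subseteq> W \<and>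
        (\<forall>r\<in>V. u r \<in> K \<and> cvec u (X r) = B h (u r))" for h
      using field_with_cvec[OF C q K(1) uK sB BE] by metis
    obtain X V where X: "X \<in> vector_fields M" "openin (top_of M) V" "q \<in> V" "V \<subseteq> W"
      "\<And>r. r \<in> V \<Longrightarrow> u r \<in> K \<and> cvec u (X r) = B h (u r)" using ex[of h] by metis
    obtain Y V' where Y: "Y \<in> vector_fields M" "openin (top_of M) V'" "q \<in> V'" "V' \<subseteq> W"
      "\<And>r. r \<in> V' \<Longrightarrow> u r \<in> K \<and> cvec u (Y r) = B k (u r)" using ex[of k] by metis
    have qM: "q \<in> points M" by (rule coords_sub[OF C q])
    have PV: "P r (X r) = X r" if "r \<in> V" for r
      using Pfix[OF _ vector_fieldD(1)[OF X(1)]] X(4) X(5)[OF that] that PI coords_sub[OF C] by (auto simp: B_def)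
    have PV': "P r (Y r) = Y r" if "r \<in> V'" for r
      using Pfix[OF _ vector_fieldD(1)[OF Y(1)]] Y(4) Y(5)[OF that] that PI coords_sub[OF C] by (auto simp: B_def)
    define c where "c = cvec u (lie_bracket M X Y q)"
    have "P q (lie_bracket M X Y q) = lie_bracket M X Y q"
      by (rule invol_local[OF X(1) Y(1) openin_Int[OF X(2) Y(2)]]) (use X(3) Y(3) PV PV' in auto)
    then have Pc: "Pm x c = c"
      using Pfix[OF q lie_bracket_tangent[OF X(1) Y(1) qM]] by (simp add: c_def uq)
    have comp: "A q (\<lambda>r. A' r (\<lambda>q. u q \<bullet> b)) = Dv (B h') x (cvec u (A q)) \<bullet> b"
      if A: "A \<in> vector_fields M" and A': "A' \<in> vector_fields M" and O: "openin (top_of M) O'" "q \<in> O'"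
        "\<And>r. r \<in> O' \<Longrightarrow> u r \<in> K \<and> cvec u (A' r) = B h' (u r)" and b: "b \<in> Basis" for A A' O' h' b
    proof -
      have "A q (\<lambda>r. A' r (\<lambda>q. u q \<bullet> b)) = Dv (\<lambda>x. B h' x \<bullet> b) (u q) (cvec u (A q))"
        by (rule tangent_chain[OF vector_fieldD(1)[OF A qM] coords_smooth[OF C] K(1) uK smooth_inner[OF sB K(1)]
              vector_fieldD(2)[OF A' coords_smooth[OF C]] O(1,2)])
          (metis O(3) b cvec_inner)
      also have "Dv (\<lambda>x. B h' x \<bullet> b) (u q) = (\<lambda>a. Dv (B h') (u q) a \<bullet> b)"
        by (rule Dv_eq) (rule has_derivative_inner_left[OF smooth_has_derivative[OF sB K(1) uK]])
      finally show ?thesis by (simp add: uq)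
    qed
    have cX: "cvec u (X q) = B h x" and cY: "cvec u (Y q) = B k x" using X(3,5) Y(3,5) uq by auto
    have c: "c = Dv (B k) x (B h x) - Dv (B h) x (B k x)"
    proof (rule euclidean_eqI)
      fix b :: 'e assume b: "b \<in> Basis"
      have "c \<bullet> b = X q (\<lambda>r. Y r (\<lambda>q. u q \<bullet> b)) - Y q (\<lambda>r. X r (\<lambda>q. u q \<bullet> b))"
        unfolding c_def cvec_inner[OF b] by (rule lie_bracket_apply[OF coords_smooth[OF C]])
      also have "\<dots> = Dv (B k) x (B h x) \<bullet> b - Dv (B h) x (B k x) \<bullet> b"
        using comp[OF X(1) Y(1) Y(2,3,5) b] comp[OF Y(1) X(1) X(2,3,5) b] cX cY by simp
      finally show "c \<bullet> b = (Dv (B k) x (B h x) - Dv (B h) x (B k x)) \<bullet> b" by (simp add: inner_diff_left)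
    qed
    have P0D: "P0 (Dv (B h') x a) = 0" for h' a
    proof -
      have "((\<lambda>x. P0 (B h' x)) has_derivative (\<lambda>a. P0 (Dv (B h') x a))) (at x)"
        by (rule bounded_linear.has_derivative[OF bP0 smooth_has_derivative[OF sB K(1) x(1)]])
      moreover have "((\<lambda>x. P0 (B h' x)) has_derivative (\<lambda>a. 0)) (at x)"
        by (rule has_derivative_transform_within_open[OF has_derivative_const[of "P0 h'"] K(1) x(1)])
          (simp add: B_def P0I)
      ultimately show ?thesis using has_derivative_unique by metis
    qed
    have "P0 c = 0" unfolding c linear_diff[OF lP0] P0D by simp
    then have "c = 0" using fix1[OF x(1) Pc] linear_0[OF lI[OF x(1)]] by simp
    then show ?thesis using c by (simp add: B_def)
  qed
  \<comment> \<open>Composition with Pr makes the frame and its derivative factor through the model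
    space, so the symmetry shown at model points holds on an open subset of the ambient
    space.\<close>
  define H where "H = G \<inter> Pr -` K"
  define B where "B = (\<lambda>x h. I (Pr x) (P0 h))"
  have oH: "open H" unfolding H_def
    by (intro open_Int oG open_vimage K(1) linear_continuous_on bPr)
  have PrH: "Pr x \<in> K" if "x \<in> H" for x using that by (simp add: H_def)
  have pH: "u p \<in> H" using pG K(3) Pr(3)[OF coords_point(1)[OF C p]] by (simp add: H_def)
  have sB: "smooth H (\<lambda>x. B x h)" for h
    unfolding B_def by (rule smooth_compose[OF smooth_linear[OF bPr] sI oH K(1)]) (use PrH in auto)
  have lB: "linear (B x)" if "x \<in> H" for x
    unfolding B_def using linear_compose[OF lP0 lI[OF PrH[OF that]]] by (simp add: o_def)
  have BE: "B x h \<in> model M" if "x \<in> H" for x h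
    unfolding B_def using PE[OF KG[OF PrH[OF that]], of "I (Pr x) (P0 h)"] PI[OF PrH[OF that]] by simp
  have DB: "Dv (\<lambda>x. B x k) x a = Dv (\<lambda>x. I x (P0 k)) (Pr x) (Pr a)" if "x \<in> H" for x k a
  proof -
    have "((\<lambda>x. B x k) has_derivative (\<lambda>a. Dv (\<lambda>x. I x (P0 k)) (Pr x) (Pr a))) (at x)"
      unfolding B_def
      by (rule has_derivative_compose[OF bounded_linear_imp_has_derivative[OF bPr] smooth_has_derivative[OF sI K(1) PrH[OF that]]])
    from Dv_eq[OF this] show ?thesis by simp
  qed
  have symB: "Dv (\<lambda>x. B x k) x (B x h) = Dv (\<lambda>x. B x h) x (B x k)" if x: "x \<in> H" for x h k
    unfolding DB[OF x] Pr(3)[OF BE[OF x]] unfolding B_def by (rule sym[OF PrH[OF x] Pr(2)])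
  have uPr: "Pr (u q) = u q" if "q \<in> W" for q by (rule Pr(3)[OF coords_point(1)[OF C that]])
  show ?thesis
  proof (rule that[OF lP0 P00 P0E oH _ pH sB lB BE _ _ symB])
    show "H \<subseteq> G" by (simp add: H_def)
    show "P0 (B x h) = P0 h" if "x \<in> H" for x h unfolding B_def by (rule P0I[OF PrH[OF that]])
    show "B x (P0 h) = B x h" for x h unfolding B_def P00 ..
    fix q v assume q: "q \<in> W" and uH: "u q \<in> H" and v: "v \<in> tangent_space M q"
    have uK: "u q \<in> K" using PrH[OF uH] uPr[OF q] by simp
    show "P q v = v \<longleftrightarrow> cvec u v = B (u q) (cvec u v)"
      unfolding Pfix[OF q v] B_def uPr[OF q] using fix1[OF uK] PI[OF uK] by metis
    fix w assume "cvec u v = B (u q) w"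
    then show "P q v = v" unfolding Pfix[OF q v] B_def uPr[OF q] using PI[OF uK] by metis
  qed
qed

end

section \<open>Construction of a leaf through a given point\<close>

lemma smooth_on_subspace_iff:
  fixes E W :: "'a::euclidean_space set" and \<pi> :: "'a \<Rightarrow> 'a"
  assumes "openin (top_of_set E) W" "linear \<pi>" "range \<pi> \<subseteq> E" "\<And>x. x \<in> E \<Longrightarrow> \<pi> x = x"
  shows "smooth_on E W f \<longleftrightarrow> smooth (\<pi> -` W) (\<lambda>x. f (\<pi> x))"
  unfolding smooth_on_def using Ck_on_subspace_iff[OF assms, of _ f] by (simp add: o_def)

lemma zero_derivative_ball:
  fixes f :: "'a::euclidean_space \<Rightarrow> 'b::euclidean_space"
  assumes "\<And>x. x \<in> ball 0 e \<Longrightarrow> (f has_derivative (\<lambda>h. 0)) (at x)" and x: "x \<in> ball 0 e"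
  shows "f x = f 0"
proof -
  have "\<exists>c. \<forall>x\<in>ball 0 e. f x = c"
    by (rule has_derivative_zero_constant[OF convex_ball]) (rule has_derivative_at_withinI[OF assms(1)])
  moreover have "0 \<in> ball 0 e" using x order_le_less_trans[OF norm_ge_zero] by auto
  ultimately show ?thesis using x by metis
qed

context involutive_projection
begin

text \<open>The equation is solved for v in a full ball and restricted to Im P0, because B x (P0 h)
  = B x h leaves nothing new in the directions of Ker P0. Tangent vectors of the leaf have
  coordinates B(u q) a with a in Im P0. These are the coordinates of the vectors fixed by P, and a
  is recovered as their P0-part, which makes the inclusion an immersion.\<close>

lemma frobenius:
  assumes p0: "p0 \<in> points M"
  shows "\<exists>(N :: ('m, 'e) manifold) d. smooth_manifold d N \<and> points N \<subseteq> points M \<and> smooth_map N M id \<and> p0 \<in> points N \<and>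
    (\<forall>q\<in>points N. inj_on (push_forward M id) (tangent_space N q) \<and>
      push_forward M id ` tangent_space N q = P q ` tangent_space M q)"
proof -
  obtain u W \<sigma> G where C: "coords u W \<sigma> G" and pW: "p0 \<in> W" using coords_exist[OF p0] by blast
  show ?thesis
  proof (rule adapted_frame[OF C pW])
    fix P0 B H
    assume lP0: "linear P0" and P00: "\<And>a. P0 (P0 a) = P0 a" and P0E: "\<And>a. P0 a \<in> model M"
      and oH: "open H" and HG: "H \<subseteq> G" and pH: "u p0 \<in> H" and sB: "\<And>h. smooth H (\<lambda>x. B x h)"
      and lB: "\<And>x. x \<in> H \<Longrightarrow> linear (B x)" and BE: "\<And>x h. x \<in> H \<Longrightarrow> B x h \<in> model M"
      and P0B: "\<And>x h. x \<in> H \<Longrightarrow> P0 (B x h) = P0 h" and BP0: "\<And>x h. x \<in> H \<Longrightarrow> B x (P0 h) = B x h"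
      and sym: "\<And>x h k. x \<in> H \<Longrightarrow> Dv (\<lambda>x. B x k) x (B x h) = Dv (\<lambda>x. B x h) x (B x k)"
      and fixP: "\<And>q v. q \<in> W \<Longrightarrow> u q \<in> H \<Longrightarrow> v \<in> tangent_space M q \<Longrightarrow> P q v = v \<longleftrightarrow> cvec u v = B (u q) (cvec u v)"
      and fixB: "\<And>q v w. q \<in> W \<Longrightarrow> u q \<in> H \<Longrightarrow> v \<in> tangent_space M q \<Longrightarrow> cvec u v = B (u q) w \<Longrightarrow> P q v = v"
    have bP0: "bounded_linear P0" using lP0 linear_conv_bounded_linear by blast
    have bPr: "bounded_linear Pr" using Pr(1) linear_conv_bounded_linear by blast
    obtain e \<phi> where e: "e > 0" and \<phi>0: "\<phi> 0 = u p0" and \<phi>H: "\<And>v. v \<in> ball 0 e \<Longrightarrow> \<phi> v \<in> H"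
      and D\<phi>: "\<And>v. v \<in> ball 0 e \<Longrightarrow> (\<phi> has_derivative B (\<phi> v)) (at v)"
      using total_ode[OF oH pH sB lB sym] by metis
    have s\<phi>: "smooth (ball 0 e) \<phi>" by (rule total_ode_smooth[OF oH open_ball sB \<phi>H D\<phi>])
    \<comment> \<open>The values of B lie in the model space, so \<phi> - Pr \<phi> has derivative
      zero and keeps its value 0 at the origin.\<close>
    have \<phi>E: "Pr (\<phi> v) = \<phi> v" if v: "v \<in> ball 0 e" for v
    proof -
      have "\<phi> v - Pr (\<phi> v) = \<phi> 0 - Pr (\<phi> 0)"
      proof (rule zero_derivative_ball[OF _ v])
        fix x :: 'e assume x: "x \<in> ball 0 e"
        show "((\<lambda>v. \<phi> v - Pr (\<phi> v)) has_derivative (\<lambda>h. 0)) (at x)"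
          using has_derivative_diff[OF D\<phi>[OF x] bounded_linear.has_derivative[OF bPr D\<phi>[OF x]]]
          by (simp add: Pr(3)[OF BE[OF \<phi>H[OF x]]])
      qed
      then show ?thesis using Pr(3)[OF coords_point(1)[OF C pW]] by (simp add: \<phi>0)
    qed
    have P0\<phi>: "P0 (\<phi> v) = P0 (u p0) + P0 v" if v: "v \<in> ball 0 e" for v
    proof -
      have "P0 (\<phi> v) - P0 v = P0 (\<phi> 0) - P0 0"
      proof (rule zero_derivative_ball[OF _ v])
        fix x :: 'e assume x: "x \<in> ball 0 e"
        show "((\<lambda>v. P0 (\<phi> v) - P0 v) has_derivative (\<lambda>h. 0)) (at x)"
          using has_derivative_diff[OF bounded_linear.has_derivative[OF bP0 D\<phi>[OF x]] bounded_linear_imp_has_derivative[OF bP0]]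
          by (simp add: P0B[OF \<phi>H[OF x]])
      qed
      then show ?thesis using linear_0[OF lP0] by (simp add: \<phi>0 algebra_simps)
    qed
    define V where "V = range P0"
    have V: "subspace V" unfolding V_def by (rule linear_subspace_image[OF lP0 subspace_UNIV])
    have VP0: "P0 v = v" if "v \<in> V" for v using that P00 by (auto simp: V_def)
    have P0V: "P0 a \<in> V" for a by (simp add: V_def)
    define D where "D = V \<inter> ball 0 e"
    have oD: "openin (top_of_set V) D" unfolding D_def by (rule openin_open_Int[OF open_ball])
    define \<iota> where "\<iota> = (\<lambda>v. \<sigma> (\<phi> v))"
    \<comment> \<open>This inverts \<open>\<iota>\<close> on \<open>D\<close>, since P0 (\<phi> v) =
      P0 (u p0) + v for v in V. Being built from global smooth functions on M, it is continuous and
      smooth on the leaf by restriction.\<close>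
    define \<kappa> where "\<kappa> = (\<lambda>q. P0 (u q) - P0 (u p0))"
    define S where "S = \<iota> ` D"
    have Db: "v \<in> ball 0 e" if "v \<in> D" for v using that by (simp add: D_def)
    have \<phi>G: "\<phi> v \<in> G" if "v \<in> ball 0 e" for v using \<phi>H[OF that] HG by blast
    have \<iota>W: "\<iota> v \<in> W" and u\<iota>: "u (\<iota> v) = \<phi> v" if "v \<in> ball 0 e" for v
      unfolding \<iota>_def using coords_par[OF C \<phi>G[OF that]] \<phi>E[OF that] by auto
    have \<kappa>\<iota>: "\<kappa> (\<iota> v) = v" if "v \<in> D" for v
      using P0\<phi>[OF Db[OF that]] VP0[of v] that by (simp add: \<kappa>_def u\<iota>[OF Db[OF that]] D_def)
    have S: "q \<in> W" "\<kappa> q \<in> D" "\<iota> (\<kappa> q) = q" "u q = \<phi> (\<kappa> q)" if "q \<in> S" for q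
      using that \<iota>W[OF Db] \<kappa>\<iota> u\<iota>[OF Db] by (auto simp: S_def)
    have Sp: "S \<subseteq> points M" using S(1) coords_sub[OF C] by blast
    have \<kappa>S: "\<kappa> ` S = D" using \<kappa>\<iota> by (force simp: S_def)
    have inj\<kappa>: "inj_on \<kappa> S" using S(3) by (metis inj_onI)
    have inv\<kappa>: "inv_into S \<kappa> v = \<iota> v" if "v \<in> D" for v
      by (rule inv_into_f_eq[OF inj\<kappa> _ \<kappa>\<iota>[OF that]]) (use that in \<open>simp add: S_def\<close>)
    have \<kappa>s: "(\<lambda>q. \<kappa> q \<bullet> b) \<in> smooth_functions M" for b
    proof (rule smooth_functions_local)
      fix q assume q: "q \<in> points M"
      have s: "smooth UNIV (\<lambda>x. (P0 x - P0 (u p0)) \<bullet> b)"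
        by (intro smooth_inner smooth_diff smooth_linear bP0 smooth_const open_UNIV)
      show "smooth_near M q (\<lambda>q. \<kappa> q \<bullet> b)"
        unfolding \<kappa>_def by (rule smooth_near_compose[OF smooth_near_smooth[OF coords_smooth[OF C] q] open_UNIV _ s q]) simp
    qed
    have o\<iota>: "openin (top_of_set V) {v \<in> D. \<iota> v \<in> X}" if X: "openin (top_of M) X" for X
    proof -
      have "open (ball 0 e \<inter> \<phi> -` {x \<in> G. \<sigma> x \<in> X})"
        by (rule continuous_open_preimage[OF smooth_continuous[OF s\<phi> open_ball] open_ball coords_open_par[OF C X]])
      then have "openin (top_of_set V) (V \<inter> (ball 0 e \<inter> \<phi> -` {x \<in> G. \<sigma> x \<in> X}))" by (rule openin_open_Int)
      moreover have "V \<inter> (ball 0 e \<inter> \<phi> -` {x \<in> G. \<sigma> x \<in> X}) = {v \<in> D. \<iota> v \<in> X}"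
        using \<phi>G by (auto simp: D_def \<iota>_def)
      ultimately show ?thesis by simp
    qed
    \<comment> \<open>A small leaf is embedded, so it carries the subspace topology and one global
      chart.\<close>
    define N where "N = \<lparr>top_of = subtopology (top_of M) S, model = V, charts = {(S, \<kappa>)}\<rparr>"
    have N: "top_of N = subtopology (top_of M) S" "model N = V" "charts N = {(S, \<kappa>)}" by (auto simp: N_def)
    have pN: "points N = S" using Sp by (auto simp: N)
    define \<pi> where "\<pi> = proj_on V"
    have \<pi>: "linear \<pi>" "range \<pi> \<subseteq> V" "\<And>x. x \<in> V \<Longrightarrow> \<pi> x = x" using proj_on[OF V] by (auto simp: \<pi>_def)
    have b\<pi>: "bounded_linear \<pi>" using \<pi>(1) linear_conv_bounded_linear by blast
    note sV = smooth_on_subspace_iff[OF _ \<pi>]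
    have homeo: "homeomorphic_map (subtopology (top_of M) S) (top_of_set D) \<kappa>"
    proof (rule homeomorphic_maps_imp_map[where g=\<iota>], unfold homeomorphic_maps_def, intro conjI ballI)
      show "continuous_map (subtopology (top_of M) S) (top_of_set D) \<kappa>"
        using continuous_map_from_subtopology[OF continuous_map_smooth[OF \<kappa>s]] S(2)
        by (auto simp: continuous_map_in_subtopology)
      have "continuous_map (top_of_set D) (top_of M) \<iota>"
        unfolding continuous_map
      proof (intro conjI allI impI)
        show "\<iota> ` topspace (top_of_set D) \<subseteq> points M" using Sp by (auto simp: S_def)
        fix X assume "openin (top_of M) X"
        then have "openin (top_of_set V) {v \<in> D. \<iota> v \<in> X}" by (rule o\<iota>)
        then have "openin (top_of_set D) {v \<in> D. \<iota> v \<in> X}" by (rule openin_subset_trans) (auto simp: D_def)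
        then show "openin (top_of_set D) {x \<in> topspace (top_of_set D). \<iota> x \<in> X}"
          by simp
      qed
      then show "continuous_map (top_of_set D) (subtopology (top_of M) S) \<iota>"
        by (auto simp: continuous_map_in_subtopology S_def)
    qed (use S(3) \<kappa>\<iota> in auto)
    have sN: "smooth_manifold (dim V) N"
      unfolding smooth_manifold_def N
    proof (intro conjI)
      show "Hausdorff_space (subtopology (top_of M) S)"
        using mfd by (simp add: smooth_manifold_def Hausdorff_space_subtopology)
      show "second_countable (subtopology (top_of M) S)"
        using mfd by (simp add: smooth_manifold_def second_countable_subtopology)
      show "\<forall>(U, \<phi>)\<in>{(S, \<kappa>)}. is_chart N U \<phi>"
        using homeo oD Sp by (simp add: is_chart_def N \<kappa>S subtopology_subtopology openin_subtopology_self)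
          (use openin_topspace[of "subtopology (top_of M) S"] Sp in \<open>simp add: Int_absorb1\<close>)
      show "(\<Union>(U, \<phi>)\<in>{(S, \<kappa>)}. U) = topspace (subtopology (top_of M) S)" using Sp by auto
      have "smooth (\<pi> -` D) (\<lambda>x. \<kappa> (inv_into S \<kappa> (\<pi> x)))"
        by (rule smooth_cong[OF smooth_linear[OF b\<pi>] open_vimage_subspace[OF oD \<pi>(1,2)]]) (simp add: inv\<kappa> \<kappa>\<iota>)
      then have "smooth_on V D (\<kappa> \<circ> inv_into S \<kappa>)" by (simp add: sV[OF oD])
      then show "\<forall>(U, \<phi>)\<in>{(S, \<kappa>)}. \<forall>(V', \<psi>)\<in>{(S, \<kappa>)}. smooth_on V (\<phi> ` (U \<inter> V')) (\<psi> \<circ> inv_into U \<phi>)"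
        by (simp add: \<kappa>S)
    qed (auto simp: V)
    have sm: "smooth_map N M id"
      unfolding smooth_map_def N
    proof (intro conjI)
      show "continuous_map (subtopology (top_of M) S) (top_of M) id"
        by (rule continuous_map_from_subtopology[OF continuous_map_id])
      have "smooth_on V (\<kappa> ` (S \<inter> U)) (\<theta> \<circ> id \<circ> inv_into S \<kappa>)" if c: "(U, \<theta>) \<in> charts M" for U \<theta>
      proof -
        define D' where "D' = {v \<in> D. \<iota> v \<in> U}"
        have D': "\<kappa> ` (S \<inter> U) = D'" using \<kappa>\<iota> by (force simp: S_def D'_def)
        have oD': "openin (top_of_set V) D'" unfolding D'_def by (rule o\<iota>[OF chart_open[OF c]])
        have o': "open (\<pi> -` D')" by (rule open_vimage_subspace[OF oD' \<pi>(1,2)])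
        have "smooth (\<pi> -` D') (\<lambda>x. \<theta> (\<iota> (\<pi> x)))"
        proof (rule smooth_componentwise[OF _ o'], rule smooth_local[OF _ o'])
          fix b x :: 'e assume x: "x \<in> \<pi> -` D'"
          have qU: "\<iota> (\<pi> x) \<in> U" using x by (simp add: D'_def)
          have "smooth_near M (\<iota> (\<pi> x)) (\<lambda>q. \<theta> q \<bullet> b)"
            by (rule smooth_near_chart[OF c qU open_UNIV]) (auto intro: smooth_inner smooth_id)
          then obtain f X where f: "f \<in> smooth_functions M" and X: "openin (top_of M) X" "\<iota> (\<pi> x) \<in> X"
            "\<forall>q\<in>X. \<theta> q \<bullet> b = f q" unfolding smooth_near_def by blast
          define T where "T = \<pi> -` {v \<in> D. \<iota> v \<in> U \<inter> X}"
          have oT: "open T" unfolding T_def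
            by (rule open_vimage_subspace[OF o\<iota>[OF openin_Int[OF chart_open[OF c] X(1)]] \<pi>(1,2)])
          have Tb: "\<pi> y \<in> ball 0 e" if "y \<in> T" for y using that Db by (auto simp: T_def)
          have "smooth T (\<lambda>x. \<phi> (\<pi> x))"
            by (rule smooth_compose[OF smooth_linear[OF b\<pi>] s\<phi> oT open_ball]) (use Tb in auto)
          then have "smooth T (\<lambda>x. f (\<sigma> (\<phi> (\<pi> x))))"
            by (rule smooth_compose[OF _ coords_smooth_par[OF C f] oT coords_open(2)[OF C]]) (use \<phi>G[OF Tb] in auto)
          then have "smooth T (\<lambda>x. \<theta> (\<iota> (\<pi> x)) \<bullet> b)"
            by (rule smooth_cong[OF _ oT]) (use X(3) in \<open>auto simp: T_def \<iota>_def\<close>)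
          moreover have "x \<in> T" using x X(2) by (auto simp: T_def D'_def)
          ultimately show "\<exists>T. open T \<and> x \<in> T \<and> smooth T (\<lambda>x. \<theta> (\<iota> (\<pi> x)) \<bullet> b)" using oT by blast
        qed
        then have "smooth (\<pi> -` D') (\<lambda>x. \<theta> (inv_into S \<kappa> (\<pi> x)))"
          by (rule smooth_cong[OF _ o']) (simp add: inv\<kappa> D'_def)
        then show ?thesis unfolding D' by (simp add: sV[OF oD'])
      qed
      then show "\<forall>(V', \<psi>)\<in>{(S, \<kappa>)}. \<forall>(U, \<phi>)\<in>charts M. smooth_on V (\<psi> ` (V' \<inter> id -` U)) (\<phi> \<circ> id \<circ> inv_into V' \<psi>)"
        by auto
    qed
    interpret sub: submap M N n "dim V"
      by unfold_locales (use sN sm pN Sp in auto)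
    have tang: "inj_on sub.push (tangent_space N q) \<and> sub.push ` tangent_space N q = P q ` tangent_space M q"
      if q: "q \<in> S" for q
    proof -
      have cN: "(S, \<kappa>) \<in> charts N" by (simp add: N)
      obtain y Wn \<tau> Gn where Cn: "sub.N.coords y Wn \<tau> Gn" and qn: "q \<in> Wn" and y\<kappa>: "\<And>q. q \<in> Wn \<Longrightarrow> y q = \<kappa> q"
        using sub.N.coords_of_chart[OF cN q] by metis
      have qM: "q \<in> points M" using q Sp by blast
      have uH: "u q \<in> H" using \<phi>H[OF Db[OF S(2)[OF q]]] S(4)[OF q] by simp
      have sk: "(\<lambda>q. \<kappa> q \<bullet> b) \<in> smooth_functions N" for b by (rule sub.smooth_restrict[OF \<kappa>s])
      have su: "(\<lambda>q. u q \<bullet> b) \<in> smooth_functions N" for b by (rule sub.smooth_restrict[OF coords_smooth[OF C]])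
      have cy: "cvec y v = cvec \<kappa> v" if v: "v \<in> tangent_space N q" for v
        unfolding cvec_def
        by (intro sum.cong refl arg_cong2[where f=scaleR]
            sub.N.tangent_local[OF v sub.N.coords_smooth[OF Cn] sk sub.N.coords_open(1)[OF Cn] qn]) (simp add: y\<kappa>)
      have cV: "cvec y v \<in> V" if "v \<in> tangent_space N q" for v
        using sub.N.coords_cvec_model[OF Cn that qn] by (simp add: N)
      \<comment> \<open>On the leaf u = \<phi> o \<kappa>, so the differential of the inclusion in
        coordinates is the derivative of \<phi> at \<kappa> q, that is, B(u q). The coordinates y
        agree with \<kappa> near q.\<close>
      have key: "cvec u (sub.push v) = B (u q) (cvec y v)" if v: "v \<in> tangent_space N q" for v
      proof (rule euclidean_eqI)
        fix b :: 'e assume b: "b \<in> Basis"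
        have "v (\<lambda>q. u q \<bullet> b) = Dv (\<lambda>x. \<phi> x \<bullet> b) (\<kappa> q) (cvec \<kappa> v)"
          by (rule sub.N.tangent_chain[OF v sk open_ball Db[OF S(2)[OF q]] smooth_inner[OF s\<phi> open_ball] su openin_topspace])
            (use q pN S(4) in auto)
        also have "Dv (\<lambda>x. \<phi> x \<bullet> b) (\<kappa> q) = (\<lambda>h. B (\<phi> (\<kappa> q)) h \<bullet> b)"
          by (rule Dv_eq) (rule has_derivative_inner_left[OF D\<phi>[OF Db[OF S(2)[OF q]]]])
        finally show "cvec u (sub.push v) \<bullet> b = B (u q) (cvec y v) \<bullet> b"
          using b by (simp add: sub.cvec_push[OF C] cvec_inner cy[OF v] S(4)[OF q])
      qed
      have "inj_on sub.push (tangent_space N q)"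
      proof (rule inj_onI)
        fix v w assume v: "v \<in> tangent_space N q" and w: "w \<in> tangent_space N q" and "sub.push v = sub.push w"
        then have "B (u q) (cvec y v) = B (u q) (cvec y w)" using key by metis
        then have "cvec y v = cvec y w" using P0B[OF uH] VP0 cV v w by metis
        then show "v = w" by (rule sub.N.coords_tangent_eq[OF Cn v w qn])
      qed
      moreover have "sub.push v \<in> P q ` tangent_space M q" if v: "v \<in> tangent_space N q" for v
      proof -
        have T: "sub.push v \<in> tangent_space M q" by (rule sub.push_tangent[OF v])
        from fixB[OF S(1)[OF q] uH T key[OF v]] show ?thesis using T by (metis imageI)
      qed
      moreover have "P q w \<in> sub.push ` tangent_space N q" if w: "w \<in> tangent_space M q" for w
      proof -
        have T: "P q w \<in> tangent_space M q" by (rule tensor_mem[OF P qM w])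
        define a where "a = cvec u (P q w)"
        \<comment> \<open>A vector fixed by P has coordinates B(u q)(P0 a), so P0 a is the
          coordinate vector of its preimage in the leaf.\<close>
        have a: "a = B (u q) (P0 a)"
          using fixP[OF S(1)[OF q] uH T] idem[OF qM w] BP0[OF uH] by (simp add: a_def)
        have "P0 a \<in> model N" by (simp add: N P0V)
        then obtain v where v: "v \<in> tangent_space N q" "cvec y v = P0 a"
          using sub.N.tangent_cvec_exists[OF Cn qn] by blast
        have "cvec u (sub.push v) = cvec u (P q w)" using key[OF v(1)] v(2) a by (simp add: a_def)
        then have "sub.push v = P q w" by (rule coords_tangent_eq[OF C sub.push_tangent[OF v(1)] T S(1)[OF q]])
        then show ?thesis using v(1) by (metis imageI)
      qed
      ultimately show ?thesis by blast
    qed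
    have "0 \<in> D" using subspace_0[OF V] e by (simp add: D_def)
    then have "\<iota> 0 \<in> S" by (simp add: S_def)
    moreover have "\<iota> 0 = p0" using coords_point(3)[OF C pW] by (simp add: \<iota>_def \<phi>0)
    ultimately have "p0 \<in> S" by simp
    then show ?thesis
      by (intro exI[of _ N] exI[of _ "dim V"]) (simp add: sN Sp sm pN tang)
  qed
qed

end

section \<open>F-structures\<close>

context mfd
begin

lemma tensor_comp:
  assumes T: "tensor_field11 M T" and S: "tensor_field11 M S"
  shows "tensor_field11 M (\<lambda>p v. T p (S p v))"
  unfolding tensor_field11_def
proof (intro conjI ballI allI)
  fix p u assume p: "p \<in> points M" and u: "u \<in> tangent_space M p"
  show "T p (S p u) \<in> tangent_space M p" by (intro tensor_mem[OF T] tensor_mem[OF S] p u)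
  show "T p (S p (u + v)) = T p (S p u) + T p (S p v)" if v: "v \<in> tangent_space M p" for v
    by (simp only: tensor_add[OF S p u v] tensor_add[OF T p tensor_mem[OF S p u] tensor_mem[OF S p v]])
  show "T p (S p (c *\<^sub>R u)) = c *\<^sub>R T p (S p u)" for c
    by (simp only: tensor_scaleR[OF S p u] tensor_scaleR[OF T p tensor_mem[OF S p u]])
qed (rule tensor_field[OF T tensor_field[OF S]])

lemma tensor_lincomb:
  assumes T: "tensor_field11 M T" and S: "tensor_field11 M S"
  shows "tensor_field11 M (\<lambda>p v. a *\<^sub>R T p v + b *\<^sub>R S p v)"
  unfolding tensor_field11_def
proof (intro conjI ballI allI)
  fix p u assume p: "p \<in> points M" and u: "u \<in> tangent_space M p"
  show "a *\<^sub>R T p u + b *\<^sub>R S p u \<in> tangent_space M p"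
    by (intro tangent_plus tangent_scaleR tensor_mem[OF T] tensor_mem[OF S] p u)
  show "a *\<^sub>R T p (u + v) + b *\<^sub>R S p (u + v) = (a *\<^sub>R T p u + b *\<^sub>R S p u) + (a *\<^sub>R T p v + b *\<^sub>R S p v)"
    if v: "v \<in> tangent_space M p" for v
    by (simp only: tensor_add[OF S p u v] tensor_add[OF T p u v] scaleR_add_right add_ac)
  show "a *\<^sub>R T p (c *\<^sub>R u) + b *\<^sub>R S p (c *\<^sub>R u) = c *\<^sub>R (a *\<^sub>R T p u + b *\<^sub>R S p u)" for c
    by (simp only: tensor_scaleR[OF S p u] tensor_scaleR[OF T p u] scaleR_add_right scaleR_scaleR mult.commute)
next
  fix X assume X: "X \<in> vector_fields M"
  show "(\<lambda>p. a *\<^sub>R T p (X p) + b *\<^sub>R S p (X p)) \<in> vector_fields M"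
    by (intro vector_field_plus vector_field_cscale tensor_field[OF T X] tensor_field[OF S X])
qed

lemma tensor_id: "tensor_field11 M (\<lambda>p v. v)"
  by (simp add: tensor_field11_def)

lemma tensor_power: "tensor_field11 M T \<Longrightarrow> tensor_field11 M (\<lambda>p. T p ^^ k)"
proof (induction k)
  case 0
  then show ?case using tensor_id by (simp add: id_def)
next
  case (Suc k)
  then show ?case using tensor_comp[of T "\<lambda>p. T p ^^ k"] by (simp add: o_def)
qed

lemma vector_field_cong:
  assumes X: "X \<in> vector_fields M" and eq: "\<And>q. q \<in> points M \<Longrightarrow> X q = X' q"
  shows "X' \<in> vector_fields M"
  unfolding vector_fields_def
proof (intro CollectI conjI ballI)
  show "X' p \<in> tangent_space M p" if "p \<in> points M" for p using vector_fieldD(1)[OF X that] eq[OF that] by simp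
  show "(\<lambda>p. X' p f) \<in> smooth_functions M" if "f \<in> smooth_functions M" for f
    by (rule smooth_functions_cong[OF vector_fieldD(2)[OF X that]]) (simp add: eq)
qed

lemma lie_bracket_zero:
  assumes "X \<in> vector_fields M" "p \<in> points M"
  shows "lie_bracket M (\<lambda>q. 0) X p = 0" "lie_bracket M X (\<lambda>q. 0) p = 0"
  using tangent_const[OF vector_fieldD(1)[OF assms], of 0] by (auto simp: lie_bracket_def fun_eq_iff)

text \<open>The components of Z and W equal A, B and 0 on \<open>points M\<close> only, which
  \<open>lie_bracket_local\<close> tolerates. Of the four real brackets just [A, B]
  survives.\<close>

lemma clie_bracket_real:
  assumes A: "A \<in> vector_fields M" "\<And>q. q \<in> points M \<Longrightarrow> Z q = (A q, 0)"
    and B: "B \<in> vector_fields M" "\<And>q. q \<in> points M \<Longrightarrow> W q = (B q, 0)" and p: "p \<in> points M"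
  shows "clie_bracket M Z W p = (lie_bracket M A B p, 0)"
proof -
  have f: "fst \<circ> Z \<in> vector_fields M" "fst \<circ> W \<in> vector_fields M" "snd \<circ> Z \<in> vector_fields M" "snd \<circ> W \<in> vector_fields M"
    by (rule vector_field_cong[OF A(1)], simp add: A(2), rule vector_field_cong[OF B(1)], simp add: B(2),
      rule vector_field_cong[OF vector_field_zero], simp add: A(2), rule vector_field_cong[OF vector_field_zero], simp add: B(2))
  note l = lie_bracket_local[OF _ _ _ _ openin_topspace p]
  have "lie_bracket M (fst \<circ> Z) (fst \<circ> W) p = lie_bracket M A B p"
    by (rule l[OF f(1) A(1) f(2) B(1)]) (simp_all add: A(2) B(2))
  moreover have "lie_bracket M (snd \<circ> Z) (snd \<circ> W) p = lie_bracket M (\<lambda>q. 0) (\<lambda>q. 0) p"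
    by (rule l[OF f(3) vector_field_zero f(4) vector_field_zero]) (simp_all add: A(2) B(2))
  moreover have "lie_bracket M (fst \<circ> Z) (snd \<circ> W) p = lie_bracket M A (\<lambda>q. 0) p"
    by (rule l[OF f(1) A(1) f(4) vector_field_zero]) (simp_all add: A(2) B(2))
  moreover have "lie_bracket M (snd \<circ> Z) (fst \<circ> W) p = lie_bracket M (\<lambda>q. 0) B p"
    by (rule l[OF f(3) vector_field_zero f(2) B(1)]) (simp_all add: A(2) B(2))
  ultimately show ?thesis
    unfolding clie_bracket_def by (simp only: lie_bracket_zero[OF A(1) p] lie_bracket_zero[OF B(1) p] lie_bracket_zero[OF vector_field_zero p] add_0 diff_zero)
qed

lemma nijenhuis_real:
  assumes T: "tensor_field11 M T" and A: "A \<in> vector_fields M" "\<And>q. q \<in> points M \<Longrightarrow> Z q = (A q, 0)"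
    and B: "B \<in> vector_fields M" "\<And>q. q \<in> points M \<Longrightarrow> W q = (B q, 0)" and p: "p \<in> points M"
  shows "nijenhuis (clie_bracket M) (\<lambda>q. cextend (T q)) Z W p = (nijenhuis (lie_bracket M) T A B p, 0)"
proof -
  note T0 = tensor_zero[OF T]
  have TZ: "cextend (T q) (Z q) = (T q (A q), 0)" and TW: "cextend (T q) (W q) = (T q (B q), 0)" if "q \<in> points M" for q
    by (simp_all only: A(2)[OF that] B(2)[OF that] cextend_def map_prod_simp T0[OF that])
  note TA = tensor_field[OF T A(1)] and TB = tensor_field[OF T B(1)]
  have "clie_bracket M (\<lambda>q. cextend (T q) (Z q)) (\<lambda>q. cextend (T q) (W q)) p = (lie_bracket M (\<lambda>q. T q (A q)) (\<lambda>q. T q (B q)) p, 0)"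
    by (rule clie_bracket_real[OF TA TZ TB TW p])
  moreover have "clie_bracket M (\<lambda>q. cextend (T q) (Z q)) W p = (lie_bracket M (\<lambda>q. T q (A q)) B p, 0)"
    by (rule clie_bracket_real[OF TA TZ B p])
  moreover have "clie_bracket M Z (\<lambda>q. cextend (T q) (W q)) p = (lie_bracket M A (\<lambda>q. T q (B q)) p, 0)"
    by (rule clie_bracket_real[OF A TB TW p])
  moreover have "clie_bracket M Z W p = (lie_bracket M A B p, 0)" by (rule clie_bracket_real[OF A B p])
  ultimately show ?thesis
    unfolding nijenhuis_def
    by (simp only: cextend_def map_prod_simp T0[OF p] minus_prod_def plus_prod_def fst_conv snd_conv diff_zero add_0)
qed

end

section \<open>The real projections onto the image and the kernel of F\<close>

lemma cextend_power: "(cextend T ^^ k) (u, v) = ((T ^^ k) u, (T ^^ k) v)"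
  by (induction k) (simp_all add: cextend_def)

text \<open>The shape of the two components in \<open>l_op_eq\<close>: b stands for the contribution
  of Im \<alpha>, which that of Im \<beta> cancels by \<open>Im_part\<close>.\<close>

lemma cancel_middle:
  fixes a b c :: "'v::ab_group_add"
  shows "- (a - b + (c - - b)) = - (a + c)" "- (a + b + (c + - b)) = - (a + c)"
  by (simp_all add: algebra_simps)

lemma times_same_eqD: "A \<times> A = B \<times> B \<Longrightarrow> A = B"
  by blast

locale F_manifold = mfd M n
  for M :: "('m, 'e::euclidean_space) manifold" and n :: nat +
  fixes r K :: nat and \<alpha> \<beta> :: complex and F :: "'m \<Rightarrow> 'm tangent \<Rightarrow> 'm tangent"
  assumes FS: "F_structure_manifold M n r K \<alpha> \<beta> F"
begin

lemma F: "tensor_field11 M F" and K3: "3 \<le> K"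
  using FS by (simp_all add: F_structure_manifold_def)

lemmas Fm = tensor_mem[OF F]

text \<open>A quasi-inverse of F: the real part of l with both exponents lowered by one, where 3 <=
  K keeps the differences of natural numbers exact. From F k0 = k0 F = l0 it follows that k0
  exhibits vectors of Im l0 as images under F and undoes F on Im F.\<close>

definition k0 :: "'m \<Rightarrow> 'm tangent \<Rightarrow> 'm tangent"
  where "k0 p v = (- Re \<alpha>) *\<^sub>R (F p ^^ (K - 1)) v + (- Re \<beta>) *\<^sub>R (F p ^^ (K - 2)) v"

definition l0 :: "'m \<Rightarrow> 'm tangent \<Rightarrow> 'm tangent" where "l0 p v = F p (k0 p v)"

definition m0 :: "'m \<Rightarrow> 'm tangent \<Rightarrow> 'm tangent" where "m0 p v = v - l0 p v"

lemma F_power_Suc: "F p ((F p ^^ j) v) = (F p ^^ Suc j) v" "(F p ^^ j) (F p v) = (F p ^^ Suc j) v"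
  by (simp_all add: funpow_swap1)

lemma tensor_k0: "tensor_field11 M k0"
  unfolding k0_def[abs_def] by (rule tensor_lincomb[OF tensor_power[OF F] tensor_power[OF F]])

lemma tensor_l0: "tensor_field11 M l0"
  unfolding l0_def[abs_def] by (rule tensor_comp[OF F tensor_k0])

lemma tensor_m0: "tensor_field11 M m0"
proof -
  have "(\<lambda>p v. 1 *\<^sub>R v + (-1) *\<^sub>R l0 p v) = m0" by (intro ext) (simp add: m0_def)
  then show ?thesis using tensor_lincomb[OF tensor_id tensor_l0, of 1 "-1"] by simp
qed

context
  fixes p assumes p: "p \<in> points M"
begin

lemma k0_F:
  assumes v: "v \<in> tangent_space M p"
  shows "k0 p (F p v) = l0 p v"
proof -
  have m: "(F p ^^ j) v \<in> tangent_space M p" for j by (rule tensor_mem[OF tensor_power[OF F] p v])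
  have "l0 p v = (- Re \<alpha>) *\<^sub>R F p ((F p ^^ (K - 1)) v) + (- Re \<beta>) *\<^sub>R F p ((F p ^^ (K - 2)) v)"
    unfolding l0_def k0_def
    by (simp only: tensor_add[OF F p tangent_scaleR[OF m] tangent_scaleR[OF m]] tensor_scaleR[OF F p m])
  then show ?thesis by (simp only: k0_def F_power_Suc)
qed

lemma l0_eq:
  assumes v: "v \<in> tangent_space M p"
  shows "l0 p v = - (Re \<alpha> *\<^sub>R (F p ^^ K) v + Re \<beta> *\<^sub>R (F p ^^ (K - 1)) v)"
proof -
  have "Suc (K - 1) = K" "Suc (K - 2) = K - 1" using K3 by auto
  then show ?thesis
    using k0_F[OF v] by (simp only: k0_def F_power_Suc scaleR_minus_left minus_add_distrib)
qed

lemma F_equation: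
  assumes v: "v \<in> tangent_space M p"
  shows "Re \<alpha> *\<^sub>R (F p ^^ (K + 1)) v + Re \<beta> *\<^sub>R (F p ^^ K) v + F p v = 0"
    "Im \<alpha> *\<^sub>R (F p ^^ (K + 1)) v + Im \<beta> *\<^sub>R (F p ^^ K) v = 0"
proof -
  have T0: "F p 0 = 0" by (rule tensor_zero[OF F p])
  have z: "(F p ^^ j) 0 = 0" for j by (rule tensor_zero[OF tensor_power[OF F] p])
  have "cscale \<alpha> ((cextend (F p) ^^ (K + 1)) (v, 0)) + cscale \<beta> ((cextend (F p) ^^ K) (v, 0)) + cextend (F p) (v, 0) = 0"
    using FS v p tangent_zero by (simp only: F_structure_manifold_def) blast
  moreover have "cextend (F p) (v, 0) = (F p v, 0)" by (simp only: cextend_def map_prod_simp T0)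
  ultimately have "(Re \<alpha> *\<^sub>R (F p ^^ (K + 1)) v + Re \<beta> *\<^sub>R (F p ^^ K) v + F p v,
      Im \<alpha> *\<^sub>R (F p ^^ (K + 1)) v + Im \<beta> *\<^sub>R (F p ^^ K) v) = 0"
    by (simp only: cextend_power cscale_def fst_conv snd_conv z scaleR_zero_right diff_zero add_0 plus_prod_def
        add_0_right)
  then show "Re \<alpha> *\<^sub>R (F p ^^ (K + 1)) v + Re \<beta> *\<^sub>R (F p ^^ K) v + F p v = 0"
    "Im \<alpha> *\<^sub>R (F p ^^ (K + 1)) v + Im \<beta> *\<^sub>R (F p ^^ K) v = 0"
    by (simp_all only: zero_prod_def prod.inject)
qed

lemma l0_F:
  assumes v: "v \<in> tangent_space M p"
  shows "l0 p (F p v) = F p v"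
proof -
  have s: "Suc (K - 1) = K" "Suc K = K + 1" using K3 by auto
  have "l0 p (F p v) = - (Re \<alpha> *\<^sub>R (F p ^^ (K + 1)) v + Re \<beta> *\<^sub>R (F p ^^ K) v)"
    by (simp only: l0_eq[OF Fm[OF p v]] F_power_Suc s)
  also have "\<dots> = F p v"
    using F_equation(1)[OF v] by (simp only: add_eq_0_iff)
  finally show ?thesis .
qed

lemma F_l0:
  assumes v: "v \<in> tangent_space M p"
  shows "F p (l0 p v) = F p v"
proof -
  have "F p (l0 p v) = F p (k0 p (F p v))" by (simp only: k0_F[OF v])
  also have "\<dots> = l0 p (F p v)" by (simp only: l0_def)
  finally show ?thesis by (simp only: l0_F[OF v])
qed

lemma l0_idem:
  assumes v: "v \<in> tangent_space M p"
  shows "l0 p (l0 p v) = l0 p v"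
  using l0_F[OF tensor_mem[OF tensor_k0 p v]] by (simp only: l0_def[of p v])

lemma F_m0:
  assumes v: "v \<in> tangent_space M p"
  shows "F p (m0 p v) = 0"
  unfolding m0_def by (simp only: tensor_diff[OF F p v tensor_mem[OF tensor_l0 p v]] F_l0[OF v] diff_self)

lemma l0_m0:
  assumes v: "v \<in> tangent_space M p"
  shows "l0 p (m0 p v) = 0"
  unfolding m0_def by (simp only: tensor_diff[OF tensor_l0 p v tensor_mem[OF tensor_l0 p v]] l0_idem[OF v] diff_self)

lemma m0_idem:
  assumes v: "v \<in> tangent_space M p"
  shows "m0 p (m0 p v) = m0 p v"
  by (simp only: m0_def[of p "m0 p v"] l0_m0[OF v] diff_zero)

lemma Im_part:
  assumes v: "v \<in> tangent_space M p"
  shows "Im \<alpha> *\<^sub>R (F p ^^ K) v + Im \<beta> *\<^sub>R (F p ^^ (K - 1)) v = 0"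
proof -
  define j where "j = (\<lambda>v. Im \<alpha> *\<^sub>R (F p ^^ K) v + Im \<beta> *\<^sub>R (F p ^^ (K - 1)) v)"
  have jt: "tensor_field11 M (\<lambda>p v. Im \<alpha> *\<^sub>R (F p ^^ K) v + Im \<beta> *\<^sub>R (F p ^^ (K - 1)) v)"
    by (rule tensor_lincomb[OF tensor_power[OF F] tensor_power[OF F]])
  have s: "Suc (K - 1) = K" "Suc K = K + 1" using K3 by auto
  have jF: "j (F p w) = 0" if "w \<in> tangent_space M p" for w
    unfolding j_def using F_equation(2)[OF that] by (simp only: F_power_Suc s)
  \<comment> \<open>K and K - 1 are both successors, so each power occurring in \<open>j\<close>
    first applies F to \<open>m0 p v\<close>.\<close>
  have "(F p ^^ Suc i) (m0 p v) = 0" for i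
    using tensor_zero[OF tensor_power[OF F, of i] p] by (simp only: F_power_Suc(2)[symmetric] F_m0[OF v])
  from this[of "K - 1"] this[of "K - 2"] have jm: "j (m0 p v) = 0"
    using K3 by (simp add: j_def numeral_2_eq_2 Suc_diff_Suc)
  have "j v = j (l0 p v + m0 p v)" by (simp add: m0_def)
  also have "\<dots> = j (l0 p v) + j (m0 p v)"
    unfolding j_def by (rule tensor_add[OF jt p tensor_mem[OF tensor_l0 p v] tensor_mem[OF tensor_m0 p v]])
  also have "\<dots> = 0"
    using jF[OF tensor_mem[OF tensor_k0 p v]] jm by (simp add: l0_def)
  finally show ?thesis by (simp only: j_def)
qed

lemma l_op_eq:
  assumes u: "u \<in> tangent_space M p" and v: "v \<in> tangent_space M p"
  shows "l_op K \<alpha> \<beta> (F p) (u, v) = (l0 p u, l0 p v)"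
proof -
  have i: "Im \<beta> *\<^sub>R (F p ^^ (K - 1)) w = - (Im \<alpha> *\<^sub>R (F p ^^ K) w)" if "w \<in> tangent_space M p" for w
    using Im_part[OF that] by (simp only: add_eq_0_iff)
  show ?thesis
    unfolding l_op_def cextend_power cscale_def fst_conv snd_conv i[OF u] i[OF v] l0_eq[OF u] l0_eq[OF v]
    by (simp only: plus_prod_def uminus_prod_def fst_conv snd_conv cancel_middle)
qed

lemma m_op_eq:
  assumes u: "u \<in> tangent_space M p" and v: "v \<in> tangent_space M p"
  shows "m_op K \<alpha> \<beta> (F p) (u, v) = (m0 p u, m0 p v)"
proof -
  have "m_op K \<alpha> \<beta> (F p) (u, v) = (u, v) - l_op K \<alpha> \<beta> (F p) (u, v)" by (simp only: m_op_def l_op_def) (simp add: algebra_simps)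
  then show ?thesis by (simp only: l_op_eq[OF u v] minus_prod_def fst_conv snd_conv m0_def)
qed

lemma D_l_eq: "D_l M K \<alpha> \<beta> F p = l0 p ` tangent_space M p \<times> l0 p ` tangent_space M p"
proof -
  have "D_l M K \<alpha> \<beta> F p = map_prod (l0 p) (l0 p) ` (tangent_space M p \<times> tangent_space M p)"
    unfolding D_l_def by (rule image_cong) (auto simp: l_op_eq)
  then show ?thesis by (simp add: map_prod_surj_on[OF refl refl])
qed

lemma D_m_eq: "D_m M K \<alpha> \<beta> F p = m0 p ` tangent_space M p \<times> m0 p ` tangent_space M p"
proof -
  have "D_m M K \<alpha> \<beta> F p = map_prod (m0 p) (m0 p) ` (tangent_space M p \<times> tangent_space M p)"
    unfolding D_m_def by (rule image_cong) (auto simp: m_op_eq)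
  then show ?thesis by (simp add: map_prod_surj_on[OF refl refl])
qed

end

end

section \<open>Integral manifolds of the image of a projection tensor\<close>

context mfd
begin

lemma integrable_distribution_projection:
  assumes P: "tensor_field11 M P" and idem: "\<And>p v. p \<in> points M \<Longrightarrow> v \<in> tangent_space M p \<Longrightarrow> P p (P p v) = P p v"
    and invol: "\<And>X Y p. X \<in> vector_fields M \<Longrightarrow> Y \<in> vector_fields M \<Longrightarrow> p \<in> points M \<Longrightarrow>
      (\<And>q. q \<in> points M \<Longrightarrow> P q (X q) = X q) \<Longrightarrow> (\<And>q. q \<in> points M \<Longrightarrow> P q (Y q) = Y q) \<Longrightarrow>
      P p (lie_bracket M X Y p) = lie_bracket M X Y p"
    and D: "\<And>p. p \<in> points M \<Longrightarrow> D p = P p ` tangent_space M p \<times> P p ` tangent_space M p"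
  shows "integrable_distribution M D"
  unfolding integrable_distribution_def
proof
  fix p assume p: "p \<in> points M"
  interpret involutive_projection M n P
    by (rule involutive_projection.intro[OF mfd_axioms involutive_projection_axioms.intro[OF P idem invol]])
  from frobenius[OF p] obtain N :: "('m, 'e) manifold" and d
    where "smooth_manifold d N \<and> points N \<subseteq> points M \<and> smooth_map N M id \<and> p \<in> points N \<and>
    (\<forall>q\<in>points N. inj_on (push_forward M id) (tangent_space N q) \<and>
      push_forward M id ` tangent_space N q = P q ` tangent_space M q)" by (elim exE)
  then have N: "smooth_manifold d N" "points N \<subseteq> points M" "smooth_map N M id" "p \<in> points N"
    "\<And>q. q \<in> points N \<Longrightarrow> inj_on (push_forward M id) (tangent_space N q) \<and>
      push_forward M id ` tangent_space N q = P q ` tangent_space M q" by simp_all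
  have "integral_manifold M D N"
    unfolding integral_manifold_def Let_def
  proof (intro conjI ballI)
    fix q assume q: "q \<in> points N"
    then have "q \<in> points M" using N(2) by blast
    then show "push_forward M id ` tangent_space N q \<times> push_forward M id ` tangent_space N q = D q"
      using N(5)[OF q] D by simp
  qed (use N in auto)
  then show "\<exists>N. integral_manifold M D N \<and> p \<in> points N" using N(4) by blast
qed

lemma integral_manifold_projection:
  assumes N: "integral_manifold M D N"
    and D: "\<And>p. p \<in> points M \<Longrightarrow> D p = P p ` tangent_space M p \<times> P p ` tangent_space M p"
  obtains d where "immersion M N n d" "\<And>q. q \<in> points N \<Longrightarrow> push_forward M id ` tangent_space N q = P q ` tangent_space M q"
proof -
  obtain d where d: "smooth_manifold d N" using N by (auto simp: integral_manifold_def)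
  have sub: "points N \<subseteq> points M" and sm: "smooth_map N M id"
    and inj: "\<And>q. q \<in> points N \<Longrightarrow> inj_on (push_forward M id) (tangent_space N q)"
    and eq: "\<And>q. q \<in> points N \<Longrightarrow> push_forward M id ` tangent_space N q \<times> push_forward M id ` tangent_space N q = D q"
    using N by (simp_all add: integral_manifold_def Let_def)
  have im: "immersion M N n d"
    by unfold_locales (use d sub sm inj in auto)
  show ?thesis
  proof (rule that[OF im])
    fix q assume q: "q \<in> points N"
    then have "q \<in> points M" using sub by blast
    from times_same_eqD[OF trans[OF eq[OF q] D[OF this]]]
    show "push_forward M id ` tangent_space N q = P q ` tangent_space M q" .
  qed
qed

text \<open>The easy half of Frobenius' theorem. On an integral manifold through p both fields are
  push-forwards of smooth fields; the push-forward of the bracket of these is the bracket on M, so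
  the latter is tangent to the leaf.\<close>

lemma projection_bracket:
  assumes D: "\<And>p. p \<in> points M \<Longrightarrow> D p = P p ` tangent_space M p \<times> P p ` tangent_space M p"
    and int: "integrable_distribution M D" and p: "p \<in> points M"
    and X: "X \<in> vector_fields M" "\<And>q. q \<in> points M \<Longrightarrow> X q \<in> P q ` tangent_space M q"
    and Y: "Y \<in> vector_fields M" "\<And>q. q \<in> points M \<Longrightarrow> Y q \<in> P q ` tangent_space M q"
  shows "lie_bracket M X Y p \<in> P p ` tangent_space M p"
proof -
  obtain N where N: "integral_manifold M D N" and pN: "p \<in> points N"
    using int p by (auto simp: integrable_distribution_def)
  obtain d where im: "immersion M N n d"
    and eq: "\<And>q. q \<in> points N \<Longrightarrow> push_forward M id ` tangent_space N q = P q ` tangent_space M q"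
    using integral_manifold_projection[OF N D] by blast
  interpret i: immersion M N n d by (rule im)
  have X': "X q \<in> i.push ` tangent_space N q" if "q \<in> points N" for q using X(2) eq[OF that] i.points_sub that by blast
  have Y': "Y q \<in> i.push ` tangent_space N q" if "q \<in> points N" for q using Y(2) eq[OF that] i.points_sub that by blast
  note rX = i.restrict_field[OF X(1) X'] and rY = i.restrict_field[OF Y(1) Y']
  have "lie_bracket M X Y p = i.push (lie_bracket N (i.restrict_field X) (i.restrict_field Y) p)"
    by (rule i.push_lie_bracket[OF X(1) rX Y(1) rY pN, symmetric])
  then show ?thesis
    using eq[OF pN] i.N.lie_bracket_tangent[OF rX(1) rY(1) pN] by (metis imageI)
qed

end

lemma eq_sum_diffI:
  fixes x u v w :: "'v::ab_group_add"
  assumes "x - u - v + w = 0"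
  shows "x = u + v - w"
proof -
  have "x - (u + v - w) = x - u - v + w" by (simp add: algebra_simps)
  then show ?thesis using assms by (metis eq_iff_diff_eq_0)
qed

section \<open>The two directions of the equivalence\<close>

context F_manifold
begin

abbreviation NF where "NF \<equiv> nijenhuis (lie_bracket M) F"

lemma image_fixed: "p \<in> points M \<Longrightarrow> v \<in> l0 p ` tangent_space M p \<Longrightarrow> l0 p v = v"
  using l0_idem by blast

lemmas vf_l0 = tensor_field[OF tensor_l0]
  and vf_m0 = tensor_field[OF tensor_m0]
  and vf_k0 = tensor_field[OF tensor_k0]
  and vf_F = tensor_field[OF F]

lemma F_eq_0_iff:
  assumes p: "p \<in> points M" and v: "v \<in> tangent_space M p"
  shows "F p v = 0 \<longleftrightarrow> m0 p v = v"
proof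
  assume "F p v = 0"
  then have "l0 p v = 0" using k0_F[OF p v] tensor_zero[OF tensor_k0 p] by simp
  then show "m0 p v = v" by (simp add: m0_def)
qed (use F_m0[OF p v] in simp)

lemma nijenhuis_kernel:
  assumes p: "p \<in> points M" and X: "X \<in> vector_fields M" "\<And>q. q \<in> points M \<Longrightarrow> F q (X q) = 0"
    and Y: "Y \<in> vector_fields M" "\<And>q. q \<in> points M \<Longrightarrow> F q (Y q) = 0"
  shows "NF X Y p = F p (F p (lie_bracket M X Y p))"
proof -
  note l = lie_bracket_local[OF _ _ _ _ openin_topspace p] and z = vector_field_zero
  have "lie_bracket M (\<lambda>q. F q (X q)) (\<lambda>q. F q (Y q)) p = lie_bracket M (\<lambda>q. 0) (\<lambda>q. 0) p"
    by (rule l[OF vf_F[OF X(1)] z vf_F[OF Y(1)] z]) (simp_all add: X Y)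
  moreover have "lie_bracket M (\<lambda>q. F q (X q)) Y p = lie_bracket M (\<lambda>q. 0) Y p"
    by (rule l[OF vf_F[OF X(1)] z Y(1) Y(1)]) (simp_all add: X Y)
  moreover have "lie_bracket M X (\<lambda>q. F q (Y q)) p = lie_bracket M X (\<lambda>q. 0) p"
    by (rule l[OF X(1) X(1) vf_F[OF Y(1)] z]) (simp_all add: X Y)
  ultimately show ?thesis
    unfolding nijenhuis_def
    by (simp only: lie_bracket_zero[OF z p] lie_bracket_zero[OF X(1) p] lie_bracket_zero[OF Y(1) p]
        tensor_zero[OF F p] diff_zero add_0)
qed

text \<open>Since X = l0 X = F (k0 X), and likewise for Y, the bracket [X, Y] is the first term of
  N_F(k0 X, k0 Y). The vanishing of that tensor expresses it through the other three terms, all in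
  Im F, and l0 is the identity on Im F.\<close>

lemma involutive_l0:
  assumes N0: "\<And>X Y p. X \<in> vector_fields M \<Longrightarrow> Y \<in> vector_fields M \<Longrightarrow> p \<in> points M \<Longrightarrow> NF X Y p = 0"
    and X: "X \<in> vector_fields M" and Y: "Y \<in> vector_fields M" and p: "p \<in> points M"
    and lX: "\<And>q. q \<in> points M \<Longrightarrow> l0 q (X q) = X q" and lY: "\<And>q. q \<in> points M \<Longrightarrow> l0 q (Y q) = Y q"
  shows "l0 p (lie_bracket M X Y p) = lie_bracket M X Y p"
proof -
  define X1 where "X1 = (\<lambda>q. k0 q (X q))"
  define Y1 where "Y1 = (\<lambda>q. k0 q (Y q))"
  have X1: "X1 \<in> vector_fields M" and Y1: "Y1 \<in> vector_fields M" unfolding X1_def Y1_def by (rule vf_k0, rule X Y)+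
  have "lie_bracket M X Y p = lie_bracket M (\<lambda>q. F q (X1 q)) (\<lambda>q. F q (Y1 q)) p"
    by (rule lie_bracket_local[OF X vf_F[OF X1] Y vf_F[OF Y1] openin_topspace p])
      (simp_all add: X1_def Y1_def lX lY flip: l0_def)
  also have "\<dots> = F p (lie_bracket M (\<lambda>q. F q (X1 q)) Y1 p + lie_bracket M X1 (\<lambda>q. F q (Y1 q)) p - F p (lie_bracket M X1 Y1 p))"
  proof -
    note m = lie_bracket_tangent[OF _ _ p]
    have a: "lie_bracket M (\<lambda>q. F q (X1 q)) Y1 p \<in> tangent_space M p" by (rule m[OF vf_F[OF X1] Y1])
    have b: "lie_bracket M X1 (\<lambda>q. F q (Y1 q)) p \<in> tangent_space M p" by (rule m[OF X1 vf_F[OF Y1]])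
    have c: "F p (lie_bracket M X1 Y1 p) \<in> tangent_space M p" by (rule Fm[OF p m[OF X1 Y1]])
    show ?thesis
      unfolding tensor_diff[OF F p tangent_plus[OF a b] c] tensor_add[OF F p a b]
      by (rule eq_sum_diffI) (use N0[OF X1 Y1 p] in \<open>simp only: nijenhuis_def\<close>)
  qed
  finally have e: "lie_bracket M X Y p = \<dots>" .
  have "lie_bracket M (\<lambda>q. F q (X1 q)) Y1 p + lie_bracket M X1 (\<lambda>q. F q (Y1 q)) p - F p (lie_bracket M X1 Y1 p) \<in> tangent_space M p"
    by (intro tangent_minus tangent_plus lie_bracket_tangent Fm vf_F X1 Y1 p)
  from l0_F[OF p this] show ?thesis unfolding e .
qed

lemma involutive_m0:
  assumes N0: "\<And>X Y p. X \<in> vector_fields M \<Longrightarrow> Y \<in> vector_fields M \<Longrightarrow> p \<in> points M \<Longrightarrow> NF X Y p = 0"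
    and X: "X \<in> vector_fields M" and Y: "Y \<in> vector_fields M" and p: "p \<in> points M"
    and mX: "\<And>q. q \<in> points M \<Longrightarrow> m0 q (X q) = X q" and mY: "\<And>q. q \<in> points M \<Longrightarrow> m0 q (Y q) = Y q"
  shows "m0 p (lie_bracket M X Y p) = lie_bracket M X Y p"
proof -
  note b = lie_bracket_tangent[OF X Y p]
  have "F q (X q) = 0" "F q (Y q) = 0" if "q \<in> points M" for q
    using F_eq_0_iff[OF that vector_fieldD(1)[OF X that]] F_eq_0_iff[OF that vector_fieldD(1)[OF Y that]] mX[OF that] mY[OF that] by simp_all
  then have "F p (F p (lie_bracket M X Y p)) = 0"
    using nijenhuis_kernel[OF p X _ Y] N0[OF X Y p] by simp
  \<comment> \<open>k0 undoes F on Im F, so F^2 [X, Y] = 0 forces F [X, Y] = 0.\<close>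
  then have "k0 p (F p (F p (lie_bracket M X Y p))) = 0" using tensor_zero[OF tensor_k0 p] by simp
  then have "F p (lie_bracket M X Y p) = 0" by (simp only: k0_F[OF p Fm[OF p b]] l0_F[OF p b])
  then show ?thesis using F_eq_0_iff[OF p b] by simp
qed

text \<open>Collects what both directions need from a leaf of \<open>D_l\<close>. F maps into Im l0,
  the tangent space of the leaf, so it induces a tensor there; l0 X restricts to a smooth field on
  the leaf, and the Nijenhuis tensor of related fields is related.\<close>

lemma leaf_nijenhuis:
  assumes N: "integral_manifold M (D_l M K \<alpha> \<beta> F) N"
  obtains d where "immersion M N n d" "tensor_field11 N (induced_tensor M N F)"
    "\<And>X. X \<in> vector_fields M \<Longrightarrow> immersion.restrict_field M N (\<lambda>q. l0 q (X q)) \<in> vector_fields N"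
    "\<And>X q. X \<in> vector_fields M \<Longrightarrow> q \<in> points N \<Longrightarrow>
      push_forward M id (immersion.restrict_field M N (\<lambda>q. l0 q (X q)) q) = l0 q (X q)"
    "\<And>X Y q. X \<in> vector_fields M \<Longrightarrow> Y \<in> vector_fields M \<Longrightarrow> q \<in> points N \<Longrightarrow>
      push_forward M id (nijenhuis (lie_bracket N) (induced_tensor M N F) (immersion.restrict_field M N (\<lambda>q. l0 q (X q)))
        (immersion.restrict_field M N (\<lambda>q. l0 q (Y q))) q) = NF (\<lambda>q. l0 q (X q)) (\<lambda>q. l0 q (Y q)) q"
    "\<And>q v. q \<in> points N \<Longrightarrow> v \<in> tangent_space N q \<Longrightarrow> l0 q (push_forward M id v) = push_forward M id v"
proof -
  obtain d where im: "immersion M N n d"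
    and eq: "\<And>q. q \<in> points N \<Longrightarrow> push_forward M id ` tangent_space N q = l0 q ` tangent_space M q"
    using integral_manifold_projection[OF N D_l_eq] by blast
  interpret i: immersion M N n d by (rule im)
  have qM: "q \<in> points M" if "q \<in> points N" for q using that i.points_sub by blast
  have FN: "F q (i.push v) \<in> i.push ` tangent_space N q" if q: "q \<in> points N" and v: "v \<in> tangent_space N q" for q v
    unfolding eq[OF q] using l0_F[OF qM[OF q] i.push_tangent[OF v]] Fm[OF qM[OF q] i.push_tangent[OF v]] by (metis imageI)
  have lN: "l0 q (X q) \<in> i.push ` tangent_space N q" if "X \<in> vector_fields M" "q \<in> points N" for X q
    unfolding eq[OF that(2)] by (rule imageI) (rule vector_fieldD(1)[OF that(1) qM[OF that(2)]])
  have iT: "tensor_field11 N (induced_tensor M N F)" by (rule i.tensor_induced_tensor[OF F FN])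
  have r1: "i.restrict_field (\<lambda>q. l0 q (X q)) \<in> vector_fields N" if X: "X \<in> vector_fields M" for X
    by (rule i.restrict_field(1)[OF vf_l0[OF X] lN[OF X]])
  have r2: "i.push (i.restrict_field (\<lambda>q. l0 q (X q)) q) = l0 q (X q)"
    if X: "X \<in> vector_fields M" and q: "q \<in> points N" for X q
    by (rule i.restrict_field(2)[OF vf_l0[OF X] lN[OF X] q])
  show ?thesis
  proof (rule that[OF im iT r1 r2])
    show "i.push (nijenhuis (lie_bracket N) (induced_tensor M N F) (i.restrict_field (\<lambda>q. l0 q (X q)))
        (i.restrict_field (\<lambda>q. l0 q (Y q))) q) = NF (\<lambda>q. l0 q (X q)) (\<lambda>q. l0 q (Y q)) q"
      if X: "X \<in> vector_fields M" and Y: "Y \<in> vector_fields M" and q: "q \<in> points N" for X Y q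
      by (rule i.push_nijenhuis[OF F FN vf_l0[OF X] r1[OF X] r2[OF X] vf_l0[OF Y] r1[OF Y] r2[OF Y] q])
    show "l0 q (i.push v) = i.push v" if "q \<in> points N" "v \<in> tangent_space N q" for q v
      using eq[OF that(1)] image_fixed[OF qM[OF that(1)]] that(2) by blast
  qed
qed

lemma completely_integrable_if:
  assumes N0: "\<And>X Y p. X \<in> vector_fields M \<Longrightarrow> Y \<in> vector_fields M \<Longrightarrow> p \<in> points M \<Longrightarrow> NF X Y p = 0"
  shows "completely_integrable M K \<alpha> \<beta> F"
  unfolding completely_integrable_def
proof (intro conjI allI impI)
  show "integrable_distribution M (D_l M K \<alpha> \<beta> F)"
    by (rule integrable_distribution_projection[OF tensor_l0 l0_idem involutive_l0[OF N0] D_l_eq])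
  show "integrable_distribution M (D_m M K \<alpha> \<beta> F)"
    by (rule integrable_distribution_projection[OF tensor_m0 m0_idem involutive_m0[OF N0] D_m_eq])
  fix N assume "integral_manifold M (D_l M K \<alpha> \<beta> F) N"
  then show "integrable_tensor N (induced_tensor M N F)"
  proof (rule leaf_nijenhuis)
    fix d
    let ?r = "\<lambda>X. immersion.restrict_field M N (\<lambda>q. l0 q (X q))"
    assume im: "immersion M N n d" and T: "tensor_field11 N (induced_tensor M N F)"
      and r1: "\<And>X. X \<in> vector_fields M \<Longrightarrow> ?r X \<in> vector_fields N"
      and r2: "\<And>X q. X \<in> vector_fields M \<Longrightarrow> q \<in> points N \<Longrightarrow> push_forward M id (?r X q) = l0 q (X q)"
      and nij: "\<And>X Y q. X \<in> vector_fields M \<Longrightarrow> Y \<in> vector_fields M \<Longrightarrow> q \<in> points N \<Longrightarrow>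
        push_forward M id (nijenhuis (lie_bracket N) (induced_tensor M N F) (?r X) (?r Y) q) = NF (\<lambda>q. l0 q (X q)) (\<lambda>q. l0 q (Y q)) q"
      and lp: "\<And>q v. q \<in> points N \<Longrightarrow> v \<in> tangent_space N q \<Longrightarrow> l0 q (push_forward M id v) = push_forward M id v"
    interpret i: immersion M N n d by (rule im)
    show ?thesis
      unfolding integrable_tensor_def
    proof (intro ballI)
      fix X Y p assume X: "X \<in> vector_fields N" and Y: "Y \<in> vector_fields N" and p: "p \<in> points N"
      have pM: "p \<in> points M" using p i.points_sub by blast
      \<comment> \<open>Only the value at p is extended: a field on M through the pushed-forward
        vector, whose l0-part restricts to a leaf field with the same value at p because l0 fixes
        vectors tangent to the leaf.\<close>
      have ext: "\<exists>X'. X' \<in> vector_fields M \<and> ?r X' p = X p" if X: "X \<in> vector_fields N" for X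
      proof -
        note Xp = i.N.vector_fieldD(1)[OF X p]
        obtain X' where X': "X' \<in> vector_fields M" "X' p = i.push (X p)"
          using vector_field_through[OF pM i.push_tangent[OF Xp]] by blast
        have "i.push (?r X' p) = i.push (X p)" using r2[OF X'(1) p] X'(2) lp[OF p Xp] by simp
        then have "?r X' p = X p" by (rule i.push_eqD[OF p i.N.vector_fieldD(1)[OF r1[OF X'(1)] p] Xp])
        then show ?thesis using X'(1) by blast
      qed
      obtain X' where X': "X' \<in> vector_fields M" "?r X' p = X p" using ext[OF X] by blast
      obtain Y' where Y': "Y' \<in> vector_fields M" "?r Y' p = Y p" using ext[OF Y] by blast
      let ?N = "nijenhuis (lie_bracket N) (induced_tensor M N F)"
      have "i.push (?N (?r X') (?r Y') p) = i.push 0"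
        using nij[OF X'(1) Y'(1) p] N0[OF vf_l0[OF X'(1)] vf_l0[OF Y'(1)] pM] by (simp add: i.push_zero)
      then have "?N (?r X') (?r Y') p = 0"
        by (rule i.push_eqD[OF p i.N.nijenhuis_tangent[OF T r1[OF X'(1)] r1[OF Y'(1)] p] i.N.tangent_zero])
      then show "?N X Y p = 0"
        using i.N.nijenhuis_pointwise[OF T r1[OF X'(1)] X r1[OF Y'(1)] Y p X'(2) Y'(2)] by simp
    qed
  qed
qed

lemma nijenhuis_split:
  assumes ci: "completely_integrable M K \<alpha> \<beta> F"
    and X: "X \<in> vector_fields M" and Y: "Y \<in> vector_fields M" and p: "p \<in> points M"
  shows "NF X Y p = NF (\<lambda>q. l0 q (X q)) (\<lambda>q. m0 q (Y q)) p + NF (\<lambda>q. m0 q (X q)) (\<lambda>q. l0 q (Y q)) p"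
proof -
  have dl: "integrable_distribution M (D_l M K \<alpha> \<beta> F)" and dm: "integrable_distribution M (D_m M K \<alpha> \<beta> F)"
    and leaf: "\<And>N. integral_manifold M (D_l M K \<alpha> \<beta> F) N \<Longrightarrow> integrable_tensor N (induced_tensor M N F)"
    using ci by (auto simp: completely_integrable_def)
  let ?lX = "\<lambda>q. l0 q (X q)" and ?mX = "\<lambda>q. m0 q (X q)" and ?lY = "\<lambda>q. l0 q (Y q)" and ?mY = "\<lambda>q. m0 q (Y q)"
  have split: "(\<lambda>q. l0 q (Z q) + m0 q (Z q)) = Z" for Z :: "'m \<Rightarrow> 'm tangent"
    by (rule ext) (simp only: m0_def add_diff_cancel_left' diff_add_cancel add.commute[of "l0 _ _"])
  have left: "NF Z V p = NF (\<lambda>q. l0 q (Z q)) V p + NF (\<lambda>q. m0 q (Z q)) V p"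
    if "Z \<in> vector_fields M" "V \<in> vector_fields M" for Z V
    using nijenhuis_add_left[OF F vf_l0[OF that(1)] vf_m0[OF that(1)] that(2) p] by (simp only: split)
  have right: "NF V Z p = NF V (\<lambda>q. l0 q (Z q)) p + NF V (\<lambda>q. m0 q (Z q)) p"
    if Z: "Z \<in> vector_fields M" and V: "V \<in> vector_fields M" for Z V
    unfolding nijenhuis_antisym[OF F V Z p] nijenhuis_antisym[OF F V vf_l0[OF Z] p] nijenhuis_antisym[OF F V vf_m0[OF Z] p] left[OF Z V]
    by (simp only: minus_add_distrib)
  have ll: "NF ?lX ?lY p = 0"
  proof -
    obtain N where N: "integral_manifold M (D_l M K \<alpha> \<beta> F) N" and pN: "p \<in> points N"
      using dl p by (auto simp: integrable_distribution_def)
    from N show ?thesis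
    proof (rule leaf_nijenhuis)
      fix d
      let ?r = "\<lambda>X. immersion.restrict_field M N (\<lambda>q. l0 q (X q))"
      assume im: "immersion M N n d"
        and r1: "\<And>X. X \<in> vector_fields M \<Longrightarrow> ?r X \<in> vector_fields N"
        and nij: "\<And>X Y q. X \<in> vector_fields M \<Longrightarrow> Y \<in> vector_fields M \<Longrightarrow> q \<in> points N \<Longrightarrow>
          push_forward M id (nijenhuis (lie_bracket N) (induced_tensor M N F) (?r X) (?r Y) q) = NF (\<lambda>q. l0 q (X q)) (\<lambda>q. l0 q (Y q)) q"
      interpret i: immersion M N n d by (rule im)
      have "nijenhuis (lie_bracket N) (induced_tensor M N F) (?r X) (?r Y) p = 0"
        using leaf[OF N] r1[OF X] r1[OF Y] pN by (simp add: integrable_tensor_def)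
      then show ?thesis using nij[OF X Y pN] by (simp add: i.push_zero)
    qed
  qed
  have mm: "NF ?mX ?mY p = 0"
  proof -
    have k: "F q (m0 q (Z q)) = 0" if "Z \<in> vector_fields M" "q \<in> points M" for Z q
      by (rule F_m0[OF that(2) vector_fieldD(1)[OF that]])
    have "lie_bracket M ?mX ?mY p \<in> m0 p ` tangent_space M p"
      by (rule projection_bracket[OF D_m_eq dm p vf_m0[OF X] _ vf_m0[OF Y]]) (simp_all add: vector_fieldD(1)[OF X] vector_fieldD(1)[OF Y])
    then have "F p (lie_bracket M ?mX ?mY p) = 0" using F_m0[OF p] by auto
    then show ?thesis
      using nijenhuis_kernel[OF p vf_m0[OF X] k[OF X] vf_m0[OF Y] k[OF Y]] tensor_zero[OF F p] by simp
  qed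
  have "NF X Y p = (NF ?lX ?lY p + NF ?lX ?mY p) + (NF ?mX ?lY p + NF ?mX ?mY p)"
    by (simp only: left[OF X Y] right[OF Y vf_l0[OF X]] right[OF Y vf_m0[OF X]])
  then show ?thesis by (simp only: ll mm add_0 add_0_right)
qed

text \<open>On real fields \<open>l_op\<close> and \<open>m_op\<close> have zero imaginary part, so
  the complex condition of the theorem is an identity between real Nijenhuis tensors in the first
  component.\<close>

lemma mixed_nijenhuis:
  assumes X: "X \<in> vector_fields M" and Y: "Y \<in> vector_fields M" and p: "p \<in> points M"
  shows "nijenhuis (clie_bracket M) (\<lambda>q. cextend (F q)) (\<lambda>q. l_op K \<alpha> \<beta> (F q) (X q, 0)) (\<lambda>q. m_op K \<alpha> \<beta> (F q) (Y q, 0)) p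
      = (NF (\<lambda>q. l0 q (X q)) (\<lambda>q. m0 q (Y q)) p, 0)"
    "nijenhuis (clie_bracket M) (\<lambda>q. cextend (F q)) (\<lambda>q. m_op K \<alpha> \<beta> (F q) (X q, 0)) (\<lambda>q. l_op K \<alpha> \<beta> (F q) (Y q, 0)) p
      = (NF (\<lambda>q. m0 q (X q)) (\<lambda>q. l0 q (Y q)) p, 0)"
proof -
  have l: "l_op K \<alpha> \<beta> (F q) (Z q, 0) = (l0 q (Z q), 0)" and m: "m_op K \<alpha> \<beta> (F q) (Z q, 0) = (m0 q (Z q), 0)"
    if "Z \<in> vector_fields M" "q \<in> points M" for Z q
    using l_op_eq[OF that(2) vector_fieldD(1)[OF that] tangent_zero] m_op_eq[OF that(2) vector_fieldD(1)[OF that] tangent_zero]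
      tensor_zero[OF tensor_l0 that(2)] tensor_zero[OF tensor_m0 that(2)] by simp_all
  show "nijenhuis (clie_bracket M) (\<lambda>q. cextend (F q)) (\<lambda>q. l_op K \<alpha> \<beta> (F q) (X q, 0)) (\<lambda>q. m_op K \<alpha> \<beta> (F q) (Y q, 0)) p
      = (NF (\<lambda>q. l0 q (X q)) (\<lambda>q. m0 q (Y q)) p, 0)"
    by (rule nijenhuis_real[OF F vf_l0[OF X] l[OF X] vf_m0[OF Y] m[OF Y] p])
  show "nijenhuis (clie_bracket M) (\<lambda>q. cextend (F q)) (\<lambda>q. m_op K \<alpha> \<beta> (F q) (X q, 0)) (\<lambda>q. l_op K \<alpha> \<beta> (F q) (Y q, 0)) p
      = (NF (\<lambda>q. m0 q (X q)) (\<lambda>q. l0 q (Y q)) p, 0)"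
    by (rule nijenhuis_real[OF F vf_m0[OF X] m[OF X] vf_l0[OF Y] l[OF Y] p])
qed

end

theorem theorem6p6:
  fixes M :: "('m, 'e::euclidean_space) manifold"
    and n r K :: nat and \<alpha> \<beta> :: complex
    and F :: "'m \<Rightarrow> 'm tangent \<Rightarrow> 'm tangent"
  assumes "F_structure_manifold M n r K \<alpha> \<beta> F"
  shows "integrable_tensor M F \<longleftrightarrow>
    completely_integrable M K \<alpha> \<beta> F \<and>
    (\<forall>X\<in>vector_fields M. \<forall>Y\<in>vector_fields M. \<forall>p\<in>points M.
       nijenhuis (clie_bracket M) (\<lambda>q. cextend (F q))
         (\<lambda>q. l_op K \<alpha> \<beta> (F q) (X q, 0)) (\<lambda>q. m_op K \<alpha> \<beta> (F q) (Y q, 0)) p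
       = - nijenhuis (clie_bracket M) (\<lambda>q. cextend (F q))
         (\<lambda>q. m_op K \<alpha> \<beta> (F q) (X q, 0)) (\<lambda>q. l_op K \<alpha> \<beta> (F q) (Y q, 0)) p)"
proof -
  interpret F_manifold M n r K \<alpha> \<beta> F
  proof
    show "smooth_manifold n M" using assms by (simp add: F_structure_manifold_def)
  qed (rule assms)
  show ?thesis
  proof
    assume "integrable_tensor M F"
    then have N0: "NF X Y p = 0" if "X \<in> vector_fields M" "Y \<in> vector_fields M" "p \<in> points M" for X Y p
      using that by (simp add: integrable_tensor_def)
    then show "completely_integrable M K \<alpha> \<beta> F \<and>
      (\<forall>X\<in>vector_fields M. \<forall>Y\<in>vector_fields M. \<forall>p\<in>points M.
       nijenhuis (clie_bracket M) (\<lambda>q. cextend (F q))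
         (\<lambda>q. l_op K \<alpha> \<beta> (F q) (X q, 0)) (\<lambda>q. m_op K \<alpha> \<beta> (F q) (Y q, 0)) p
       = - nijenhuis (clie_bracket M) (\<lambda>q. cextend (F q))
         (\<lambda>q. m_op K \<alpha> \<beta> (F q) (X q, 0)) (\<lambda>q. l_op K \<alpha> \<beta> (F q) (Y q, 0)) p)"
      using completely_integrable_if vf_l0 vf_m0 by (simp add: mixed_nijenhuis)
  next
    assume R: "completely_integrable M K \<alpha> \<beta> F \<and>
      (\<forall>X\<in>vector_fields M. \<forall>Y\<in>vector_fields M. \<forall>p\<in>points M.
       nijenhuis (clie_bracket M) (\<lambda>q. cextend (F q))
         (\<lambda>q. l_op K \<alpha> \<beta> (F q) (X q, 0)) (\<lambda>q. m_op K \<alpha> \<beta> (F q) (Y q, 0)) p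
       = - nijenhuis (clie_bracket M) (\<lambda>q. cextend (F q))
         (\<lambda>q. m_op K \<alpha> \<beta> (F q) (X q, 0)) (\<lambda>q. l_op K \<alpha> \<beta> (F q) (Y q, 0)) p)"
    show "integrable_tensor M F"
      unfolding integrable_tensor_def
    proof (intro ballI)
      fix X Y p assume X: "X \<in> vector_fields M" and Y: "Y \<in> vector_fields M" and p: "p \<in> points M"
      have "(NF (\<lambda>q. l0 q (X q)) (\<lambda>q. m0 q (Y q)) p, 0) = - (NF (\<lambda>q. m0 q (X q)) (\<lambda>q. l0 q (Y q)) p, 0 :: 'm tangent)"
        using R X Y p by (simp only: mixed_nijenhuis[OF X Y p, symmetric])
      then have "NF (\<lambda>q. l0 q (X q)) (\<lambda>q. m0 q (Y q)) p = - NF (\<lambda>q. m0 q (X q)) (\<lambda>q. l0 q (Y q)) p"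
        by (simp only: uminus_prod_def fst_conv prod.inject)
      then show "NF X Y p = 0"
        using nijenhuis_split[OF conjunct1[OF R] X Y p] by (simp only: left_minus)
    qed
  qed
qed

end
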